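(* Let $K$ be an algebraically closed field of characteristic $0$ and let $(0)\neq I\subset K[x_1,\ldots,x_n]$ be a maximal-gdepth graded ideal with $\dim(I)=m$ and $0<\operatorname{depth}(I)=t<m-1$, and let $c$ be the maximal total degree of a minimal monomial generator of a generic initial ideal of $I$ (over all generic initial ideals of $I$). Let $\omega\in\operatorname{gT}(I)$ with $$0=\omega_1=\ldots=\omega_{n-m+1}<\omega_{n-m+2}\leq\ldots\leq\omega_{n-t}<\omega_{n-t+1},\ldots,\omega_n$$ (i.e. $\omega_{n-t}<\omega_j$ for all $j>n-t$) such that $c\,\omega_{n-t}<\omega_j$ for all $j>n-t$, and suppose $\omega\in\mathring{C}$ for some maximal cone $C$ of $\operatorname{gT}(I)$. Then $$\omega+\operatorname{cone}(e_{n-t+1},\ldots,e_n)\subset\mathring{C},$$ where $e_i$ denotes the $i$th standard basis vector of $\mathbb{R}^n$.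
   Context: $\dim I$ is the Krull dimension of $R_I=K[x_1,\ldots,x_n]/I$; $\operatorname{depth}(I)$ is the maximal length of a regular sequence of linear forms on $R_I$. $\mathring{C}$ is the relative interior of $C$; $\operatorname{cone}(\ldots)$ is the set of nonnegative real linear combinations. For $\omega\in\mathbb{R}^n$ the $\omega$-weight of a term $cx^\nu$ is $\omega\cdot\nu$; $\operatorname{in}_\omega(f)$ is the sum of the terms of $f$ of minimal $\omega$-weight; $\operatorname{in}_\omega(I)=(\operatorname{in}_\omega(f):f\in I)$. For a term order $\succ$, $\operatorname{in}_\succ(f)$ is the $\succ$-largest term of $f$ and $\operatorname{in}_\succ(I)$ the ideal generated by these. The Gröbner fan $\operatorname{GF}(I)$ is the complete fan in which $\omega,\omega'$ lie in the same relatively open cone iff $\operatorname{in}_\omega(I)=\operatorname{in}_{\omega'}(I)$. The tropical variety $T(I)=\{\omega\in\mathbb{R}^n:\operatorname{in}_\omega(I)\text{ contains no monomial}\}$ is a subfan of $\operatorname{GF}(I)$. A matrix $g\in\operatorname{GL}_n(K)$ acts by $x_i\mapsto\sum_j g_{ji}x_j$. It is known that if $\dim I>0$ there is a nonempty Zariski-open $U\subset\operatorname{GL}_n(K)$ such that for all $g\in U$: $\operatorname{GF}(g(I))$ is one and the same fan, $T(g(I))$ is one and the same fan, denoted $\operatorname{gT}(I)$ (generic tropical variety), and for every term order $\succ$, $\operatorname{in}_\succ(g(I))$ is one and the same ideal $\operatorname{gin}_\succ(I)$ (generic initial ideal; there are only finitely many of these). $\operatorname{gdepth}(I)=\min_\succ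 \operatorname{depth}(\operatorname{gin}_\succ(I))$ over all generic initial ideals of $I$; $I$ is maximal-gdepth if $\operatorname{depth}(I)=\operatorname{gdepth}(I)$. *)

theory Defs
  imports
    "HOL-Analysis.Analysis"
    "HOL-Library.Poly_Mapping"
    "HOL-Library.Extended_Nat"
    "HOL-Algebra.QuotRing"
begin

text \<open>
  The variables are indexed by a finite type \<open>'n\<close>, so that \<open>n\<close> is \<open>CARD('n)\<close>. A monomial is
  its exponent vector, and \<open>single \<nu> c\<close> is the term \<open>c x\<^sup>\<nu>\<close>.
\<close>

type_synonym 'n mon = "'n \<Rightarrow>\<^sub>0 nat"
type_synonym ('n, 'k) mpol = "'n mon \<Rightarrow>\<^sub>0 'k"

definition mpol_ring :: "('n, 'k::field) mpol ring" where
  "mpol_ring = \<lparr>carrier = UNIV, monoid.mult = (*), one = 1, ring.zero = 0, add = (+)\<rparr>"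

definition mon_deg :: "'n::finite mon \<Rightarrow> nat" where
  "mon_deg \<nu> = (\<Sum>i\<in>UNIV. Poly_Mapping.lookup \<nu> i)"

definition homogeneous :: "nat \<Rightarrow> ('n::finite, 'k::field) mpol \<Rightarrow> bool" where
  "homogeneous d f \<longleftrightarrow> (\<forall>\<nu>\<in>Poly_Mapping.keys f. mon_deg \<nu> = d)"

definition graded_ideal :: "('n::finite, 'k::field) mpol set \<Rightarrow> bool" where
  "graded_ideal I \<longleftrightarrow>
     ideal I mpol_ring \<and> (\<exists>S. (\<forall>f\<in>S. \<exists>d. homogeneous d f) \<and> I = Idl\<^bsub>mpol_ring\<^esub> S)"


subsection \<open>Dimension and depth\<close>

text \<open>Values in \<^typ>\<open>enat\<close> make the suprema meaningful without a boundedness proof.\<close>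

definition krull_dim :: "('a, 'b) ring_scheme \<Rightarrow> enat" where
  "krull_dim S =
     Sup {enat k | k. \<exists>P :: nat \<Rightarrow> 'a set.
            (\<forall>i\<le>k. primeideal (P i) S) \<and> (\<forall>i<k. P i \<subset> P (Suc i))}"

definition dim_ideal :: "('n::finite, 'k::field) mpol set \<Rightarrow> enat" where
  "dim_ideal I = krull_dim (mpol_ring Quot I)"

text \<open>
  That \<open>x\<^sub>i\<close> is a nonzerodivisor on \<open>S/(x\<^sub>0, \<dots>, x\<^sub>i\<^sub>-\<^sub>1)\<close> is expressed by
  representatives in \<open>S\<close>.
\<close>

definition regular_sequence :: "('a, 'b) ring_scheme \<Rightarrow> 'a list \<Rightarrow> bool" where
  "regular_sequence S xs \<longleftrightarrow>
     set xs \<subseteq> carrier S \<and>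
     (\<forall>i<length xs. \<forall>y\<in>carrier S.
        xs ! i \<otimes>\<^bsub>S\<^esub> y \<in> Idl\<^bsub>S\<^esub> (set (take i xs)) \<longrightarrow> y \<in> Idl\<^bsub>S\<^esub> (set (take i xs))) \<and>
     Idl\<^bsub>S\<^esub> (set xs) \<noteq> carrier S"

definition depth_ideal :: "('n::finite, 'k::field) mpol set \<Rightarrow> enat" where
  "depth_ideal I =
     Sup {enat (length ls) | ls. (\<forall>l\<in>set ls. homogeneous 1 l) \<and>
            regular_sequence (mpol_ring Quot I) (map (\<lambda>l. I +>\<^bsub>mpol_ring\<^esub> l) ls)}"


subsection \<open>Initial ideals\<close>

definition weight :: "real^'n \<Rightarrow> 'n::finite mon \<Rightarrow> real" where
  "weight \<omega> \<nu> = (\<Sum>i\<in>UNIV. \<omega> $ i * real (Poly_Mapping.lookup \<nu> i))"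

definition in_weight :: "real^'n \<Rightarrow> ('n::finite, 'k::field) mpol \<Rightarrow> ('n, 'k) mpol" where
  "in_weight \<omega> f =
     (\<Sum>\<nu>\<in>{\<nu>\<in>Poly_Mapping.keys f. \<forall>\<mu>\<in>Poly_Mapping.keys f. weight \<omega> \<nu> \<le> weight \<omega> \<mu>}. Poly_Mapping.single \<nu> (Poly_Mapping.lookup f \<nu>))"

definition in_weight_ideal :: "real^'n \<Rightarrow> ('n::finite, 'k::field) mpol set \<Rightarrow> ('n, 'k) mpol set" where
  "in_weight_ideal \<omega> I = Idl\<^bsub>mpol_ring\<^esub> (in_weight \<omega> ` I)"

text \<open>A term order is given by its strict relation \<open>\<succ>\<close>.\<close>

definition term_order :: "('n mon \<Rightarrow> 'n mon \<Rightarrow> bool) \<Rightarrow> bool" where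
  "term_order gt \<longleftrightarrow>
     irreflp gt \<and> transp gt \<and> totalp gt \<and>
     (\<forall>\<nu>. \<nu> \<noteq> 0 \<longrightarrow> gt \<nu> 0) \<and>
     (\<forall>\<nu> \<mu> \<rho>. gt \<nu> \<mu> \<longrightarrow> gt (\<nu> + \<rho>) (\<mu> + \<rho>))"

text \<open>For a term order the sum has exactly one summand if \<open>f \<noteq> 0\<close>, and it is \<open>0\<close> for \<open>f = 0\<close>.\<close>

definition in_order :: "('n mon \<Rightarrow> 'n mon \<Rightarrow> bool) \<Rightarrow> ('n, 'k::field) mpol \<Rightarrow> ('n, 'k) mpol" where
  "in_order gt f =
     (\<Sum>\<nu>\<in>{\<nu>\<in>Poly_Mapping.keys f. \<forall>\<mu>\<in>Poly_Mapping.keys f. \<mu> \<noteq> \<nu> \<longrightarrow> gt \<nu> \<mu>}. Poly_Mapping.single \<nu> (Poly_Mapping.lookup f \<nu>))"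

definition in_order_ideal ::
  "('n mon \<Rightarrow> 'n mon \<Rightarrow> bool) \<Rightarrow> ('n, 'k::field) mpol set \<Rightarrow> ('n, 'k) mpol set" where
  "in_order_ideal gt I = Idl\<^bsub>mpol_ring\<^esub> (in_order gt ` I)"


subsection \<open>Groebner fan and tropical variety\<close>

text \<open>
  A fan is the set of its closed cones; the relatively open cone of \<open>\<omega>\<close> is the class
  of all \<open>\<omega>'\<close> with the same initial ideal.
\<close>

definition groebner_fan :: "('n::finite, 'k::field) mpol set \<Rightarrow> (real^'n) set set" where
  "groebner_fan I =
     range (\<lambda>\<omega>. closure {\<omega>'. in_weight_ideal \<omega>' I = in_weight_ideal \<omega> I})"

definition tropical_variety :: "('n::finite, 'k::field) mpol set \<Rightarrow> (real^'n) set" where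
  "tropical_variety I = {\<omega>. \<nexists>\<nu>. Poly_Mapping.single \<nu> 1 \<in> in_weight_ideal \<omega> I}"

definition tropical_fan :: "('n::finite, 'k::field) mpol set \<Rightarrow> (real^'n) set set" where
  "tropical_fan I = {C \<in> groebner_fan I. C \<subseteq> tropical_variety I}"

definition maximal_cone :: "'a set set \<Rightarrow> 'a set \<Rightarrow> bool" where
  "maximal_cone F C \<longleftrightarrow> C \<in> F \<and> (\<forall>D\<in>F. C \<subseteq> D \<longrightarrow> D = C)"

definition pos_cone :: "'a::real_vector set \<Rightarrow> 'a set" where
  "pos_cone S = {\<Sum>v\<in>T. a v *\<^sub>R v | T a. finite T \<and> T \<subseteq> S \<and> (\<forall>v\<in>T. 0 \<le> a v)}"


subsection \<open>Generic coordinates\<close>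

definition act :: "'k^'n^'n \<Rightarrow> ('n::finite, 'k::field) mpol \<Rightarrow> ('n, 'k) mpol" where
  "act g f =
     (\<Sum>\<nu>\<in>Poly_Mapping.keys f. Poly_Mapping.single 0 (Poly_Mapping.lookup f \<nu>) *
        (\<Prod>i\<in>UNIV. (\<Sum>j\<in>UNIV. Poly_Mapping.single (Poly_Mapping.single j 1) (g $ j $ i)) ^ Poly_Mapping.lookup \<nu> i))"

definition GL :: "('k::field^'n^'n::finite) set" where
  "GL = {g. invertible g}"

definition eval_entries :: "('n \<times> 'n, 'k) mpol \<Rightarrow> 'k::field^'n^'n::finite \<Rightarrow> 'k" where
  "eval_entries p g =
     (\<Sum>\<nu>\<in>Poly_Mapping.keys p. Poly_Mapping.lookup p \<nu> * (\<Prod>(i, j)\<in>UNIV. (g $ i $ j) ^ Poly_Mapping.lookup \<nu> (i, j)))"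

definition zariski_open_GL :: "('k::field^'n^'n::finite) set \<Rightarrow> bool" where
  "zariski_open_GL U \<longleftrightarrow> (\<exists>S. U = {g \<in> GL. \<exists>p\<in>S. eval_entries p g \<noteq> 0})"

definition generically :: "('k::field^'n^'n::finite \<Rightarrow> bool) \<Rightarrow> bool" where
  "generically P \<longleftrightarrow> (\<exists>U. zariski_open_GL U \<and> U \<noteq> {} \<and> (\<forall>g\<in>U. P g))"

text \<open>
  The generic tropical variety and the generic initial ideals are introduced as relations:
  they are the common value of \<open>T(g(I))\<close>, respectively \<open>in\<^sub>\<succ>(g(I))\<close>, on a nonempty Zariski-open
  set. Over an infinite field two such sets intersect, so this value is unique.
\<close>

definition is_gT :: "('n::finite, 'k::field) mpol set \<Rightarrow> (real^'n) set set \<Rightarrow> bool" where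
  "is_gT I F \<longleftrightarrow> generically (\<lambda>g. tropical_fan (act g ` I) = F)"

definition is_gin ::
  "('n mon \<Rightarrow> 'n mon \<Rightarrow> bool) \<Rightarrow> ('n::finite, 'k::field) mpol set \<Rightarrow> ('n, 'k) mpol set \<Rightarrow> bool" where
  "is_gin gt I J \<longleftrightarrow> generically (\<lambda>g. in_order_ideal gt (act g ` I) = J)"

definition gins :: "('n::finite, 'k::field) mpol set \<Rightarrow> ('n, 'k) mpol set set" where
  "gins I = {J. \<exists>gt. term_order gt \<and> is_gin gt I J}"

definition gdepth :: "('n::finite, 'k::field) mpol set \<Rightarrow> enat" where
  "gdepth I = (INF J\<in>gins I. depth_ideal J)"

definition maximal_gdepth :: "('n::finite, 'k::field) mpol set \<Rightarrow> bool" where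
  "maximal_gdepth I \<longleftrightarrow> depth_ideal I = gdepth I"

definition min_mon_gens :: "('n, 'k::field) mpol set \<Rightarrow> 'n mon set" where
  "min_mon_gens J =
     {\<nu>. Poly_Mapping.single \<nu> 1 \<in> J \<and>
         (\<forall>\<mu>. Poly_Mapping.single \<mu> 1 \<in> J \<and> (\<forall>i. Poly_Mapping.lookup \<mu> i \<le> Poly_Mapping.lookup \<nu> i) \<longrightarrow> \<mu> = \<nu>)}"

definition max_gin_degree :: "('n::finite, 'k::field) mpol set \<Rightarrow> enat" where
  "max_gin_degree I = (SUP J\<in>gins I. SUP \<nu>\<in>min_mon_gens J. enat (mon_deg \<nu>))"

end

theory Submission
  imports Defs "HOL-Computational_Algebra.Polynomial"
begin

text \<open>
  Let \<open>\<succ>\<close> be a term order that refines the weight \<open>\<omega>\<close>. The generic initial ideal with respect to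
  \<open>\<succ>\<close> has depth at least \<open>t\<close> because \<open>I\<close> is maximal-gdepth, and it is strongly stable because the
  characteristic is \<open>0\<close>. Hence its minimal generators, which have degree at most \<open>c\<close>, do not involve
  the \<open>t\<close> variables of largest weight. Elements of \<open>g(I)\<close> whose leading monomials are these generators
  therefore have initial forms of weight at most \<open>c \<omega>\<^sub>n\<^sub>-\<^sub>t\<close>, and such forms do not involve the last \<open>t\<close>
  variables either. So the initial forms, and with them the initial ideal, do not change if \<open>\<omega>\<close> is
  moved by a vector \<open>v\<close> in the cone. Finally, a class of the Groebner fan is convex, so \<open>\<omega> + v\<close>, being
  the midpoint of a point of the relative interior and of the point \<open>\<omega> + 2 v\<close> of the class, is in
  the relative interior.

  Ranks of projections to sets of coefficients take the place of exterior powers in the genericity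
  arguments.
\<close>

text \<open>Why ranks control genericity: in one degree, the number of leading monomials in a set
  closed towards larger monomials is the rank of the projection of the ideal to the coefficients in
  that set, and rank at least r is an open condition on the matrix. One degree thus costs finitely
  many open conditions. All degrees together cost infinitely many, and infinitely many nonempty open
  sets may have empty intersection. Dickson's lemma and a count in each degree remove this obstacle
  for the initial ideal itself; strong stability is proved one degree at a time, with a matrix of
  maximal rank for that degree.

  The generic initial ideal of the weight order has to be shown to exist, because
  \<open>gins\<close> collects only ideals attained on an open set, and the hypotheses on depth and
  on \<open>c\<close> speak about members of \<open>gins\<close> alone.

  A cone of \<open>groebner_fan\<close> is the closure of a class, and its relative interior is that
  of the class once the class is known to be convex. Convexity comes from reduced elements, which
  have one and the same initial form throughout a class.\<close>

abbreviation lookup :: "('a \<Rightarrow>\<^sub>0 'b::zero) \<Rightarrow> 'a \<Rightarrow> 'b" where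
  "lookup \<equiv> Poly_Mapping.lookup"

abbreviation keys :: "('a \<Rightarrow>\<^sub>0 'b::zero) \<Rightarrow> 'a set" where
  "keys \<equiv> Poly_Mapping.keys"

abbreviation single :: "'a \<Rightarrow> 'b \<Rightarrow> ('a \<Rightarrow>\<^sub>0 'b::zero)" where
  "single \<equiv> Poly_Mapping.single"


text \<open>This destruction rule and \<open>in_keys_iff\<close> undo each other in \<open>auto\<close>.\<close>

declare lookup_eq_zero_in_keys_contradict [rule del]


section \<open>Polynomials as finitely supported functions\<close>

lemma poly_mapping_sum_single:
  fixes f :: "'a \<Rightarrow>\<^sub>0 'b::comm_monoid_add"
  assumes "finite A" "keys f \<subseteq> A"
  shows "(\<Sum>\<nu>\<in>A. single \<nu> (lookup f \<nu>)) = f"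
proof (rule poly_mapping_eqI)
  fix \<mu>
  have "lookup (\<Sum>\<nu>\<in>A. single \<nu> (lookup f \<nu>)) \<mu> = (\<Sum>\<nu>\<in>A. if \<nu> = \<mu> then lookup f \<nu> else 0)"
    by (simp add: lookup_sum lookup_single when_def)
  also have "\<dots> = lookup f \<mu>"
    using assms by (auto simp: not_in_keys_iff_lookup_eq_zero[symmetric])
  finally show "lookup (\<Sum>\<nu>\<in>A. single \<nu> (lookup f \<nu>)) \<mu> = lookup f \<mu>" .
qed

lemma poly_mapping_sum_induct [case_names zero single add]:
  fixes f :: "'a \<Rightarrow>\<^sub>0 'b::comm_monoid_add"
  assumes "P 0" "\<And>\<nu> c. P (single \<nu> c)" "\<And>f g. P f \<Longrightarrow> P g \<Longrightarrow> P (f + g)"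
  shows "P f"
proof -
  have "P (\<Sum>\<nu>\<in>A. single \<nu> (lookup f \<nu>))" if "finite A" for A
    using that by induction (auto intro: assms)
  from this[of "keys f"] show ?thesis
    by (simp add: poly_mapping_sum_single)
qed

lemma lookup_single_mult:
  fixes f :: "'a::cancel_comm_monoid_add \<Rightarrow>\<^sub>0 'b::semiring_0"
  shows "lookup (single a c * f) (a + \<nu>) = c * lookup f \<nu>"
  by (induction f rule: poly_mapping_sum_induct)
    (auto simp: mult_single lookup_single when_def distrib_left lookup_add)

lemma lookup_single_mult_eq_0:
  fixes f :: "'a::cancel_comm_monoid_add \<Rightarrow>\<^sub>0 'b::semiring_0"
  assumes "\<And>\<nu>. \<mu> \<noteq> a + \<nu>"
  shows "lookup (single a c * f) \<mu> = 0"
  using assms[symmetric]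
  by (induction f rule: poly_mapping_sum_induct)
    (auto simp: mult_single lookup_single when_def distrib_left lookup_add)

lemma keys_single_mult_subset:
  fixes f :: "'a::cancel_comm_monoid_add \<Rightarrow>\<^sub>0 'b::semiring_0"
  shows "keys (single a c * f) \<subseteq> (+) a ` keys f"
proof
  fix \<mu> assume \<mu>: "\<mu> \<in> keys (single a c * f)"
  then obtain \<nu> where \<nu>: "\<mu> = a + \<nu>"
    using lookup_single_mult_eq_0[of \<mu> a c f] by (auto simp: in_keys_iff)
  with \<mu> have "\<nu> \<in> keys f"
    by (auto simp: in_keys_iff lookup_single_mult)
  with \<nu> show "\<mu> \<in> (+) a ` keys f"
    by blast
qed

lemma keys_single_mult:
  fixes f :: "'a::cancel_comm_monoid_add \<Rightarrow>\<^sub>0 'b::semiring_no_zero_divisors"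
  assumes "c \<noteq> 0"
  shows "keys (single a c * f) = (+) a ` keys f"
proof
  show "(+) a ` keys f \<subseteq> keys (single a c * f)"
  proof (rule image_subsetI)
    fix \<nu> assume "\<nu> \<in> keys f"
    then show "a + \<nu> \<in> keys (single a c * f)"
      using assms unfolding in_keys_iff lookup_single_mult by (metis no_zero_divisors)
  qed
qed (rule keys_single_mult_subset)

lemma lookup_scale:
  fixes f :: "'a::cancel_comm_monoid_add \<Rightarrow>\<^sub>0 'b::semiring_0"
  shows "lookup (single 0 c * f) \<nu> = c * lookup f \<nu>"
  using lookup_single_mult[of 0 c f \<nu>] by simp

section \<open>Restriction to sets of monomials\<close>

definition restr :: "'a set \<Rightarrow> ('a \<Rightarrow>\<^sub>0 'b) \<Rightarrow> ('a \<Rightarrow>\<^sub>0 'b::comm_monoid_add)" where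
  "restr A f = (\<Sum>\<nu>\<in>keys f \<inter> A. single \<nu> (lookup f \<nu>))"

lemma lookup_restr: "lookup (restr A f) \<nu> = (if \<nu> \<in> A then lookup f \<nu> else 0)"
proof -
  have "lookup (restr A f) \<nu> = (\<Sum>\<mu>\<in>keys f \<inter> A. if \<mu> = \<nu> then lookup f \<mu> else 0)"
    by (simp add: restr_def lookup_sum lookup_single when_def)
  also have "\<dots> = (if \<nu> \<in> A then lookup f \<nu> else 0)"
    by (auto simp: in_keys_iff)
  finally show ?thesis .
qed

lemma keys_restr: "keys (restr A f) = keys f \<inter> A"
  unfolding set_eq_iff Int_iff in_keys_iff lookup_restr by simp

lemma restr_0 [simp]: "restr A 0 = 0"
  by (simp add: restr_def)

lemma restr_add: "restr A (f + g) = restr A f + restr A g"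
  by (rule poly_mapping_eqI) (simp add: lookup_restr lookup_add)

lemma restr_restr: "restr A (restr B f) = restr (A \<inter> B) f"
  by (rule poly_mapping_eqI) (simp add: lookup_restr)

lemma restr_eq_self:
  assumes "keys f \<subseteq> A"
  shows "restr A f = f"
proof (rule poly_mapping_eqI)
  fix \<nu>
  have "lookup f \<nu> = 0" if "\<nu> \<notin> A"
    using assms that unfolding not_in_keys_iff_lookup_eq_zero[symmetric] by blast
  then show "lookup (restr A f) \<nu> = lookup f \<nu>"
    by (simp add: lookup_restr)
qed

lemma restr_eq_0:
  assumes "keys f \<inter> A = {}"
  shows "restr A f = 0"
proof (rule poly_mapping_eqI)
  fix \<nu>
  have "lookup f \<nu> = 0" if "\<nu> \<in> A"
    using assms that unfolding not_in_keys_iff_lookup_eq_zero[symmetric] by blast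
  then show "lookup (restr A f) \<nu> = lookup 0 \<nu>"
    by (simp add: lookup_restr)
qed

lemma restr_single_mult:
  fixes f :: "'a::cancel_comm_monoid_add \<Rightarrow>\<^sub>0 'b::semiring_0"
  assumes "\<And>\<nu>. a + \<nu> \<in> A \<longleftrightarrow> \<nu> \<in> B"
  shows "restr A (single a c * f) = single a c * restr B f"
proof (rule poly_mapping_eqI)
  fix \<mu>
  show "lookup (restr A (single a c * f)) \<mu> = lookup (single a c * restr B f) \<mu>"
  proof (cases "\<exists>\<nu>. \<mu> = a + \<nu>")
    case True
    then obtain \<nu> where "\<mu> = a + \<nu>" by blast
    then show ?thesis by (simp add: lookup_restr lookup_single_mult assms)
  next
    case False
    then show ?thesis by (simp add: lookup_restr lookup_single_mult_eq_0)
  qed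
qed

lemma restr_sum_partition:
  assumes "finite X" "\<And>\<nu>. \<nu> \<in> keys f \<Longrightarrow> h \<nu> \<in> X"
  shows "(\<Sum>x\<in>X. restr {\<nu>. h \<nu> = x} f) = f"
proof (rule poly_mapping_eqI)
  fix \<mu>
  have "lookup (\<Sum>x\<in>X. restr {\<nu>. h \<nu> = x} f) \<mu> = (\<Sum>x\<in>X. if h \<mu> = x then lookup f \<mu> else 0)"
    by (simp add: lookup_sum lookup_restr)
  also have "\<dots> = (if h \<mu> \<in> X then lookup f \<mu> else 0)"
    using assms(1) by simp
  also have "\<dots> = lookup f \<mu>"
    using assms(2)[of \<mu>] by (metis in_keys_iff)
  finally show "lookup (\<Sum>x\<in>X. restr {\<nu>. h \<nu> = x} f) \<mu> = lookup f \<mu>" .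
qed

section \<open>Degrees, weights and homogeneous parts\<close>

lemma mon_deg_0 [simp]: "mon_deg 0 = 0"
  by (simp add: mon_deg_def)

lemma mon_deg_add: "mon_deg (\<nu> + \<mu>) = mon_deg \<nu> + mon_deg \<mu>"
  by (simp add: mon_deg_def lookup_add sum.distrib)

lemma mon_deg_single [simp]: "mon_deg (single i k) = k"
proof -
  have "mon_deg (single i k) = (\<Sum>j\<in>UNIV. if j = i then k else 0)"
    unfolding mon_deg_def by (rule sum.cong) (simp_all add: lookup_single when_def)
  then show ?thesis by simp
qed

lemma lookup_le_mon_deg: "lookup \<nu> i \<le> mon_deg \<nu>"
  unfolding mon_deg_def by (rule member_le_sum) auto

lemma mon_deg_eq_0_iff: "mon_deg \<nu> = 0 \<longleftrightarrow> \<nu> = 0"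
  unfolding mon_deg_def poly_mapping_eq_iff fun_eq_iff by simp

lemma finite_mon_deg: "finite {\<nu> :: 'n::finite mon. mon_deg \<nu> = d}"
proof (rule finite_imageD[where f = lookup])
  have "lookup ` {\<nu> :: 'n mon. mon_deg \<nu> = d} \<subseteq> (UNIV :: 'n set) \<rightarrow>\<^sub>E {..d}"
  proof (rule image_subsetI)
    fix \<nu> :: "'n mon" assume "\<nu> \<in> {\<nu>. mon_deg \<nu> = d}"
    then show "lookup \<nu> \<in> (UNIV :: 'n set) \<rightarrow>\<^sub>E {..d}"
      using lookup_le_mon_deg[of \<nu>] by (intro PiE_I) simp_all
  qed
  then show "finite (lookup ` {\<nu> :: 'n mon. mon_deg \<nu> = d})"
    by (rule finite_subset) (auto intro: finite_PiE)
  show "inj_on lookup {\<nu> :: 'n mon. mon_deg \<nu> = d}"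
    by (intro inj_onI poly_mapping_eqI) (simp only:)
qed

lemma weight_add: "weight w (\<nu> + \<mu>) = weight w \<nu> + weight w \<mu>"
  by (simp add: weight_def lookup_add distrib_left sum.distrib)

lemma weight_single: "weight w (single i k) = w $ i * real k"
proof -
  have "weight w (single i k) = (\<Sum>j\<in>UNIV. if j = i then w $ j * real k else 0)"
    unfolding weight_def by (rule sum.cong) (auto simp: lookup_single when_def)
  then show ?thesis by simp
qed

lemma mon_eq_sum_single: "(\<Sum>i\<in>UNIV. single i (lookup \<nu> i)) = (\<nu> :: 'n::finite mon)"
  by (rule poly_mapping_sum_single) auto

lemma exists_diff_mon:
  assumes "\<And>i. lookup \<nu> i \<le> lookup \<mu> i"
  obtains \<rho> where "\<mu> = \<nu> + (\<rho> :: 'n mon)"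
proof
  show "\<mu> = \<nu> + (\<mu> - \<nu>)"
    by (rule poly_mapping_eqI) (simp add: lookup_add lookup_minus assms)
qed

lemma homogeneous_0 [simp]: "homogeneous d 0"
  by (simp add: homogeneous_def)

lemma homogeneousD: "homogeneous d f \<Longrightarrow> \<nu> \<in> keys f \<Longrightarrow> mon_deg \<nu> = d"
  by (simp add: homogeneous_def)

lemma homogeneous_add: "homogeneous d f \<Longrightarrow> homogeneous d g \<Longrightarrow> homogeneous d (f + g)"
  using keys_add[of f g] unfolding homogeneous_def by blast

lemma homogeneous_sum: "(\<And>i. i \<in> X \<Longrightarrow> homogeneous d (f i)) \<Longrightarrow> homogeneous d (sum f X)"
  by (induction X rule: infinite_finite_induct) (auto intro: homogeneous_add)

lemma homogeneous_mult: "homogeneous d f \<Longrightarrow> homogeneous e g \<Longrightarrow> homogeneous (d + e) (f * g)"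
  using keys_mult[of f g] unfolding homogeneous_def subset_iff mem_Collect_eq
  by (metis mon_deg_add)

lemma homogeneous_single: "homogeneous (mon_deg \<nu>) (single \<nu> c)"
  by (auto simp: homogeneous_def split: if_splits)

lemma homogeneous_scale: "homogeneous d f \<Longrightarrow> homogeneous d (single 0 c * f)"
  using homogeneous_mult[OF homogeneous_single[of 0 c]] by auto

lemma homogeneous_diff: "homogeneous d f \<Longrightarrow> homogeneous d g \<Longrightarrow> homogeneous d (f - g)"
  using keys_diff[of f g] unfolding homogeneous_def by blast

definition hom_part :: "nat \<Rightarrow> ('n::finite, 'k::field) mpol \<Rightarrow> ('n, 'k) mpol" where
  "hom_part d = restr {\<nu>. mon_deg \<nu> = d}"

lemma homogeneous_hom_part: "homogeneous d (hom_part d f)"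
  by (simp add: homogeneous_def hom_part_def keys_restr)

lemma hom_part_homogeneous: "homogeneous d f \<Longrightarrow> hom_part e f = (if d = e then f else 0)"
  unfolding hom_part_def homogeneous_def
  using restr_eq_self[of f "{\<nu>. mon_deg \<nu> = e}"] restr_eq_0[of f "{\<nu>. mon_deg \<nu> = e}"]
  by (cases "d = e") (simp_all add: subset_iff disjoint_iff)

lemma sum_hom_part: "(\<Sum>d\<in>mon_deg ` keys f. hom_part d f) = f"
  unfolding hom_part_def by (rule restr_sum_partition) auto

lemma hom_part_add: "hom_part d (f + g) = hom_part d f + hom_part d g"
  by (simp add: hom_part_def restr_add)

lemma hom_part_0 [simp]: "hom_part d 0 = 0"
  by (simp add: hom_part_def)

lemma hom_part_single_mult:
  "hom_part d (single a c * f) = (if mon_deg a \<le> d then single a c * hom_part (d - mon_deg a) f else 0)"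
proof (cases "mon_deg a \<le> d")
  case True
  then show ?thesis
    unfolding hom_part_def by (simp, intro restr_single_mult) (auto simp: mon_deg_add)
next
  case False
  then show ?thesis
    unfolding hom_part_def
    using restr_single_mult[of a "{\<nu>. mon_deg \<nu> = d}" "{}" c f] restr_eq_0[of f "{}"]
    by (auto simp: mon_deg_add)
qed

lemma hom_part_mult_homogeneous:
  assumes "homogeneous e l"
  shows "hom_part d (l * f) = (if e \<le> d then l * hom_part (d - e) f else 0)"
proof -
  have "hom_part d ((\<Sum>\<nu>\<in>A. single \<nu> (lookup l \<nu>)) * f) =
      (if e \<le> d then (\<Sum>\<nu>\<in>A. single \<nu> (lookup l \<nu>)) * hom_part (d - e) f else 0)"
    if "finite A" "A \<subseteq> keys l" for A
    using that
  proof (induction A)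
    case (insert \<nu> A)
    then have "mon_deg \<nu> = e" using assms by (auto simp: homogeneous_def)
    with insert show ?case
      by (auto simp: hom_part_add distrib_right hom_part_single_mult)
  qed auto
  from this[of "keys l"] show ?thesis by (simp add: poly_mapping_sum_single)
qed


subsection \<open>Evaluation homomorphisms\<close>

text \<open>Substitution homomorphisms in one place: \<open>act g\<close> sends coefficients to
  constants and variables to linear forms, while \<open>eval_entries\<close> keeps the coefficients
  and puts matrix entries for the variables.\<close>

locale evaluation =
  fixes \<iota> :: "'k::field \<Rightarrow> 'r::comm_ring_1" and \<phi> :: "'v::finite \<Rightarrow> 'r"
  assumes \<iota>_0: "\<iota> 0 = 0" and \<iota>_1: "\<iota> 1 = 1"
    and \<iota>_add: "\<iota> (a + b) = \<iota> a + \<iota> b" and \<iota>_mult: "\<iota> (a * b) = \<iota> a * \<iota> b"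
begin

definition mon_val :: "'v mon \<Rightarrow> 'r" where
  "mon_val \<nu> = (\<Prod>i\<in>UNIV. \<phi> i ^ lookup \<nu> i)"

definition val :: "('v, 'k) mpol \<Rightarrow> 'r" where
  "val f = (\<Sum>\<nu>\<in>keys f. \<iota> (lookup f \<nu>) * mon_val \<nu>)"

lemma mon_val_add: "mon_val (\<nu> + \<mu>) = mon_val \<nu> * mon_val \<mu>"
  by (simp add: mon_val_def lookup_add power_add prod.distrib)

lemma mon_val_single: "mon_val (single i k) = \<phi> i ^ k"
proof -
  have "mon_val (single i k) = (\<Prod>j\<in>UNIV. if j = i then \<phi> i ^ k else 1)"
    unfolding mon_val_def by (rule prod.cong) (auto simp: lookup_single when_def)
  then show ?thesis by simp
qed

lemma val_superset:
  assumes "finite A" "keys f \<subseteq> A"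
  shows "val f = (\<Sum>\<nu>\<in>A. \<iota> (lookup f \<nu>) * mon_val \<nu>)"
  unfolding val_def by (rule sum.mono_neutral_left) (use assms in \<open>auto simp: in_keys_iff \<iota>_0\<close>)

lemma val_0 [simp]: "val 0 = 0"
  by (simp add: val_def)

lemma val_add: "val (f + g) = val f + val g"
proof -
  let ?A = "keys f \<union> keys g"
  have "val (f + g) = (\<Sum>\<nu>\<in>?A. \<iota> (lookup (f + g) \<nu>) * mon_val \<nu>)"
    using keys_add[of f g] by (intro val_superset) auto
  also have "\<dots> = val f + val g"
    by (simp add: val_superset[of ?A f] val_superset[of ?A g] lookup_add \<iota>_add distrib_right
        sum.distrib)
  finally show ?thesis .
qed

lemma val_single: "val (single \<nu> c) = \<iota> c * mon_val \<nu>"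
  by (simp add: val_superset[of "{\<nu>}"])

lemma val_1: "val 1 = 1"
  using val_single[of 0 1] by (simp add: \<iota>_1 mon_val_def)

lemma val_mult: "val (f * g) = val f * val g"
proof (induction f rule: poly_mapping_sum_induct)
  case (single \<nu> c)
  show ?case
  proof (induction g rule: poly_mapping_sum_induct)
    case (single \<mu> d)
    show ?case by (simp add: mult_single val_single mon_val_add \<iota>_mult mult.assoc
        mult.left_commute)
  next
    case (add f g)
    have "single \<nu> c * (f + g) = single \<nu> c * f + single \<nu> c * g" by (rule distrib_left)
    with add show ?case by (simp only: val_add distrib_left)
  qed simp
next
  case (add f h)
  have "(f + h) * g = f * g + h * g" by (rule distrib_right)
  with add show ?case by (simp only: val_add distrib_right)
qed simp

end


section \<open>Ideals and leading monomials\<close>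

text \<open>Ideals of the polynomial ring without the record \<open>mpol_ring\<close>;
  \<open>ideal_mpol_ring_iff\<close> gives the translation.\<close>

definition poly_ideal :: "('n, 'k::field) mpol set \<Rightarrow> bool" where
  "poly_ideal J \<longleftrightarrow> 0 \<in> J \<and> (\<forall>f\<in>J. \<forall>g\<in>J. f + g \<in> J) \<and> (\<forall>f\<in>J. \<forall>h. h * f \<in> J)"

lemma poly_ideal_0: "poly_ideal J \<Longrightarrow> 0 \<in> J"
  and poly_ideal_add: "poly_ideal J \<Longrightarrow> f \<in> J \<Longrightarrow> g \<in> J \<Longrightarrow> f + g \<in> J"
  and poly_ideal_mult: "poly_ideal J \<Longrightarrow> f \<in> J \<Longrightarrow> h * f \<in> J"
  by (simp_all add: poly_ideal_def)

lemma poly_ideal_uminus: "poly_ideal J \<Longrightarrow> f \<in> J \<Longrightarrow> - f \<in> J"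
  using poly_ideal_mult[of J f "- 1"] by simp

lemma poly_ideal_diff: "poly_ideal J \<Longrightarrow> f \<in> J \<Longrightarrow> g \<in> J \<Longrightarrow> f - g \<in> J"
  using poly_ideal_add[of J f "- g"] poly_ideal_uminus[of J g] by simp

lemma poly_ideal_sum: "poly_ideal J \<Longrightarrow> (\<And>i. i \<in> X \<Longrightarrow> f i \<in> J) \<Longrightarrow> sum f X \<in> J"
  by (induction X rule: infinite_finite_induct) (simp_all add: poly_ideal_0 poly_ideal_add)

lemma cring_mpol_ring: "cring (mpol_ring :: ('n, 'k::field) mpol ring)"
proof (rule cringI)
  show "abelian_group (mpol_ring :: ('n, 'k) mpol ring)"
  proof (rule abelian_groupI)
    fix x :: "('n, 'k) mpol"
    have "- x + x = 0" by simp
    then show "\<exists>y\<in>carrier mpol_ring. y \<oplus>\<^bsub>mpol_ring\<^esub> x = \<zero>\<^bsub>mpol_ring\<^esub>"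
      unfolding mpol_ring_def by (metis UNIV_I partial_object.select_convs(1) ring_record_simps(11,12))
  qed (simp_all add: mpol_ring_def add_ac)
  show "comm_monoid (mpol_ring :: ('n, 'k) mpol ring)"
    by (rule comm_monoidI) (simp_all add: mpol_ring_def mult_ac)
qed (simp add: mpol_ring_def distrib_right)

lemma ring_mpol_ring: "ring (mpol_ring :: ('n, 'k::field) mpol ring)"
  using cring_mpol_ring by (rule cring.axioms(1))

lemma mpol_ring_simps [simp]:
  "carrier mpol_ring = UNIV" "x \<otimes>\<^bsub>mpol_ring\<^esub> y = x * y" "x \<oplus>\<^bsub>mpol_ring\<^esub> y = x + y"
  "\<zero>\<^bsub>mpol_ring\<^esub> = 0" "\<one>\<^bsub>mpol_ring\<^esub> = 1"
  by (simp_all add: mpol_ring_def)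

lemma a_inv_mpol_ring: "\<ominus>\<^bsub>mpol_ring\<^esub> x = - (x :: ('n, 'k::field) mpol)"
proof -
  interpret cring "mpol_ring :: ('n, 'k) mpol ring" by (rule cring_mpol_ring)
  have "\<ominus>\<^bsub>mpol_ring\<^esub> x + x = 0"
    using l_neg[of x] by simp
  then show ?thesis by (simp add: eq_neg_iff_add_eq_0)
qed

lemma ideal_mpol_ring_iff: "ideal J mpol_ring \<longleftrightarrow> poly_ideal (J :: ('n, 'k::field) mpol set)"
proof
  assume "ideal J mpol_ring"
  then interpret ideal J mpol_ring .
  show "poly_ideal J"
    unfolding poly_ideal_def
    using additive_subgroup.zero_closed[OF is_additive_subgroup]
      additive_subgroup.a_closed[OF is_additive_subgroup] I_l_closed by simp
next
  assume J: "poly_ideal J"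
  show "ideal J mpol_ring"
  proof (rule idealI[OF ring_mpol_ring])
    show "subgroup J (add_monoid mpol_ring)"
    proof
      fix x assume "x \<in> J"
      then show "inv\<^bsub>add_monoid mpol_ring\<^esub> x \<in> J"
        using poly_ideal_uminus[OF J] a_inv_mpol_ring[of x] by (simp add: a_inv_def)
    qed (use J in \<open>simp_all add: poly_ideal_0 poly_ideal_add\<close>)
  qed (use J poly_ideal_mult[OF J] in \<open>simp_all add: mult.commute\<close>)
qed

lemma poly_ideal_Idl: "poly_ideal (Idl\<^bsub>mpol_ring\<^esub> S)"
  using ring.genideal_ideal[OF ring_mpol_ring, of S] by (simp add: ideal_mpol_ring_iff)

lemma in_Idl: "f \<in> S \<Longrightarrow> f \<in> Idl\<^bsub>mpol_ring\<^esub> S"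
  using ring.genideal_self[OF ring_mpol_ring, of S] by auto

lemma Idl_minimal: "poly_ideal J \<Longrightarrow> S \<subseteq> J \<Longrightarrow> Idl\<^bsub>mpol_ring\<^esub> S \<subseteq> J"
  using ring.genideal_minimal[OF ring_mpol_ring, of J S] by (simp add: ideal_mpol_ring_iff)

text \<open>Closure under homogeneous parts replaces homogeneous generators, because it is tested on
  single elements and passes directly to images under \<open>act g\<close>.\<close>

definition graded :: "('n::finite, 'k::field) mpol set \<Rightarrow> bool" where
  "graded J \<longleftrightarrow> poly_ideal J \<and> (\<forall>f\<in>J. \<forall>d. hom_part d f \<in> J)"

lemma graded_poly_ideal: "graded J \<Longrightarrow> poly_ideal J"
  and graded_hom_part: "graded J \<Longrightarrow> f \<in> J \<Longrightarrow> hom_part d f \<in> J"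
  by (simp_all add: graded_def)

text \<open>The polynomials whose homogeneous parts all lie in \<open>I\<close> form an ideal, and
  this ideal contains the homogeneous generators.\<close>

lemma graded_ideal_imp_graded:
  assumes "graded_ideal I"
  shows "graded I"
proof -
  obtain S where S: "\<And>f. f \<in> S \<Longrightarrow> \<exists>d. homogeneous d f" and I: "I = Idl\<^bsub>mpol_ring\<^esub> S"
    using assms by (auto simp: graded_ideal_def)
  let ?T = "{f. \<forall>d. hom_part d f \<in> I}"
  have idl: "poly_ideal I" by (simp add: I poly_ideal_Idl)
  have "poly_ideal ?T"
    unfolding poly_ideal_def
  proof (intro conjI ballI allI)
    fix f h assume f: "f \<in> ?T"
    show "h * f \<in> ?T"
    proof (induction h rule: poly_mapping_sum_induct)
      case (single \<nu> c)
      with f show ?case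
        by (simp add: hom_part_single_mult poly_ideal_0[OF idl] poly_ideal_mult[OF idl])
    qed (simp_all add: poly_ideal_0[OF idl] poly_ideal_add[OF idl] hom_part_add distrib_right)
  qed (simp_all add: poly_ideal_0[OF idl] poly_ideal_add[OF idl] hom_part_add)
  moreover have "S \<subseteq> ?T"
  proof
    fix f assume f: "f \<in> S"
    then obtain d where "homogeneous d f" using S by blast
    moreover have "f \<in> I" unfolding I using f by (rule in_Idl)
    ultimately show "f \<in> ?T"
      by (simp add: hom_part_homogeneous poly_ideal_0[OF idl])
  qed
  ultimately have "I \<subseteq> ?T" unfolding I by (rule Idl_minimal)
  then show ?thesis using idl by (auto simp: graded_def)
qed

section \<open>Leading monomials and reduction\<close>

definition is_lm :: "('n mon \<Rightarrow> 'n mon \<Rightarrow> bool) \<Rightarrow> ('n, 'k::field) mpol \<Rightarrow> 'n mon \<Rightarrow> bool" where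
  "is_lm gt f \<nu> \<longleftrightarrow> \<nu> \<in> keys f \<and> (\<forall>\<mu>\<in>keys f. \<mu> \<noteq> \<nu> \<longrightarrow> gt \<nu> \<mu>)"

text \<open>The exponents of the initial ideal. Arguments run on this set of monomials;
  \<open>in_order_ideal_eq\<close> recovers the ideal from it.\<close>

definition lms :: "('n mon \<Rightarrow> 'n mon \<Rightarrow> bool) \<Rightarrow> ('n, 'k::field) mpol set \<Rightarrow> 'n mon set" where
  "lms gt J = {\<nu>. \<exists>f\<in>J. is_lm gt f \<nu>}"

lemma term_order_irrefl: "term_order gt \<Longrightarrow> \<not> gt \<nu> \<nu>"
  by (simp add: term_order_def irreflp_def)

lemma term_order_trans: "term_order gt \<Longrightarrow> gt \<nu> \<mu> \<Longrightarrow> gt \<mu> \<rho> \<Longrightarrow> gt \<nu> \<rho>"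
  unfolding term_order_def transp_def by blast

lemma term_order_total: "term_order gt \<Longrightarrow> \<nu> \<noteq> \<mu> \<Longrightarrow> gt \<nu> \<mu> \<or> gt \<mu> \<nu>"
  unfolding term_order_def totalp_on_def by blast

lemma term_order_add: "term_order gt \<Longrightarrow> gt \<nu> \<mu> \<Longrightarrow> gt (\<nu> + \<rho>) (\<mu> + \<rho>)"
  unfolding term_order_def by blast

lemma term_order_asym: "term_order gt \<Longrightarrow> gt \<nu> \<mu> \<Longrightarrow> \<not> gt \<mu> \<nu>"
  using term_order_irrefl term_order_trans by blast

lemma is_lm_exists:
  assumes gt: "term_order gt" and "f \<noteq> 0"
  obtains \<nu> where "is_lm gt f \<nu>"
proof -
  have "\<exists>\<nu>\<in>X. \<forall>\<mu>\<in>X. \<mu> \<noteq> \<nu> \<longrightarrow> gt \<nu> \<mu>" if "finite X" "X \<noteq> {}" for X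
    using that
  proof (induction X rule: finite_ne_induct)
    case (insert x X)
    then obtain \<nu> where \<nu>: "\<nu> \<in> X" "\<forall>\<mu>\<in>X. \<mu> \<noteq> \<nu> \<longrightarrow> gt \<nu> \<mu>" by blast
    with insert have "x \<noteq> \<nu>" by blast
    then consider "gt x \<nu>" | "gt \<nu> x" using term_order_total[OF gt] by blast
    then show ?case
    proof cases
      case 1
      then have "gt x \<mu>" if "\<mu> \<in> X" for \<mu>
        using \<nu>(2) that term_order_trans[OF gt 1] by metis
      then show ?thesis by blast
    next
      case 2
      then show ?thesis using \<nu> by blast
    qed
  qed blast
  from this[of "keys f", OF finite_keys] \<open>f \<noteq> 0\<close> have "\<exists>\<nu>. is_lm gt f \<nu>"
    unfolding is_lm_def keys_eq_empty by blast
  then show ?thesis using that by blast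
qed

lemma is_lm_unique: "term_order gt \<Longrightarrow> is_lm gt f \<nu> \<Longrightarrow> is_lm gt f \<mu> \<Longrightarrow> \<nu> = \<mu>"
  unfolding is_lm_def by (metis term_order_asym)

lemma is_lm_single_mult:
  assumes "term_order gt" "c \<noteq> 0" "is_lm gt f \<nu>"
  shows "is_lm gt (single a c * f) (a + \<nu>)"
  unfolding is_lm_def keys_single_mult[OF assms(2)]
proof (intro conjI ballI impI)
  show "a + \<nu> \<in> (+) a ` keys f"
    using assms(3) by (simp add: is_lm_def)
  fix \<mu> assume "\<mu> \<in> (+) a ` keys f" "\<mu> \<noteq> a + \<nu>"
  then obtain \<kappa> where "\<kappa> \<in> keys f" "\<mu> = a + \<kappa>" "\<kappa> \<noteq> \<nu>" by blast
  then show "gt (a + \<nu>) \<mu>"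
    using assms(3) term_order_add[OF assms(1), of \<nu> \<kappa> a] by (simp add: is_lm_def add.commute)
qed

lemma lms_add: "term_order gt \<Longrightarrow> poly_ideal J \<Longrightarrow> \<nu> \<in> lms gt J \<Longrightarrow> a + \<nu> \<in> lms gt J"
  unfolding lms_def mem_Collect_eq
  by (elim bexE, rule bexI[of _ "single a 1 * _"]) (auto intro: is_lm_single_mult poly_ideal_mult)

lemma lms_homogeneous:
  assumes "graded J" "\<beta> \<in> lms gt J"
  obtains f where "f \<in> J" "homogeneous (mon_deg \<beta>) f" "is_lm gt f \<beta>" "lookup f \<beta> = 1"
proof -
  obtain f where f: "f \<in> J" "is_lm gt f \<beta>" using assms by (auto simp: lms_def)
  let ?c = "inverse (lookup f \<beta>)"
  let ?g = "single 0 ?c * hom_part (mon_deg \<beta>) f"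
  have lf: "lookup f \<beta> \<noteq> 0" using f(2) unfolding is_lm_def in_keys_iff by blast
  then have "keys ?g = keys f \<inter> {\<nu>. mon_deg \<nu> = mon_deg \<beta>}"
    by (simp add: keys_single_mult hom_part_def keys_restr)
  then have "is_lm gt ?g \<beta>" using f(2) unfolding is_lm_def by blast
  moreover have "?g \<in> J"
    using assms(1) f(1) by (intro poly_ideal_mult graded_hom_part graded_poly_ideal)
  moreover have "lookup ?g \<beta> = 1"
    using lf by (simp add: lookup_scale hom_part_def lookup_restr)
  ultimately show ?thesis
    using that homogeneous_scale[OF homogeneous_hom_part] by blast
qed

text \<open>A measure for reductions within one degree. The term order itself may have infinitely
  many monomials below a given one, but each degree is finite.\<close>

definition order_rank :: "('n mon \<Rightarrow> 'n mon \<Rightarrow> bool) \<Rightarrow> 'n::finite mon \<Rightarrow> nat" where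
  "order_rank gt \<beta> = card {\<mu>. mon_deg \<mu> = mon_deg \<beta> \<and> gt \<beta> \<mu>}"

lemma order_rank_less:
  assumes gt: "term_order gt" and "mon_deg \<alpha> = mon_deg \<beta>" "gt \<alpha> \<beta>"
  shows "order_rank gt \<beta> < order_rank gt \<alpha>"
  unfolding order_rank_def
proof (rule psubset_card_mono)
  show "finite {\<mu>. mon_deg \<mu> = mon_deg \<alpha> \<and> gt \<alpha> \<mu>}"
    by (rule finite_subset[OF _ finite_mon_deg[of "mon_deg \<alpha>"]]) blast
  show "{\<mu>. mon_deg \<mu> = mon_deg \<beta> \<and> gt \<beta> \<mu>} \<subset> {\<mu>. mon_deg \<mu> = mon_deg \<alpha> \<and> gt \<alpha> \<mu>}"
  proof
    show "{\<mu>. mon_deg \<mu> = mon_deg \<beta> \<and> gt \<beta> \<mu>} \<subseteq> {\<mu>. mon_deg \<mu> = mon_deg \<alpha> \<and> gt \<alpha> \<mu>}"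
      using assms(2) term_order_trans[OF gt assms(3)] by auto
    have "\<beta> \<in> {\<mu>. mon_deg \<mu> = mon_deg \<alpha> \<and> gt \<alpha> \<mu>}" "\<beta> \<notin> {\<mu>. mon_deg \<mu> = mon_deg \<beta> \<and> gt \<beta> \<mu>}"
      using assms(2,3) term_order_irrefl[OF gt] by auto
    then show "{\<mu>. mon_deg \<mu> = mon_deg \<beta> \<and> gt \<beta> \<mu>} \<noteq> {\<mu>. mon_deg \<mu> = mon_deg \<alpha> \<and> gt \<alpha> \<mu>}"
      by metis
  qed
qed

lemma order_rank_eq:
  assumes gt: "term_order gt" and "mon_deg \<alpha> = mon_deg \<beta>" "order_rank gt \<alpha> = order_rank gt \<beta>"
  shows "\<alpha> = \<beta>"
  using assms term_order_total[OF gt, of \<alpha> \<beta>] order_rank_less[OF gt, of \<alpha> \<beta>]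
    order_rank_less[OF gt, of \<beta> \<alpha>] by force

text \<open>Such elements resemble those of a reduced Groebner basis, except that \<beta> need not
  be a minimal generator. Offending monomials are cleared from the top down: subtracting a multiple
  of an element with leading monomial \<kappa> brings in only monomials below \<kappa>.\<close>

lemma reduced_element:
  assumes gt: "term_order gt" and J: "graded J" and \<beta>: "\<beta> \<in> lms gt J"
  obtains f where "f \<in> J" "homogeneous (mon_deg \<beta>) f" "is_lm gt f \<beta>" "lookup f \<beta> = 1"
    "keys f \<inter> lms gt J = {\<beta>}"
proof -
  let ?d = "mon_deg \<beta>" and ?r = "order_rank gt"
  have "\<exists>f\<in>J. homogeneous ?d f \<and> is_lm gt f \<beta> \<and> lookup f \<beta> = 1 \<and>
      (\<forall>\<kappa>\<in>keys f \<inter> lms gt J. \<kappa> \<noteq> \<beta> \<longrightarrow> ?r \<kappa> < ?r \<beta> - j)" for j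
  proof (induction j)
    case 0
    obtain f where f: "f \<in> J" "homogeneous ?d f" "is_lm gt f \<beta>" "lookup f \<beta> = 1"
      by (rule lms_homogeneous[OF J \<beta>])
    have "?r \<kappa> < ?r \<beta>" if "\<kappa> \<in> keys f" "\<kappa> \<noteq> \<beta>" for \<kappa>
    proof (rule order_rank_less[OF gt])
      show "mon_deg \<beta> = mon_deg \<kappa>" using homogeneousD[OF f(2) that(1)] by (rule sym)
      show "gt \<beta> \<kappa>" using f(3) that unfolding is_lm_def by blast
    qed
    with f show ?case by (intro bexI[of _ f]) simp_all
  next
    case (Suc j)
    then obtain f where f: "f \<in> J" "homogeneous ?d f" "is_lm gt f \<beta>" "lookup f \<beta> = 1"
      and bad: "\<And>\<kappa>. \<kappa> \<in> keys f \<Longrightarrow> \<kappa> \<in> lms gt J \<Longrightarrow> \<kappa> \<noteq> \<beta> \<Longrightarrow> ?r \<kappa> < ?r \<beta> - j" by blast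
    show ?case
    proof (cases "\<exists>\<kappa>\<in>keys f \<inter> lms gt J. \<kappa> \<noteq> \<beta> \<and> ?r \<kappa> = ?r \<beta> - Suc j")
      case False
      have "?r \<kappa> < ?r \<beta> - Suc j" if "\<kappa> \<in> keys f" "\<kappa> \<in> lms gt J" "\<kappa> \<noteq> \<beta>" for \<kappa>
      proof -
        have "?r \<kappa> \<noteq> ?r \<beta> - Suc j" using False that by blast
        with bad[OF that] show ?thesis by linarith
      qed
      with f show ?thesis by blast
    next
      case True
      then obtain \<kappa>\<^sub>0 where \<kappa>\<^sub>0: "\<kappa>\<^sub>0 \<in> keys f" "\<kappa>\<^sub>0 \<in> lms gt J" "\<kappa>\<^sub>0 \<noteq> \<beta>" "?r \<kappa>\<^sub>0 = ?r \<beta> - Suc j"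
        by blast
      have deg: "mon_deg \<kappa>\<^sub>0 = ?d" using homogeneousD[OF f(2) \<kappa>\<^sub>0(1)] .
      obtain g where g: "g \<in> J" "homogeneous ?d g" "is_lm gt g \<kappa>\<^sub>0" "lookup g \<kappa>\<^sub>0 = 1"
        by (rule lms_homogeneous[OF J \<kappa>\<^sub>0(2), unfolded deg])
      have g_less: "gt \<beta> \<kappa>" if "\<kappa> \<in> keys g" for \<kappa>
      proof -
        have "gt \<beta> \<kappa>\<^sub>0" using f(3) \<kappa>\<^sub>0(1,3) unfolding is_lm_def by blast
        moreover have "\<kappa> = \<kappa>\<^sub>0 \<or> gt \<kappa>\<^sub>0 \<kappa>" using g(3) that unfolding is_lm_def by blast
        ultimately show ?thesis using term_order_trans[OF gt] by metis
      qed
      then have \<beta>_g: "lookup g \<beta> = 0"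
        using term_order_irrefl[OF gt, of \<beta>] by (metis in_keys_iff)
      define h where "h = f - single 0 (lookup f \<kappa>\<^sub>0) * g"
      have lh: "lookup h \<kappa> = lookup f \<kappa> - lookup f \<kappa>\<^sub>0 * lookup g \<kappa>" for \<kappa>
        by (simp add: h_def lookup_minus lookup_scale)
      have keys_h: "\<kappa> \<in> keys f \<or> \<kappa> \<in> keys g" if "\<kappa> \<in> keys h" for \<kappa>
      proof (rule ccontr)
        assume "\<not> ?thesis"
        then have "lookup h \<kappa> = 0"
          by (simp add: lh not_in_keys_iff_lookup_eq_zero)
        with that show False unfolding in_keys_iff by blast
      qed
      have "h \<in> J"
        unfolding h_def using J f(1) g(1) by (intro poly_ideal_diff poly_ideal_mult graded_poly_ideal)
      moreover have "homogeneous ?d h"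
        unfolding h_def using f(2) g(2) by (intro homogeneous_diff homogeneous_scale)
      moreover have 1: "lookup h \<beta> = 1" by (simp add: lh \<beta>_g f(4))
      moreover have "is_lm gt h \<beta>"
        unfolding is_lm_def
      proof (intro conjI ballI impI)
        show "\<beta> \<in> keys h" unfolding in_keys_iff 1 by simp
        fix \<mu> assume "\<mu> \<in> keys h" "\<mu> \<noteq> \<beta>"
        then show "gt \<beta> \<mu>" using keys_h[of \<mu>] g_less[of \<mu>] f(3) unfolding is_lm_def by blast
      qed
      moreover have "?r \<kappa> < ?r \<beta> - Suc j"
        if \<kappa>: "\<kappa> \<in> keys h" "\<kappa> \<in> lms gt J" "\<kappa> \<noteq> \<beta>" for \<kappa>
      proof -
        have "lookup h \<kappa>\<^sub>0 = 0" by (simp add: lh g(4))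
        with \<kappa>(1) have "\<kappa> \<noteq> \<kappa>\<^sub>0" unfolding in_keys_iff by blast
        consider "\<kappa> \<in> keys g" | "\<kappa> \<in> keys f" using keys_h[OF \<kappa>(1)] by blast
        then show ?thesis
        proof cases
          case 1
          have "gt \<kappa>\<^sub>0 \<kappa>" using g(3) 1 \<open>\<kappa> \<noteq> \<kappa>\<^sub>0\<close> unfolding is_lm_def by blast
          moreover have "mon_deg \<kappa>\<^sub>0 = mon_deg \<kappa>" using homogeneousD[OF g(2) 1] deg by metis
          ultimately show ?thesis using order_rank_less[OF gt, of \<kappa>\<^sub>0 \<kappa>] \<kappa>\<^sub>0(4) by metis
        next
          case 2
          then have "mon_deg \<kappa> = ?d" by (rule homogeneousD[OF f(2)])
          then have "?r \<kappa> \<noteq> ?r \<kappa>\<^sub>0"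
            using order_rank_eq[OF gt, of \<kappa> \<kappa>\<^sub>0] deg \<open>\<kappa> \<noteq> \<kappa>\<^sub>0\<close> by metis
          with bad[OF 2 \<kappa>(2,3)] \<kappa>\<^sub>0(4) show ?thesis by linarith
        qed
      qed
      ultimately show ?thesis by blast
    qed
  qed
  \<comment> \<open>After as many rounds as the rank of \<beta>, the bound on the ranks of offending
    monomials is 0.\<close>
  from this[of "?r \<beta>"] obtain f where f: "f \<in> J" "homogeneous ?d f" "is_lm gt f \<beta>"
      "lookup f \<beta> = 1" "\<forall>\<kappa>\<in>keys f \<inter> lms gt J. \<kappa> \<noteq> \<beta> \<longrightarrow> ?r \<kappa> < ?r \<beta> - ?r \<beta>"
    by blast
  then have "\<forall>\<kappa>\<in>keys f \<inter> lms gt J. \<kappa> = \<beta>" by simp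
  with f(3) have "keys f \<inter> lms gt J = {\<beta>}"
    using \<beta> unfolding is_lm_def by blast
  with f show ?thesis by (intro that)
qed


subsection \<open>Counting leading monomials\<close>

text \<open>Linear independence of the restrictions to \<open>A\<close> of a family of functions;
  indexing by \<open>X\<close> makes repeated functions dependent. With \<open>A\<close> a set of
  monomials it bounds the rank of a projection to coefficients from below.\<close>

definition indep_on :: "'a set \<Rightarrow> 'i set \<Rightarrow> ('i \<Rightarrow> 'a \<Rightarrow> 'k::field) \<Rightarrow> bool" where
  "indep_on A X w \<longleftrightarrow> (\<forall>c. (\<forall>a\<in>A. (\<Sum>i\<in>X. c i * w i a) = 0) \<longrightarrow> (\<forall>i\<in>X. c i = 0))"

lemma indep_onD: "indep_on A X w \<Longrightarrow> (\<And>a. a \<in> A \<Longrightarrow> (\<Sum>i\<in>X. c i * w i a) = 0) \<Longrightarrow> i \<in> X \<Longrightarrow> c i = 0"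
  unfolding indep_on_def by blast

text \<open>Gaussian elimination by columns: a row with a nonzero entry in column \<open>x\<close>
  clears that column and is then dropped together with it.\<close>

lemma indep_on_card_le:
  assumes "finite A" "finite X" "indep_on A X w"
  shows "card X \<le> card A"
  using assms
proof (induction A arbitrary: X w)
  case empty
  have "X = {}" using indep_onD[OF empty(2), of "\<lambda>_. 1"] by auto
  then show ?case by simp
next
  case (insert x A)
  show ?case
  proof (cases "\<exists>i\<in>X. w i x \<noteq> 0")
    case False
    then have "indep_on A X w"
      using insert.prems(2) unfolding indep_on_def by simp
    with insert show ?thesis by (simp add: le_SucI)
  next
    case True
    then obtain j where j: "j \<in> X" "w j x \<noteq> 0" by blast
    let ?u = "\<lambda>i y. w i y - w i x / w j x * w j y"
    have "indep_on A (X - {j}) ?u"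
      unfolding indep_on_def
    proof (intro allI impI)
      fix c assume c: "\<forall>a\<in>A. (\<Sum>i\<in>X - {j}. c i * ?u i a) = 0"
      \<comment> \<open>The coefficient of the pivot row is chosen such that the combination
        vanishes in column \<open>x\<close>.\<close>
      define s where "s = (\<Sum>i\<in>X - {j}. c i * w i x) / w j x"
      define c' where "c' = c(j := - s)"
      have sum: "(\<Sum>i\<in>X. c' i * w i a) = (\<Sum>i\<in>X - {j}. c i * w i a) - s * w j a" for a
        using sum.remove[OF insert.prems(1) j(1), of "\<lambda>i. c' i * w i a"] by (simp add: c'_def)
      have u: "(\<Sum>i\<in>X - {j}. c i * ?u i a) = (\<Sum>i\<in>X - {j}. c i * w i a) - s * w j a" for a
        by (simp add: s_def right_diff_distrib sum_subtractf sum_distrib_right sum_divide_distrib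
            mult.assoc)
      have "(\<Sum>i\<in>X. c' i * w i a) = 0" if "a \<in> insert x A" for a
      proof (cases "a = x")
        case True
        then show ?thesis using j(2) by (simp add: sum s_def)
      next
        case False
        then show ?thesis using c that u[of a] sum[of a] by simp
      qed
      from indep_onD[OF insert.prems(2), of c', OF this]
      show "\<forall>i\<in>X - {j}. c i = 0" by (metis DiffD1 DiffD2 c'_def fun_upd_other singletonI)
    qed
    from insert.IH[OF _ this] have "card (X - {j}) \<le> card A" using insert.prems(1) by simp
    then show ?thesis using j(1) insert by (simp add: card_Diff_singleton_if)
  qed
qed

text \<open>A combination of the given elements with a nonzero coefficient in \<open>A\<close> has
  its leading monomial in \<open>A\<close> too, as \<open>A\<close> is closed towards larger
  monomials. So a combination that vanishes at the leading monomials in \<open>A\<close> vanishes on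
  all of \<open>A\<close>.\<close>

lemma card_indep_on_le_lms:
  assumes gt: "term_order gt" and J: "poly_ideal J" and X: "finite X"
    and f: "\<forall>i\<in>X. f i \<in> J \<and> homogeneous d (f i)"
    and A: "A \<subseteq> {\<nu>. mon_deg \<nu> = d}" "\<And>a b. a \<in> A \<Longrightarrow> mon_deg b = d \<Longrightarrow> gt b a \<Longrightarrow> b \<in> A"
    and ind: "indep_on A X (\<lambda>i. lookup (f i))"
  shows "card X \<le> card (lms gt J \<inter> A)"
proof (rule indep_on_card_le[OF _ X])
  show "finite (lms gt J \<inter> A)"
    using finite_subset[OF A(1) finite_mon_deg] by blast
  show "indep_on (lms gt J \<inter> A) X (\<lambda>i. lookup (f i))"
    unfolding indep_on_def
  proof (intro allI impI)
    fix c assume c: "\<forall>a\<in>lms gt J \<inter> A. (\<Sum>i\<in>X. c i * lookup (f i) a) = 0"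
    define g where "g = (\<Sum>i\<in>X. single 0 (c i) * f i)"
    have lg: "lookup g a = (\<Sum>i\<in>X. c i * lookup (f i) a)" for a
      by (simp add: g_def lookup_sum lookup_scale)
    have gJ: "g \<in> J"
      unfolding g_def using J f by (intro poly_ideal_sum poly_ideal_mult) blast+
    have gd: "homogeneous d g"
      unfolding g_def using f by (intro homogeneous_sum homogeneous_scale) blast
    have "lookup g a = 0" if a: "a \<in> A" for a
    proof (rule ccontr)
      assume ne: "lookup g a \<noteq> 0"
      then have "g \<noteq> 0" by auto
      then obtain \<nu> where \<nu>: "is_lm gt g \<nu>" by (rule is_lm_exists[OF gt])
      then have "\<nu> = a \<or> gt \<nu> a" using ne[folded in_keys_iff] unfolding is_lm_def by metis
      moreover have "mon_deg \<nu> = d" using homogeneousD[OF gd] \<nu> unfolding is_lm_def by blast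
      ultimately have "\<nu> \<in> A" using a A(2) by blast
      moreover have "\<nu> \<in> lms gt J" using \<nu> gJ unfolding lms_def by blast
      ultimately have "lookup g \<nu> = 0" using c lg by simp
      then show False using \<nu> unfolding is_lm_def in_keys_iff by blast
    qed
    then show "\<forall>i\<in>X. c i = 0"
      using indep_onD[OF ind, of c] by (simp add: lg)
  qed
qed

text \<open>Reduced elements give the identity matrix on the columns in \<open>lms gt J\<close>.
  Together with \<open>card_indep_on_le_lms\<close>, the rank of the projection to a set closed
  towards larger monomials is its number of leading monomials.\<close>

lemma exists_indep_on_lms:
  assumes gt: "term_order gt" and J: "graded J" and A: "A \<subseteq> {\<nu>. mon_deg \<nu> = d}"
  obtains f where "\<forall>\<beta>\<in>lms gt J \<inter> A. f \<beta> \<in> J \<and> homogeneous d (f \<beta>)"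
    "indep_on A (lms gt J \<inter> A) (\<lambda>\<beta>. lookup (f \<beta>))"
proof -
  let ?B = "lms gt J \<inter> A"
  have "\<forall>\<beta>\<in>?B. \<exists>f. f \<in> J \<and> homogeneous d f \<and> lookup f \<beta> = 1 \<and> keys f \<inter> lms gt J = {\<beta>}"
  proof
    fix \<beta> assume \<beta>: "\<beta> \<in> ?B"
    then obtain f where f: "f \<in> J" "homogeneous (mon_deg \<beta>) f" "is_lm gt f \<beta>" "lookup f \<beta> = 1"
      "keys f \<inter> lms gt J = {\<beta>}"
      by (rule reduced_element[OF gt J IntD1])
    have "mon_deg \<beta> = d" using A \<beta> by blast
    with f show "\<exists>f. f \<in> J \<and> homogeneous d f \<and> lookup f \<beta> = 1 \<and> keys f \<inter> lms gt J = {\<beta>}"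
      by metis
  qed
  from bchoice[OF this] obtain f where
    "\<forall>\<beta>\<in>?B. f \<beta> \<in> J \<and> homogeneous d (f \<beta>) \<and> lookup (f \<beta>) \<beta> = 1 \<and> keys (f \<beta>) \<inter> lms gt J = {\<beta>}"
    by blast
  then have f: "\<And>\<beta>. \<beta> \<in> ?B \<Longrightarrow> f \<beta> \<in> J" "\<And>\<beta>. \<beta> \<in> ?B \<Longrightarrow> homogeneous d (f \<beta>)"
    "\<And>\<beta>. \<beta> \<in> ?B \<Longrightarrow> lookup (f \<beta>) \<beta> = 1" "\<And>\<beta>. \<beta> \<in> ?B \<Longrightarrow> keys (f \<beta>) \<inter> lms gt J = {\<beta>}"
    by simp_all
  have fin: "finite ?B" using finite_subset[OF A finite_mon_deg] by blast
  have "indep_on A ?B (\<lambda>\<beta>. lookup (f \<beta>))"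
    unfolding indep_on_def
  proof (intro allI impI ballI)
    fix c \<beta> assume c: "\<forall>a\<in>A. (\<Sum>\<beta>\<in>?B. c \<beta> * lookup (f \<beta>) a) = 0" and \<beta>: "\<beta> \<in> ?B"
    have "lookup (f \<gamma>) \<beta> = (if \<gamma> = \<beta> then 1 else 0)" if "\<gamma> \<in> ?B" for \<gamma>
    proof (cases "\<gamma> = \<beta>")
      case False
      then have "\<beta> \<notin> keys (f \<gamma>)" using f(4)[OF that] \<beta> by (metis IntD1 IntI singletonD)
      with False show ?thesis by (simp add: not_in_keys_iff_lookup_eq_zero)
    qed (use f(3) \<beta> in simp)
    then have "(\<Sum>\<gamma>\<in>?B. c \<gamma> * lookup (f \<gamma>) \<beta>) = (\<Sum>\<gamma>\<in>?B. if \<gamma> = \<beta> then c \<gamma> else 0)"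
      by (intro sum.cong) simp_all
    also have "\<dots> = c \<beta>" using fin \<beta> by simp
    finally show "c \<beta> = 0" using c \<beta> by simp
  qed
  with f(1,2) show ?thesis by (intro that ballI conjI)
qed

text \<open>The Hilbert function does not see the term order: all monomials of degree
  \<open>d\<close> form a set closed towards larger ones for every order, so both sides count the
  dimension of the degree-\<open>d\<close> part of \<open>J\<close>.\<close>

lemma card_lms_le:
  assumes "term_order gt" "term_order gt'" "graded J"
  shows "card (lms gt J \<inter> {\<nu>. mon_deg \<nu> = d}) \<le> card (lms gt' J \<inter> {\<nu>. mon_deg \<nu> = d})"
proof -
  let ?A = "{\<nu> :: 'a mon. mon_deg \<nu> = d}"
  obtain f where f: "\<forall>\<beta>\<in>lms gt J \<inter> ?A. f \<beta> \<in> J \<and> homogeneous d (f \<beta>)"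
    "indep_on ?A (lms gt J \<inter> ?A) (\<lambda>\<beta>. lookup (f \<beta>))"
    by (rule exists_indep_on_lms[OF assms(1,3), of ?A d, OF order.refl])
  show ?thesis
  proof (rule card_indep_on_le_lms[OF assms(2) graded_poly_ideal[OF assms(3)] _ f(1) _ _ f(2)])
    show "finite (lms gt J \<inter> ?A)" by (rule finite_subset[OF Int_lower2 finite_mon_deg])
  qed simp_all
qed

text \<open>Equal finite counts in each degree turn the inclusion into an equality.\<close>

lemma lms_eqI:
  assumes gt: "term_order gt" "term_order gt'" and J: "graded J" and sub: "lms gt J \<subseteq> lms gt' J"
  shows "lms gt J = lms gt' J"
proof
  show "lms gt' J \<subseteq> lms gt J"
  proof
    fix \<nu> assume \<nu>: "\<nu> \<in> lms gt' J"
    let ?A = "{\<mu>. mon_deg \<mu> = mon_deg \<nu>}"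
    have "lms gt J \<inter> ?A = lms gt' J \<inter> ?A"
    proof (rule card_seteq)
      show "finite (lms gt' J \<inter> ?A)" by (rule finite_subset[OF Int_lower2 finite_mon_deg])
      show "lms gt J \<inter> ?A \<subseteq> lms gt' J \<inter> ?A" using sub by blast
    qed (rule card_lms_le[OF gt(2,1) J])
    with \<nu> show "\<nu> \<in> lms gt J" by blast
  qed
qed (fact sub)


section \<open>Linear changes of coordinates\<close>

definition lin_form :: "'k^'n^'n \<Rightarrow> 'n \<Rightarrow> ('n::finite, 'k::field) mpol" where
  "lin_form g i = (\<Sum>j\<in>UNIV. single (single j 1) (g $ j $ i))"

lemma evaluation_single_0: "evaluation (single 0 :: 'k::field \<Rightarrow> ('n, 'k) mpol)"
  by unfold_locales (simp_all add: single_add mult_single)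

lemma act_eq_val: "act g = evaluation.val (single 0) (lin_form g)"
  unfolding fun_eq_iff act_def evaluation.val_def[OF evaluation_single_0]
    evaluation.mon_val_def[OF evaluation_single_0] lin_form_def by simp

lemmas act_add = evaluation.val_add[OF evaluation_single_0, of "lin_form g", folded act_eq_val]
  and act_mult = evaluation.val_mult[OF evaluation_single_0, of "lin_form g", folded act_eq_val]
  and act_single = evaluation.val_single[OF evaluation_single_0, of "lin_form g", folded act_eq_val]
  and act_0 [simp] = evaluation.val_0[OF evaluation_single_0, of "lin_form g", folded act_eq_val]
  and act_1 = evaluation.val_1[OF evaluation_single_0, of "lin_form g", folded act_eq_val]
  and monom_single = evaluation.mon_val_single[OF evaluation_single_0]
  and monom_def = evaluation.mon_val_def[OF evaluation_single_0]
  for g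

lemma act_const: "act g (single 0 c) = single 0 c"
  by (simp add: act_single monom_def)

lemma act_scale: "act g (single 0 c * f) = single 0 c * act g f"
  by (simp add: act_mult act_const)

lemma act_sum: "act g (sum f X) = (\<Sum>x\<in>X. act g (f x))"
  by (induction X rule: infinite_finite_induct) (simp_all add: act_add)

lemma act_prod: "act g (prod f X) = (\<Prod>x\<in>X. act g (f x))"
  by (induction X rule: infinite_finite_induct) (simp_all add: act_mult act_1)

lemma act_power: "act g (f ^ k) = act g f ^ k"
  by (induction k) (simp_all add: act_mult act_1)

lemma act_var: "act g (single (single i 1) c) = single 0 c * lin_form g i"
  unfolding act_single monom_single by simp

lemma single_sum: "single a (sum f X) = (\<Sum>x\<in>X. single a (f x :: 'b::comm_monoid_add))"
  by (induction X rule: infinite_finite_induct) (simp_all add: single_add)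

lemma act_lin_form: "act h (lin_form g i) = lin_form (h ** g) i"
proof -
  have "act h (lin_form g i) = (\<Sum>j\<in>UNIV. \<Sum>k\<in>UNIV. single (single k 1) (h $ k $ j * g $ j $ i))"
    unfolding lin_form_def[of g] act_sum act_var lin_form_def sum_distrib_left mult_single
    by (simp add: mult.commute)
  also have "\<dots> = (\<Sum>k\<in>UNIV. \<Sum>j\<in>UNIV. single (single k 1) (h $ k $ j * g $ j $ i))"
    by (rule sum.swap)
  also have "\<dots> = lin_form (h ** g) i"
    by (simp add: lin_form_def matrix_matrix_mult_def single_sum)
  finally show ?thesis .
qed

text \<open>Column \<open>i\<close> of a matrix holds the image of the variable \<open>i\<close>, so
  the later substitution becomes the left factor.\<close>

lemma act_act: "act h (act g f) = act (h ** g) f"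
proof (induction f rule: poly_mapping_sum_induct)
  case (single \<nu> c)
  show ?case
    by (simp only: act_single[of _ \<nu>] act_mult act_const monom_def act_prod act_power act_lin_form)
qed (simp_all add: act_add)

lemma lin_form_mat_1: "lin_form (mat 1) i = single (single i 1) 1"
proof -
  have "lin_form (mat 1) i = (\<Sum>j\<in>UNIV. if j = i then single (single j 1) 1 else 0)"
    unfolding lin_form_def mat_def by (rule sum.cong) simp_all
  then show ?thesis by simp
qed

lemma var_power: "single (single i (Suc 0)) (1::'k::field) ^ k = single (single i k) 1"
  for i :: 'n
  by (induction k) (simp_all add: mult_single flip: single_add)

lemma act_mat_1: "act (mat 1) f = f"
proof (induction f rule: poly_mapping_sum_induct)
  case (single \<nu> c)
  have prod: "(\<Prod>i\<in>X. single (h i) (1::'b)) = single (\<Sum>i\<in>X. h i) 1" for X and h :: "'a \<Rightarrow> 'a mon"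
    by (induction X rule: infinite_finite_induct) (simp_all add: mult_single)
  have "(\<Prod>i\<in>UNIV. lin_form (mat 1) i ^ lookup \<nu> i) = single \<nu> (1::'b)"
    by (simp add: lin_form_mat_1 var_power prod mon_eq_sum_single)
  then show ?case by (simp add: act_single monom_def mult_single)
qed (simp_all add: act_add)

lemma homogeneous_prod:
  "(\<And>i. i \<in> X \<Longrightarrow> homogeneous (d i) (f i)) \<Longrightarrow> homogeneous (\<Sum>i\<in>X. d i) (\<Prod>i\<in>X. f i)"
proof (induction X rule: infinite_finite_induct)
  case (insert x X)
  then show ?case by (simp add: homogeneous_mult)
qed (use homogeneous_single[of 0 1] in simp_all)

lemma homogeneous_power: "homogeneous d f \<Longrightarrow> homogeneous (k * d) (f ^ k)"
proof (induction k)
  case (Suc k)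
  then show ?case using homogeneous_mult[of d f "k * d" "f ^ k"] by simp
qed (use homogeneous_single[of 0 1] in simp)

lemma homogeneous_lin_form: "homogeneous 1 (lin_form g i)"
  unfolding lin_form_def
proof (rule homogeneous_sum)
  show "homogeneous 1 (single (single j 1) (g $ j $ i))" for j
    using homogeneous_single[of "single j 1" "g $ j $ i"] by simp
qed

lemma homogeneous_act_single: "homogeneous (mon_deg \<nu>) (act g (single \<nu> c))"
proof -
  have "homogeneous (\<Sum>i\<in>UNIV. lookup \<nu> i * 1) (\<Prod>i\<in>UNIV. lin_form g i ^ lookup \<nu> i)"
    by (intro homogeneous_prod homogeneous_power homogeneous_lin_form)
  then show ?thesis
    unfolding act_single monom_def by (intro homogeneous_scale) (simp add: mon_deg_def)
qed

lemma hom_part_act: "hom_part d (act g f) = act g (hom_part d f)"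
proof (induction f rule: poly_mapping_sum_induct)
  case (single \<nu> c)
  show ?case
    by (simp add: hom_part_homogeneous[OF homogeneous_act_single] hom_part_homogeneous[OF homogeneous_single])
qed (simp_all add: act_add hom_part_add)

lemma homogeneous_act: "homogeneous d f \<Longrightarrow> homogeneous d (act g f)"
  using homogeneous_hom_part[of d "act g f"] by (simp add: hom_part_act hom_part_homogeneous)

lemma graded_act:
  assumes g: "invertible g" and I: "graded I"
  shows "graded (act g ` I)"
proof -
  obtain g' where g': "g ** g' = mat 1" using g by (auto simp: invertible_def)
  note idl = graded_poly_ideal[OF I]
  have "h * act g f \<in> act g ` I" if "f \<in> I" for h f
  proof
    show "h * act g f = act g (act g' h * f)"
      by (simp add: act_mult act_act g' act_mat_1)
    show "act g' h * f \<in> I" using that by (rule poly_ideal_mult[OF idl])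
  qed
  moreover have "act g f + act g f' \<in> act g ` I" if "f \<in> I" "f' \<in> I" for f f'
    using poly_ideal_add[OF idl that] act_add[of g f f'] by (metis imageI)
  moreover have "0 \<in> act g ` I"
    using poly_ideal_0[OF idl] act_0[of g] by (metis imageI)
  moreover have "hom_part d (act g f) \<in> act g ` I" if "f \<in> I" for d f
    unfolding hom_part_act using graded_hom_part[OF I that] by (rule imageI)
  ultimately show ?thesis
    unfolding graded_def poly_ideal_def by blast
qed


section \<open>Generic properties\<close>

text \<open>Generated by closure rules, so that polynomiality of determinants and coefficients is
  checked along their syntax; \<open>polyfun_imp_eval_entries\<close> returns to explicit
  polynomials in the entries.\<close>

inductive polyfun :: "('k::field^'n^'n::finite \<Rightarrow> 'k) \<Rightarrow> bool" where
  polyfun_const: "polyfun (\<lambda>_. c)"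
| polyfun_entry: "polyfun (\<lambda>g. g $ i $ j)"
| polyfun_add: "polyfun p \<Longrightarrow> polyfun q \<Longrightarrow> polyfun (\<lambda>g. p g + q g)"
| polyfun_mult: "polyfun p \<Longrightarrow> polyfun q \<Longrightarrow> polyfun (\<lambda>g. p g * q g)"

lemma polyfun_sum: "(\<And>x. x \<in> X \<Longrightarrow> polyfun (p x)) \<Longrightarrow> polyfun (\<lambda>g. \<Sum>x\<in>X. p x g)"
  by (induction X rule: infinite_finite_induct) (simp_all add: polyfun_const polyfun_add)

lemma polyfun_prod: "(\<And>x. x \<in> X \<Longrightarrow> polyfun (p x)) \<Longrightarrow> polyfun (\<lambda>g. \<Prod>x\<in>X. p x g)"
  by (induction X rule: infinite_finite_induct) (simp_all add: polyfun_const polyfun_mult)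

lemma polyfun_power: "polyfun p \<Longrightarrow> polyfun (\<lambda>g. p g ^ k)"
  by (induction k) (simp_all add: polyfun_const polyfun_mult)

lemma polyfun_diff: "polyfun p \<Longrightarrow> polyfun q \<Longrightarrow> polyfun (\<lambda>g. p g - q g)"
  using polyfun_add[of p "\<lambda>g. - 1 * q g"] polyfun_mult[OF polyfun_const[of "- 1"], of q] by simp

lemma polyfun_det: "polyfun det"
  unfolding det_def[abs_def]
  by (intro polyfun_sum polyfun_mult polyfun_prod polyfun_const polyfun_entry)

lemma evaluation_id: "evaluation (\<lambda>x :: 'k::field. x)"
  by unfold_locales simp_all

lemma eval_entries_eq_val: "eval_entries p g = evaluation.val (\<lambda>x. x) (\<lambda>(i, j). g $ i $ j) p"
  unfolding eval_entries_def evaluation.val_def[OF evaluation_id]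
    evaluation.mon_val_def[OF evaluation_id] by (simp add: case_prod_unfold)

lemma polyfun_imp_eval_entries: "polyfun p \<Longrightarrow> \<exists>q. eval_entries q = p"
proof (induction rule: polyfun.induct)
  case (polyfun_const c)
  have "eval_entries (single 0 c) = (\<lambda>_. c)"
    unfolding fun_eq_iff eval_entries_eq_val evaluation.val_single[OF evaluation_id]
      evaluation.mon_val_def[OF evaluation_id] by simp
  then show ?case by blast
next
  case (polyfun_entry i j)
  have "eval_entries (single (single (i, j) 1) 1) = (\<lambda>g. g $ i $ j)"
    unfolding fun_eq_iff eval_entries_eq_val evaluation.val_single[OF evaluation_id]
      evaluation.mon_val_single[OF evaluation_id] by simp
  then show ?case by blast
next
  case (polyfun_add p q)
  then obtain p' q' where "eval_entries p' = p" "eval_entries q' = q" by blast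
  then have "eval_entries (p' + q') = (\<lambda>g. p g + q g)"
    unfolding fun_eq_iff eval_entries_eq_val evaluation.val_add[OF evaluation_id] by simp
  then show ?case by blast
next
  case (polyfun_mult p q)
  then obtain p' q' where "eval_entries p' = p" "eval_entries q' = q" by blast
  then have "eval_entries (p' * q') = (\<lambda>g. p g * q g)"
    unfolding fun_eq_iff eval_entries_eq_val evaluation.val_mult[OF evaluation_id] by simp
  then show ?case by blast
qed

lemma polyfun_eval_entries: "polyfun (eval_entries p)"
  unfolding eval_entries_def[abs_def] case_prod_unfold
  by (intro polyfun_sum polyfun_mult polyfun_const polyfun_prod polyfun_power polyfun_entry)

lemma polyfun_line:
  assumes "polyfun p"
  shows "\<exists>q. \<forall>s. p (\<chi> i j. g\<^sub>0 $ i $ j + s * (g\<^sub>1 $ i $ j - g\<^sub>0 $ i $ j)) = poly q s"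
  using assms
proof (induction rule: polyfun.induct)
  case (polyfun_const c)
  show ?case by (intro exI[of _ "[:c:]"]) simp
next
  case (polyfun_entry i j)
  show ?case by (intro exI[of _ "[:g\<^sub>0 $ i $ j, g\<^sub>1 $ i $ j - g\<^sub>0 $ i $ j:]"]) simp
next
  case (polyfun_add p q)
  then obtain p' q' where "\<forall>s. p (\<chi> i j. g\<^sub>0 $ i $ j + s * (g\<^sub>1 $ i $ j - g\<^sub>0 $ i $ j)) = poly p' s"
    "\<forall>s. q (\<chi> i j. g\<^sub>0 $ i $ j + s * (g\<^sub>1 $ i $ j - g\<^sub>0 $ i $ j)) = poly q' s" by blast
  then show ?case by (intro exI[of _ "p' + q'"]) simp
next
  case (polyfun_mult p q)
  then obtain p' q' where "\<forall>s. p (\<chi> i j. g\<^sub>0 $ i $ j + s * (g\<^sub>1 $ i $ j - g\<^sub>0 $ i $ j)) = poly p' s"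
    "\<forall>s. q (\<chi> i j. g\<^sub>0 $ i $ j + s * (g\<^sub>1 $ i $ j - g\<^sub>0 $ i $ j)) = poly q' s" by blast
  then show ?case by (intro exI[of _ "p' * q'"]) simp
qed

text \<open>One polynomial suffices: choose one that does not vanish at some point of the open set,
  and multiply it by the determinant to encode invertibility.\<close>

lemma generically_iff:
  "generically P \<longleftrightarrow>
    (\<exists>p g\<^sub>0. polyfun p \<and> p g\<^sub>0 \<noteq> 0 \<and> (\<forall>g. p g \<noteq> 0 \<longrightarrow> invertible g \<and> P g))" (is "_ \<longleftrightarrow> ?R")
proof
  assume "generically P"
  then obtain S where ne: "{g \<in> GL. \<exists>p\<in>S. eval_entries p g \<noteq> 0} \<noteq> {}"
    and P: "\<forall>g\<in>{g \<in> GL. \<exists>p\<in>S. eval_entries p g \<noteq> 0}. P g"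
    unfolding generically_def zariski_open_GL_def by blast
  from ne obtain g\<^sub>0 p where g\<^sub>0: "g\<^sub>0 \<in> GL" "p \<in> S" "eval_entries p g\<^sub>0 \<noteq> 0" by blast
  have "polyfun (\<lambda>g. det g * eval_entries p g)"
    by (intro polyfun_mult polyfun_det polyfun_eval_entries)
  moreover have "det g\<^sub>0 * eval_entries p g\<^sub>0 \<noteq> 0"
    using g\<^sub>0 by (simp add: GL_def invertible_det_nz)
  moreover have "invertible g \<and> P g" if "det g * eval_entries p g \<noteq> 0" for g
    using that P g\<^sub>0(2) by (auto simp: GL_def invertible_det_nz)
  ultimately show ?R by blast
next
  assume ?R
  then obtain p g\<^sub>0 where p: "polyfun p" "p g\<^sub>0 \<noteq> 0" "\<And>g. p g \<noteq> 0 \<Longrightarrow> invertible g \<and> P g" by blast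
  obtain q where q: "eval_entries q = p" using polyfun_imp_eval_entries[OF p(1)] by blast
  let ?U = "{g \<in> GL. \<exists>p\<in>{q}. eval_entries p g \<noteq> 0}"
  have "zariski_open_GL ?U" unfolding zariski_open_GL_def by blast
  moreover have "g\<^sub>0 \<in> ?U" using p(2,3) q by (simp add: GL_def)
  moreover have "\<forall>g\<in>?U. P g" using p(3) q by simp
  ultimately show "generically P" unfolding generically_def by blast
qed

lemma generically_mono: "generically P \<Longrightarrow> (\<And>g. invertible g \<Longrightarrow> P g \<Longrightarrow> Q g) \<Longrightarrow> generically Q"
  unfolding generically_iff by blast

lemma generically_ex: "generically P \<Longrightarrow> \<exists>g. invertible g \<and> P g"
  unfolding generically_iff by blast

lemma generically_True: "generically (\<lambda>g. True)"
  unfolding generically_iff using polyfun_det invertible_det_nz det_I by (metis zero_neq_one)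

text \<open>On the line joining the two witnesses both polynomials become nonzero univariate
  polynomials. Their product has finitely many roots, and the field is infinite.\<close>

lemma generically_conj:
  fixes P :: "'k::field_char_0^'n^'n::finite \<Rightarrow> bool"
  assumes "generically P" "generically Q"
  shows "generically (\<lambda>g. P g \<and> Q g)"
proof -
  obtain p g\<^sub>0 where p: "polyfun p" "p g\<^sub>0 \<noteq> 0" "\<And>g. p g \<noteq> 0 \<Longrightarrow> invertible g \<and> P g"
    using assms(1) unfolding generically_iff by blast
  obtain q g\<^sub>1 where q: "polyfun q" "q g\<^sub>1 \<noteq> 0" "\<And>g. q g \<noteq> 0 \<Longrightarrow> invertible g \<and> Q g"
    using assms(2) unfolding generically_iff by blast
  let ?l = "\<lambda>s. \<chi> i j. g\<^sub>0 $ i $ j + s * (g\<^sub>1 $ i $ j - g\<^sub>0 $ i $ j)"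
  obtain a where a: "\<And>s. p (?l s) = poly a s" using polyfun_line[OF p(1)] by blast
  obtain b where b: "\<And>s. q (?l s) = poly b s" using polyfun_line[OF q(1)] by blast
  have l: "?l 0 = g\<^sub>0" "?l 1 = g\<^sub>1" by (simp_all add: vec_eq_iff)
  have "poly a 0 \<noteq> 0" using p(2) l(1) a[of 0] by simp
  moreover have "poly b 1 \<noteq> 0" using q(2) l(2) b[of 1] by simp
  ultimately have "a * b \<noteq> 0" by auto
  then have "finite {s. poly (a * b) s = 0}" by (rule poly_roots_finite)
  then have "{s. poly (a * b) s = 0} \<noteq> UNIV" using infinite_UNIV_char_0 by metis
  then obtain s where "poly (a * b) s \<noteq> 0" by blast
  then have "p (?l s) * q (?l s) \<noteq> 0" by (simp add: a b)
  moreover have "polyfun (\<lambda>g. p g * q g)" using p(1) q(1) by (rule polyfun_mult)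
  moreover have "invertible g \<and> P g \<and> Q g" if "p g * q g \<noteq> 0" for g
    using that p(3)[of g] q(3)[of g] by simp
  ultimately show ?thesis unfolding generically_iff by blast
qed

lemma generically_ball:
  fixes P :: "'a \<Rightarrow> 'k::field_char_0^'n^'n::finite \<Rightarrow> bool"
  assumes "finite X" "\<And>x. x \<in> X \<Longrightarrow> generically (P x)"
  shows "generically (\<lambda>g. \<forall>x\<in>X. P x g)"
  using assms
proof (induction X)
  case empty
  show ?case using generically_True by simp
next
  case (insert x X)
  then have "generically (\<lambda>g. P x g \<and> (\<forall>x\<in>X. P x g))" by (intro generically_conj) auto
  then show ?case by simp
qed

section \<open>Coefficients as polynomial functions of the matrix\<close>

lemma finite_mon_add_pairs: "finite {(b, c). b + c = (a :: 'n::finite mon)}"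
proof (rule finite_subset)
  show "{(b, c). b + c = a} \<subseteq> (\<Union>d\<le>mon_deg a. {b. mon_deg b = d}) \<times> (\<Union>d\<le>mon_deg a. {b. mon_deg b = d})"
    by (auto simp: mon_deg_add)
  show "finite ((\<Union>d\<le>mon_deg a. {b :: 'n mon. mon_deg b = d}) \<times> (\<Union>d\<le>mon_deg a. {b :: 'n mon. mon_deg b = d}))"
    by (intro finite_cartesian_product finite_UN_I finite_mon_deg finite_atMost)
qed

text \<open>The index set depends on the monomial alone and not on the supports of the factors.
  Hence a coefficient of a product of polynomials that vary with the matrix is a fixed finite
  sum.\<close>

lemma lookup_mult_finite:
  fixes f h :: "('n::finite, 'k::field) mpol"
  shows "lookup (f * h) a = (\<Sum>(b, c)\<in>{(b, c). b + c = a}. lookup f b * lookup h c)"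
proof (induction f rule: poly_mapping_sum_induct)
  case (single \<nu> x)
  show ?case
  proof (induction h rule: poly_mapping_sum_induct)
    case (single \<mu> y)
    have "(\<Sum>(b, c)\<in>{(b, c). b + c = a}. lookup (single \<nu> x) b * lookup (single \<mu> y) c) =
        (\<Sum>z\<in>{(b, c). b + c = a}. if z = (\<nu>, \<mu>) then x * y else 0)"
      by (intro sum.cong) (auto simp: lookup_single when_def split: if_splits)
    also have "\<dots> = (if \<nu> + \<mu> = a then x * y else 0)"
      by (simp add: sum.delta[OF finite_mon_add_pairs[of a], of "(\<nu>, \<mu>)" "\<lambda>_. x * y"])
    finally show ?case by (simp add: mult_single lookup_single when_def)
  next
    case (add f h)
    then show ?case
      by (simp add: distrib_left lookup_add case_prod_unfold sum.distrib)
  qed (simp add: case_prod_unfold)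
next
  case (add f g)
  then show ?case
    by (simp add: distrib_right lookup_add case_prod_unfold sum.distrib)
qed (simp add: case_prod_unfold)

lemma polyfun_lookup_mult:
  fixes F H :: "'k::field^'n^'n::finite \<Rightarrow> ('n, 'k) mpol"
  assumes "\<And>a. polyfun (\<lambda>g. lookup (F g) a)" "\<And>a. polyfun (\<lambda>g. lookup (H g) a)"
  shows "polyfun (\<lambda>g. lookup (F g * H g) a)"
  unfolding lookup_mult_finite case_prod_unfold by (intro polyfun_sum polyfun_mult assms)

lemma polyfun_lookup_act:
  fixes f :: "('n::finite, 'k::field) mpol"
  shows "polyfun (\<lambda>g. lookup (act g f) a)"
proof (induction f arbitrary: a rule: poly_mapping_sum_induct)
  case (single \<nu> c)
  have lin: "polyfun (\<lambda>g. lookup (lin_form g i) a)" for i :: 'n and a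
    unfolding lin_form_def lookup_sum lookup_single when_def
  proof (rule polyfun_sum)
    show "polyfun (\<lambda>g. if single j 1 = a then g $ j $ i else 0)" for j
      by (cases "single j 1 = a") (simp_all add: polyfun_entry polyfun_const)
  qed
  have pow: "polyfun (\<lambda>g. lookup (lin_form g i ^ k) a)" for i :: 'n and k a
    by (induction k arbitrary: a) (simp_all add: polyfun_const polyfun_lookup_mult lin)
  have "polyfun (\<lambda>g. lookup (\<Prod>i\<in>X. lin_form g i ^ lookup \<nu> i) a)" for X a
    by (induction X arbitrary: a rule: infinite_finite_induct)
      (simp_all add: polyfun_const polyfun_lookup_mult pow)
  then show ?case
    unfolding act_single monom_def by (intro polyfun_lookup_mult polyfun_const)
qed (simp_all add: act_add lookup_add polyfun_add polyfun_const)

text \<open>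
  The proof is fraction-free Gaussian elimination, which does not leave the function ring \<open>R\<close>.
\<close>

lemma indep_on_open:
  fixes w :: "'i \<Rightarrow> 'a \<Rightarrow> 'x \<Rightarrow> 'k::field"
  assumes R: "\<And>p q. R p \<Longrightarrow> R q \<Longrightarrow> R (\<lambda>x. p x * q x)" "\<And>p q. R p \<Longrightarrow> R q \<Longrightarrow> R (\<lambda>x. p x - q x)"
    "R (\<lambda>_. 1)"
  assumes "finite X" "\<And>i a. i \<in> X \<Longrightarrow> a \<in> A \<Longrightarrow> R (w i a)" "indep_on A X (\<lambda>i a. w i a x\<^sub>0)"
  shows "\<exists>p. R p \<and> p x\<^sub>0 \<noteq> 0 \<and> (\<forall>x. p x \<noteq> 0 \<longrightarrow> indep_on A X (\<lambda>i a. w i a x))"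
  using assms(4-6)
proof (induction X arbitrary: w)
  case empty
  show ?case using R(3) by (intro exI[of _ "\<lambda>_. 1"]) (simp add: indep_on_def)
next
  case (insert j X)
  have "\<exists>b\<in>A. w j b x\<^sub>0 \<noteq> 0"
  proof (rule ccontr)
    assume *: "\<not> ?thesis"
    have "(\<Sum>i\<in>insert j X. (if i = j then 1 else 0) * w i a x\<^sub>0) = 0" if "a \<in> A" for a
      by (rule sum.neutral) (use * that in simp)
    from indep_onD[OF insert.prems(2), of "\<lambda>i. if i = j then 1 else 0" j, OF this]
    show False by simp
  qed
  then obtain b where b: "b \<in> A" "w j b x\<^sub>0 \<noteq> 0" by blast
  define u where "u = (\<lambda>i a x. w j b x * w i a x - w i b x * w j a x)"
  have sum_u: "(\<Sum>i\<in>X. c i * u i a x) = w j b x * (\<Sum>i\<in>X. c i * w i a x) - (\<Sum>i\<in>X. c i * w i b x) * w j a x"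
    for c a x
    by (simp add: u_def right_diff_distrib sum_subtractf sum_distrib_left sum_distrib_right mult_ac)
  have uR: "R (u i a)" if "i \<in> X" "a \<in> A" for i a
    unfolding u_def using that b(1) insert.prems(1) by (intro R) simp_all
  have "indep_on A X (\<lambda>i a. u i a x\<^sub>0)"
    unfolding indep_on_def
  proof (intro allI impI ballI)
    fix c i assume c: "\<forall>a\<in>A. (\<Sum>i\<in>X. c i * u i a x\<^sub>0) = 0" and i: "i \<in> X"
    \<comment> \<open>A relation among the eliminated rows lifts to the original rows: multiply it
      by the pivot and let row \<open>j\<close> cancel column \<open>b\<close>.\<close>
    define c' where "c' = (\<lambda>i. if i = j then - (\<Sum>i\<in>X. c i * w i b x\<^sub>0) else c i * w j b x\<^sub>0)"
    have "(\<Sum>i\<in>insert j X. c' i * w i a x\<^sub>0) = 0" if "a \<in> A" for a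
    proof -
      have "(\<Sum>i\<in>X. c' i * w i a x\<^sub>0) = (\<Sum>i\<in>X. w j b x\<^sub>0 * (c i * w i a x\<^sub>0))"
        using insert.hyps(2) by (intro sum.cong) (auto simp: c'_def)
      then have "(\<Sum>i\<in>insert j X. c' i * w i a x\<^sub>0) = (\<Sum>i\<in>X. c i * u i a x\<^sub>0)"
        using insert.hyps by (simp add: c'_def sum_u sum_distrib_left)
      then show ?thesis using c that by simp
    qed
    from indep_onD[OF insert.prems(2), of c', OF this] have "c' i = 0" using i by simp
    then show "c i = 0" using i insert.hyps(2) b(2) by (auto simp: c'_def split: if_splits)
  qed
  from insert.IH[OF uR this] obtain p where p: "R p" "p x\<^sub>0 \<noteq> 0"
    "\<And>x. p x \<noteq> 0 \<Longrightarrow> indep_on A X (\<lambda>i a. u i a x)" by blast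
  have "indep_on A (insert j X) (\<lambda>i a. w i a x)" if "p x * w j b x \<noteq> 0" for x
    unfolding indep_on_def
  proof (intro allI impI)
    fix c assume "\<forall>a\<in>A. (\<Sum>i\<in>insert j X. c i * w i a x) = 0"
    then have c: "(\<Sum>i\<in>X. c i * w i a x) = - (c j * w j a x)" if "a \<in> A" for a
      using that insert.hyps by (simp add: eq_neg_iff_add_eq_0 add.commute)
    have "(\<Sum>i\<in>X. c i * u i a x) = 0" if "a \<in> A" for a
      by (simp add: sum_u c[OF that] c[OF b(1)])
    moreover have "indep_on A X (\<lambda>i a. u i a x)" using p(3) \<open>p x * w j b x \<noteq> 0\<close> by simp
    ultimately have X: "\<forall>i\<in>X. c i = 0" unfolding indep_on_def by blast
    then have "(\<Sum>i\<in>X. c i * w i b x) = 0" by (intro sum.neutral) simp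
    with c[OF b(1)] \<open>p x * w j b x \<noteq> 0\<close> have "c j = 0" by simp
    with X show "\<forall>i\<in>insert j X. c i = 0" by simp
  qed
  moreover have "R (\<lambda>x. p x * w j b x)"
    using p(1) insert.prems(1) b(1) by (intro R(1)) simp_all
  moreover have "p x\<^sub>0 * w j b x\<^sub>0 \<noteq> 0" using p(2) b(2) by simp
  ultimately show ?case by (intro exI[of _ "\<lambda>x. p x * w j b x"]) blast
qed


section \<open>Existence of generic initial ideals\<close>

text \<open>Every sequence in a linear order has a monotone subsequence, and a decreasing one of
  natural numbers is constant from its least value on.\<close>

lemma nat_incseq_subseq:
  fixes f :: "nat \<Rightarrow> nat"
  obtains r :: "nat \<Rightarrow> nat" where "strict_mono r" "incseq (\<lambda>n. f (r n))"
proof -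
  obtain r :: "nat \<Rightarrow> nat" where r: "strict_mono r" "monoseq (\<lambda>n. f (r n))"
    using seq_monosub[of f] by blast
  show ?thesis
  proof (cases "incseq (\<lambda>n. f (r n))")
    case True
    with r(1) show ?thesis by (rule that)
  next
    case False
    with r(2) have dec: "decseq (\<lambda>n. f (r n))"
      unfolding monoseq_def incseq_def decseq_def by blast
    obtain k where k: "\<And>n. f (r k) \<le> f (r n)"
      using ex_has_least_nat[of "\<lambda>_. True" 0 "\<lambda>n. f (r n)"] by auto
    have "f (r (k + n)) = f (r k)" for n
      using k[of "k + n"] decseqD[OF dec, of k "k + n"] by simp
    then have "incseq (\<lambda>n. f (r (k + n)))" by (simp add: incseq_def)
    moreover have "strict_mono (\<lambda>n. r (k + n))"
      using r(1) by (simp add: strict_mono_def)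
    ultimately show ?thesis by (intro that)
  qed
qed

lemma fun_incseq_subseq:
  fixes f :: "nat \<Rightarrow> 'i \<Rightarrow> nat"
  assumes "finite X"
  shows "\<exists>r :: nat \<Rightarrow> nat. strict_mono r \<and> (\<forall>i\<in>X. incseq (\<lambda>n. f (r n) i))"
  using assms
proof (induction X)
  case empty
  show ?case by (intro exI[of _ id]) (simp add: strict_mono_def)
next
  case (insert x X)
  then obtain r where r: "strict_mono r" "\<forall>i\<in>X. incseq (\<lambda>n. f (r n) i)" by blast
  obtain q :: "nat \<Rightarrow> nat" where q: "strict_mono q" "incseq (\<lambda>n. f (r (q n)) x)"
    by (rule nat_incseq_subseq)
  have "incseq (\<lambda>n. f (r (q n)) i)" if "i \<in> X" for i
  proof (rule incseq_SucI)
    fix n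
    have "q n \<le> q (Suc n)" using q(1) by (simp add: strict_mono_less_eq)
    with r(2) that show "f (r (q n)) i \<le> f (r (q (Suc n))) i" unfolding incseq_def by blast
  qed
  with r(1) q show ?case
    by (intro exI[of _ "\<lambda>n. r (q n)"]) (simp add: strict_mono_def)
qed

text \<open>\<open>B\<close> consists of the elements that are minimal for divisibility. Were it
  infinite, a sequence of distinct elements would have a subsequence increasing in each exponent,
  hence one element properly dividing another. This lets finitely many degrees control a monomial
  ideal.\<close>

lemma dickson:
  fixes N :: "'n::finite mon set"
  obtains B where "finite B" "B \<subseteq> N" "\<forall>\<nu>\<in>N. \<exists>\<beta>\<in>B. \<exists>a. \<nu> = a + \<beta>"
proof -
  define B where "B = {\<beta> \<in> N. \<forall>\<gamma>\<in>N. (\<exists>a. \<beta> = a + \<gamma>) \<longrightarrow> \<gamma> = \<beta>}"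
  have "\<exists>\<beta>\<in>B. \<exists>a. \<nu> = a + \<beta>" if "\<nu> \<in> N" for \<nu>
    using that
  proof (induction "mon_deg \<nu>" arbitrary: \<nu> rule: less_induct)
    case less
    show ?case
    proof (cases "\<nu> \<in> B")
      case True
      then show ?thesis by (intro bexI[of _ \<nu>] exI[of _ 0]) simp_all
    next
      case False
      then obtain \<gamma> a where \<gamma>: "\<gamma> \<in> N" "\<nu> = a + \<gamma>" "\<gamma> \<noteq> \<nu>"
        using less.prems unfolding B_def by blast
      then have "mon_deg a \<noteq> 0" by (metis add_0 mon_deg_eq_0_iff)
      then have "mon_deg \<gamma> < mon_deg \<nu>" using \<gamma>(2) by (simp add: mon_deg_add)
      from less.hyps[OF this \<gamma>(1)] obtain \<beta> b where "\<beta> \<in> B" "\<gamma> = b + \<beta>" by blast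
      with \<gamma>(2) show ?thesis
        by (intro bexI[of _ \<beta>] exI[of _ "a + b"]) (simp_all add: add.assoc)
    qed
  qed
  moreover have "finite B"
  proof (rule ccontr)
    assume "infinite B"
    then obtain f :: "nat \<Rightarrow> 'n mon" where f: "inj f" "range f \<subseteq> B"
      using infinite_countable_subset by blast
    obtain r :: "nat \<Rightarrow> nat" where r: "strict_mono r" "\<And>i. incseq (\<lambda>n. lookup (f (r n)) i)"
      using fun_incseq_subseq[of "UNIV :: 'n set" "\<lambda>n. lookup (f n)"] by auto
    have "lookup (f (r 0)) i \<le> lookup (f (r 1)) i" for i
      using r(2)[of i] unfolding incseq_def by simp
    then obtain \<rho> where "f (r 1) = f (r 0) + \<rho>" by (rule exists_diff_mon)
    then have "f (r 1) = \<rho> + f (r 0)" by (simp add: add.commute)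
    moreover have "f (r 1) \<in> B" "f (r 0) \<in> N" using f(2) unfolding B_def by blast+
    ultimately have "f (r 0) = f (r 1)" unfolding B_def by blast
    then have "r 0 = r 1" using f(1) by (simp add: inj_eq)
    then show False using r(1) strict_monoD[of r 0 1] by simp
  qed
  moreover have "B \<subseteq> N" unfolding B_def by blast
  ultimately show ?thesis by (intro that) blast+
qed

section \<open>Ranks of projections under varying coordinates\<close>

definition upset :: "('n mon \<Rightarrow> 'n mon \<Rightarrow> bool) \<Rightarrow> nat \<Rightarrow> 'n::finite mon set \<Rightarrow> bool" where
  "upset gt d A \<longleftrightarrow> A \<subseteq> {\<nu>. mon_deg \<nu> = d} \<and> (\<forall>a\<in>A. \<forall>b. mon_deg b = d \<longrightarrow> gt b a \<longrightarrow> b \<in> A)"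

text \<open>
  For an upset \<open>A\<close> the cardinality below is the rank of the projection of \<open>act g ` I\<close>
  to the coefficients in \<open>A\<close>.
\<close>

definition max_rank ::
  "('n mon \<Rightarrow> 'n mon \<Rightarrow> bool) \<Rightarrow> ('n::finite, 'k::field) mpol set \<Rightarrow> nat \<Rightarrow> 'k^'n^'n \<Rightarrow> bool" where
  "max_rank gt I d g \<longleftrightarrow> (\<forall>A. upset gt d A \<longrightarrow> (\<forall>h. invertible h \<longrightarrow>
     card (lms gt (act h ` I) \<inter> A) \<le> card (lms gt (act g ` I) \<inter> A)))"

lemma generically_nonzero:
  assumes "polyfun p" "p h \<noteq> 0" "invertible h"
  shows "generically (\<lambda>g. p g \<noteq> 0)"
  unfolding generically_iff
proof (intro exI conjI allI impI)
  show "polyfun (\<lambda>g. det g * p g)" by (intro polyfun_mult polyfun_det assms)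
  show "det h * p h \<noteq> 0" using assms by (simp add: invertible_det_nz)
qed (auto simp: invertible_det_nz)

text \<open>Elements that are independent on \<open>A\<close> after applying \<open>h\<close> are
  pulled back to \<open>I\<close> and moved by a variable \<open>g\<close>. Independence persists on
  an open set, so the rank does not fall there.\<close>

lemma generically_card_lms:
  fixes I :: "('n::finite, 'k::field_char_0) mpol set"
  assumes gt: "term_order gt" and I: "graded I" and A: "upset gt d A" and h: "invertible h"
  shows "generically (\<lambda>g. card (lms gt (act h ` I) \<inter> A) \<le> card (lms gt (act g ` I) \<inter> A))"
proof -
  let ?B = "lms gt (act h ` I) \<inter> A"
  have Ad: "A \<subseteq> {\<nu>. mon_deg \<nu> = d}" and Aup: "\<And>a b. a \<in> A \<Longrightarrow> mon_deg b = d \<Longrightarrow> gt b a \<Longrightarrow> b \<in> A"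
    using A unfolding upset_def by blast+
  have fin: "finite ?B" using finite_subset[OF Ad finite_mon_deg] by blast
  obtain f where f: "\<forall>\<beta>\<in>?B. f \<beta> \<in> act h ` I \<and> homogeneous d (f \<beta>)"
    "indep_on A ?B (\<lambda>\<beta>. lookup (f \<beta>))"
    by (rule exists_indep_on_lms[OF gt graded_act[OF h I] Ad])
  have "\<forall>\<beta>\<in>?B. \<exists>u. u \<in> I \<and> homogeneous d u \<and> act h u = f \<beta>"
  proof
    fix \<beta> assume "\<beta> \<in> ?B"
    with f(1) obtain u where u: "u \<in> I" "f \<beta> = act h u" "homogeneous d (f \<beta>)" by blast
    have "act h (hom_part d u) = hom_part d (f \<beta>)" by (simp add: u(2) hom_part_act)
    also have "\<dots> = f \<beta>" using hom_part_homogeneous[OF u(3), of d] by simp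
    finally show "\<exists>u. u \<in> I \<and> homogeneous d u \<and> act h u = f \<beta>"
      using graded_hom_part[OF I u(1)] homogeneous_hom_part by blast
  qed
  from bchoice[OF this] obtain u where
    u: "\<forall>\<beta>\<in>?B. u \<beta> \<in> I \<and> homogeneous d (u \<beta>) \<and> act h (u \<beta>) = f \<beta>" by blast
  have ind: "indep_on A ?B (\<lambda>\<beta> a. lookup (act h (u \<beta>)) a)"
    using f(2) u unfolding indep_on_def by simp
  have "\<exists>p. polyfun p \<and> p h \<noteq> 0 \<and>
      (\<forall>g. p g \<noteq> 0 \<longrightarrow> indep_on A ?B (\<lambda>\<beta> a. lookup (act g (u \<beta>)) a))"
    by (rule indep_on_open[where R = polyfun, OF polyfun_mult polyfun_diff polyfun_const fin
          polyfun_lookup_act ind])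
  then obtain p where p: "polyfun p" "p h \<noteq> 0"
    "\<And>g. p g \<noteq> 0 \<Longrightarrow> indep_on A ?B (\<lambda>\<beta>. lookup (act g (u \<beta>)))" by blast
  show ?thesis
  proof (rule generically_mono[OF generically_nonzero[OF p(1,2) h]])
    fix g :: "'k^'n^'n" assume g: "invertible g" "p g \<noteq> 0"
    show "card ?B \<le> card (lms gt (act g ` I) \<inter> A)"
    proof (rule card_indep_on_le_lms[OF gt graded_poly_ideal[OF graded_act[OF g(1) I]] fin _ Ad Aup
          p(3)[OF g(2)]])
      show "\<forall>\<beta>\<in>?B. act g (u \<beta>) \<in> act g ` I \<and> homogeneous d (act g (u \<beta>))"
        using u homogeneous_act by blast
    qed
  qed
qed

text \<open>For one \<open>A\<close> the count is bounded by the size of \<open>A\<close>, so some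
  matrix attains the maximum, and the maximum is kept generically. A fixed degree has only finitely
  many such \<open>A\<close>.\<close>

lemma generically_max_rank:
  fixes I :: "('n::finite, 'k::field_char_0) mpol set"
  assumes gt: "term_order gt" and I: "graded I"
  shows "generically (max_rank gt I d)"
proof -
  have "generically (\<lambda>g. \<forall>h. invertible h \<longrightarrow>
      card (lms gt (act h ` I) \<inter> A) \<le> card (lms gt (act g ` I) \<inter> A))" if A: "upset gt d A" for A
  proof -
    have fin: "finite A" using A finite_mon_deg[of d] unfolding upset_def by (metis finite_subset)
    have "\<exists>h :: 'k^'n^'n. invertible h \<and> (\<forall>h'. invertible h' \<longrightarrow>
        card (lms gt (act h' ` I) \<inter> A) \<le> card (lms gt (act h ` I) \<inter> A))"
    proof (rule ex_has_greatest_nat)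
      show "invertible (mat 1 :: 'k^'n^'n)" by (simp add: invertible_def)
      show "\<forall>h :: 'k^'n^'n. invertible h \<longrightarrow> card (lms gt (act h ` I) \<inter> A) < Suc (card A)"
        using fin by (simp add: less_Suc_eq_le card_mono)
    qed
    then obtain h :: "'k^'n^'n" where h: "invertible h" "\<And>h'. invertible h' \<Longrightarrow>
        card (lms gt (act h' ` I) \<inter> A) \<le> card (lms gt (act h ` I) \<inter> A)" by blast
    show ?thesis
      by (rule generically_mono[OF generically_card_lms[OF gt I A h(1)]])
        (use h(2) order.trans in blast)
  qed
  then have "generically (\<lambda>g. \<forall>A\<in>{A. upset gt d A}. \<forall>h. invertible h \<longrightarrow>
      card (lms gt (act h ` I) \<inter> A) \<le> card (lms gt (act g ` I) \<inter> A))"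
  proof (intro generically_ball)
    show "finite {A. upset gt d A}"
    proof (rule finite_subset)
      show "{A. upset gt d A} \<subseteq> Pow {\<nu>. mon_deg \<nu> = d}" unfolding upset_def by blast
      show "finite (Pow {\<nu> :: 'n mon. mon_deg \<nu> = d})" by (simp add: finite_mon_deg)
    qed
  qed simp
  then show ?thesis
    by (rule generically_mono) (simp add: max_rank_def)
qed

text \<open>Whether \<beta> is a leading monomial can be read off from two counts: over the
  monomials above \<beta>, and over these together with \<beta>. Two matrices of maximal rank have
  the same counts.\<close>

lemma max_rank_lms_eq:
  assumes gt: "term_order gt" and "max_rank gt I d g" "invertible g" "max_rank gt I d h" "invertible h"
  shows "lms gt (act g ` I) \<inter> {\<nu>. mon_deg \<nu> = d} = lms gt (act h ` I) \<inter> {\<nu>. mon_deg \<nu> = d}"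
proof -
  have card: "card (lms gt (act g ` I) \<inter> A) = card (lms gt (act h ` I) \<inter> A)" if "upset gt d A" for A
    using assms that unfolding max_rank_def by (meson order.antisym)
  have "\<beta> \<in> lms gt (act g ` I) \<longleftrightarrow> \<beta> \<in> lms gt (act h ` I)" if \<beta>: "mon_deg \<beta> = d" for \<beta>
  proof -
    define A where "A = {\<alpha>. mon_deg \<alpha> = d \<and> gt \<alpha> \<beta>}"
    have fin: "finite A" unfolding A_def by (rule finite_subset[OF _ finite_mon_deg[of d]]) blast
    have "\<beta> \<notin> A" unfolding A_def using term_order_irrefl[OF gt] by blast
    have up: "upset gt d A" "upset gt d (insert \<beta> A)"
      unfolding upset_def A_def using \<beta> term_order_trans[OF gt] by auto
    have ins: "card (X \<inter> insert \<beta> A) = card (X \<inter> A) + (if \<beta> \<in> X then 1 else 0)" for X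
      using fin \<open>\<beta> \<notin> A\<close> by (simp add: Int_insert_right)
    show ?thesis
      using card[OF up(1)] card[OF up(2)] unfolding ins by (simp split: if_splits)
  qed
  then show ?thesis by blast
qed

text \<open>\<open>N\<close> is assembled degree by degree from matrices of maximal rank. Agreement
  in the degrees of its finitely many generators gives one inclusion, maximality of the counts the
  other. The second conclusion offers one matrix of maximal rank per degree, since maximality in all
  degrees at once is not a finite conjunction.\<close>

lemma generic_lms:
  fixes I :: "('n::finite, 'k::field_char_0) mpol set"
  assumes gt: "term_order gt" and I: "graded I"
  obtains N where "generically (\<lambda>g. lms gt (act g ` I) = N)"
    "\<forall>d. \<exists>g. invertible g \<and> max_rank gt I d g \<and>
       lms gt (act g ` I) \<inter> {\<nu>. mon_deg \<nu> = d} = N \<inter> {\<nu>. mon_deg \<nu> = d}"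
proof -
  let ?M = "\<lambda>d. {\<nu> :: 'n mon. mon_deg \<nu> = d}"
  have "\<exists>g. invertible g \<and> max_rank gt I d g" for d
    using generically_ex[OF generically_max_rank[OF gt I]] .
  then obtain G where G: "\<And>d. invertible (G d)" "\<And>d. max_rank gt I d (G d)" by metis
  define N where "N = {\<nu>. \<nu> \<in> lms gt (act (G (mon_deg \<nu>)) ` I)}"
  have N: "lms gt (act (G d) ` I) \<inter> ?M d = N \<inter> ?M d" for d
    unfolding N_def by blast
  have gen: "generically (\<lambda>g. lms gt (act g ` I) \<inter> ?M d = N \<inter> ?M d)" for d
    by (rule generically_mono[OF generically_max_rank[OF gt I, of d]])
      (use max_rank_lms_eq[OF gt _ _ G(2,1)] N in blast)
  obtain B where B: "finite B" "B \<subseteq> N" "\<forall>\<nu>\<in>N. \<exists>\<beta>\<in>B. \<exists>a. \<nu> = a + \<beta>"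
    by (rule dickson)
  have "generically (\<lambda>g. \<forall>d\<in>mon_deg ` B. lms gt (act g ` I) \<inter> ?M d = N \<inter> ?M d)"
    using B(1) gen by (intro generically_ball) simp_all
  then have "generically (\<lambda>g. lms gt (act g ` I) = N)"
  proof (rule generically_mono)
    fix g :: "'k^'n^'n"
    assume g: "invertible g" and eq: "\<forall>d\<in>mon_deg ` B. lms gt (act g ` I) \<inter> ?M d = N \<inter> ?M d"
    have sub: "N \<subseteq> lms gt (act g ` I)"
    proof
      fix \<nu> assume "\<nu> \<in> N"
      then obtain \<beta> a where \<beta>: "\<beta> \<in> B" "\<nu> = a + \<beta>" using B(3) by blast
      then have "\<beta> \<in> N \<inter> ?M (mon_deg \<beta>)" using B(2) by blast
      then have "\<beta> \<in> lms gt (act g ` I)" using eq \<beta>(1) by blast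
      then show "\<nu> \<in> lms gt (act g ` I)"
        unfolding \<beta>(2) by (rule lms_add[OF gt graded_poly_ideal[OF graded_act[OF g I]]])
    qed
    have "N \<inter> ?M d = lms gt (act g ` I) \<inter> ?M d" for d
    proof (rule card_seteq)
      show "finite (lms gt (act g ` I) \<inter> ?M d)" by (rule finite_subset[OF Int_lower2 finite_mon_deg])
      show "N \<inter> ?M d \<subseteq> lms gt (act g ` I) \<inter> ?M d" using sub by blast
      \<comment> \<open>A whole degree is closed towards larger monomials, so the maximal rank of
        \<open>G d\<close> bounds the count at \<open>g\<close> by the count for
        \<open>N\<close>.\<close>
      have "upset gt d (?M d)" unfolding upset_def by blast
      then show "card (lms gt (act g ` I) \<inter> ?M d) \<le> card (N \<inter> ?M d)"
        using G(2)[of d] g unfolding max_rank_def N[symmetric] by blast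
    qed
    then show "lms gt (act g ` I) = N" by blast
  qed
  moreover have "\<forall>d. \<exists>g. invertible g \<and> max_rank gt I d g \<and> lms gt (act g ` I) \<inter> ?M d = N \<inter> ?M d"
    using G N by blast
  ultimately show ?thesis by (rule that)
qed


section \<open>Generic initial ideals are strongly stable\<close>

text \<open>The substitution that sends \<open>x_j\<close> to \<open>x_j + s x_i\<close> and fixes
  the other variables; its derivative at \<open>s = 0\<close> is the derivation
  \<open>x_i d/dx_j\<close>.\<close>

definition transvection :: "'n \<Rightarrow> 'n \<Rightarrow> 'k \<Rightarrow> 'k::field^'n^'n::finite" where
  "transvection i j s = (\<chi> a b. (if a = b then 1 else 0) + (if a = i \<and> b = j then s else 0))"

text \<open>If \<nu> does not contain the variable \<open>j\<close>, the truncated subtraction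
  leaves a meaningless exponent, but then the coefficient is 0.\<close>

definition mon_deriv :: "'n \<Rightarrow> 'n \<Rightarrow> 'n mon \<Rightarrow> ('n, 'k::field) mpol" where
  "mon_deriv i j \<nu> = single (\<nu> - single j 1 + single i 1) (of_nat (lookup \<nu> j))"

text \<open>The derivation \<open>x\<^sub>i \<partial>/\<partial>x\<^sub>j\<close>.\<close>

definition deriv_var :: "'n \<Rightarrow> 'n \<Rightarrow> ('n, 'k::field) mpol \<Rightarrow> ('n, 'k) mpol" where
  "deriv_var i j f = (\<Sum>\<nu>\<in>keys f. single 0 (lookup f \<nu>) * mon_deriv i j \<nu>)"

text \<open>The Leibniz rule, which matches the linear coefficient of a product of polynomials in
  \<open>s\<close>.\<close>

lemma mon_deriv_add:
  "mon_deriv i j (\<nu> + \<mu>) = single \<nu> 1 * mon_deriv i j \<mu> + mon_deriv i j \<nu> * single \<mu> 1"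
proof -
  have 1: "single \<nu> 1 * mon_deriv i j \<mu> = single (\<nu> + \<mu> - single j 1 + single i 1) (of_nat (lookup \<mu> j))"
    for \<nu> \<mu> :: "'a mon"
  proof (cases "lookup \<mu> j = 0")
    case False
    have "\<nu> + (\<mu> - single j 1 + single i 1) = \<nu> + \<mu> - single j 1 + single i 1"
      using False by (intro poly_mapping_eqI) (auto simp: lookup_add lookup_minus lookup_single when_def)
    then show ?thesis by (simp add: mon_deriv_def mult_single)
  qed (simp add: mon_deriv_def)
  show ?thesis
    unfolding 1 mult.commute[of "mon_deriv i j \<nu>"]
    by (simp add: mon_deriv_def lookup_add single_add add.commute)
qed

text \<open>The expansion in powers of \<open>s\<close>. By the Leibniz rule the claim is stable
  under products of monomials, so it is enough to treat 1 and the variables.\<close>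

lemma act_transvection_mon:
  "\<exists>Q. (\<forall>s. act (transvection i j s) (single \<nu> 1) = poly Q (single 0 s)) \<and>
     coeff Q 0 = single \<nu> (1::'k::field) \<and> coeff Q 1 = mon_deriv i j \<nu>" (is "?P \<nu>")
proof -
  have add: "?P (\<nu> + \<mu>)" if "?P \<nu>" "?P \<mu>" for \<nu> \<mu>
  proof -
    obtain P Q where
      P: "\<And>s. act (transvection i j s) (single \<nu> 1) = poly P (single 0 s)"
        "coeff P 0 = single \<nu> (1::'k)" "coeff P 1 = mon_deriv i j \<nu>" and
      Q: "\<And>s. act (transvection i j s) (single \<mu> 1) = poly Q (single 0 s)"
        "coeff Q 0 = single \<mu> (1::'k)" "coeff Q 1 = mon_deriv i j \<mu>"
      using \<open>?P \<nu>\<close> \<open>?P \<mu>\<close> by blast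
    have eq: "single (\<nu> + \<mu>) (1::'k) = single \<nu> 1 * single \<mu> 1" by (simp add: mult_single)
    show ?thesis
    proof (intro exI[of _ "P * Q"] conjI allI)
      fix s
      show "act (transvection i j s) (single (\<nu> + \<mu>) 1) = poly (P * Q) (single 0 s)"
        unfolding eq act_mult P(1) Q(1) by simp
      show "coeff (P * Q) 0 = single (\<nu> + \<mu>) 1" unfolding eq coeff_mult by (simp add: P(2) Q(2))
      show "coeff (P * Q) 1 = mon_deriv i j (\<nu> + \<mu>)"
        using P(2,3) Q(2,3) unfolding mon_deriv_add coeff_mult by simp
    qed
  qed
  have zero: "?P 0"
  proof (intro exI[of _ "[:1:]"] conjI allI)
    show "act (transvection i j s) (single 0 1) = poly [:1:] (single 0 s)" for s
      by (simp add: act_1)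
  qed (simp_all add: mon_deriv_def)
  have var: "?P (single b 1)" for b
  proof (intro exI[of _ "[:single (single b 1) 1, if b = j then single (single i 1) 1 else 0:]"] conjI allI)
    fix s :: 'k
    have "lin_form (transvection i j s) b =
        (\<Sum>a\<in>UNIV. (if a = b then single (single b 1) 1 else 0) +
           (if a = i then if b = j then single (single i 1) s else 0 else 0))"
      unfolding lin_form_def transvection_def by (rule sum.cong) (simp_all add: single_add)
    also have "\<dots> = single (single b 1) 1 + (if b = j then single (single i 1) s else 0)"
      by (simp add: sum.distrib)
    finally show "act (transvection i j s) (single (single b 1) 1) =
        poly [:single (single b 1) 1, if b = j then single (single i 1) 1 else 0:] (single 0 s)"
      unfolding act_var by (simp add: mult_single)
    have "single j 1 - single j 1 + single i (1::nat) = single i 1" by simp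
    then show "coeff [:single (single b 1) (1::'k), if b = j then single (single i 1) 1 else 0:] 1 =
        mon_deriv i j (single b 1)"
      by (auto simp: mon_deriv_def lookup_single when_def)
  qed simp
  have "?P (single b k)" for b k
  proof (induction k)
    case (Suc k)
    have "single b (Suc k) = single b 1 + single b k" by (simp flip: single_add)
    with add[OF var Suc, of b] show ?case by simp
  qed (use zero in simp)
  then show ?thesis
    by (induction \<nu> rule: poly_mapping_sum_induct) (use zero add in blast)+
qed

text \<open>Splitting off the constant coefficient \<open>f\<close> exhibits the change of
  \<open>f\<close> as \<open>s\<close> times a polynomial in \<open>s\<close>, ready for division by
  \<open>s\<close>.\<close>

lemma act_transvection:
  fixes f :: "('n::finite, 'k::field) mpol"
  obtains Q where "\<forall>s. act (transvection i j s) f = poly (pCons f Q) (single 0 s)"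
    "coeff Q 0 = deriv_var i j f"
proof -
  have "\<forall>\<nu>. \<exists>Q. (\<forall>s. act (transvection i j s) (single \<nu> 1) = poly Q (single 0 s)) \<and>
     coeff Q 0 = single \<nu> (1::'k) \<and> coeff Q 1 = mon_deriv i j \<nu>"
    using act_transvection_mon by blast
  from choice[OF this] obtain q where
    q: "\<And>\<nu> s. act (transvection i j s) (single \<nu> 1) = poly (q \<nu>) (single 0 s)"
      "\<And>\<nu>. coeff (q \<nu>) 0 = single \<nu> (1::'k)" "\<And>\<nu>. coeff (q \<nu>) 1 = mon_deriv i j \<nu>" by blast
  define P where "P = (\<Sum>\<nu>\<in>keys f. smult (single 0 (lookup f \<nu>)) (q \<nu>))"
  have f: "f = (\<Sum>\<nu>\<in>keys f. single 0 (lookup f \<nu>) * single \<nu> 1)"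
    using poly_mapping_sum_single[of "keys f" f] by (simp add: mult_single)
  have P: "act (transvection i j s) f = poly P (single 0 s)" for s
    by (subst f) (simp add: P_def act_sum act_scale q(1) poly_sum)
  have P0: "coeff P 0 = f"
  proof -
    have "coeff P 0 = (\<Sum>\<nu>\<in>keys f. single 0 (lookup f \<nu>) * single \<nu> 1)"
      by (simp add: P_def coeff_sum q(2))
    then show ?thesis using f by (rule trans[OF _ sym])
  qed
  have P1: "coeff P 1 = deriv_var i j f"
    using q(3) by (simp add: P_def coeff_sum deriv_var_def)
  obtain a Q where Q: "P = pCons a Q" by (rule pCons_cases)
  show ?thesis
  proof (rule that)
    show "\<forall>s. act (transvection i j s) f = poly (pCons f Q) (single 0 s)"
      using P P0 Q by simp
    show "coeff Q 0 = deriv_var i j f" using P1 Q by simp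
  qed
qed

lemma lookup_poly_single:
  fixes Q :: "('n, 'k::field) mpol poly"
  shows "lookup (poly Q (single 0 s)) a = poly (map_poly (\<lambda>c. lookup c a) Q) s"
  by (induction Q) (simp_all add: map_poly_pCons lookup_add lookup_scale)

lemma indep_on_scale:
  assumes "indep_on A X w" "\<And>i. i \<in> X \<Longrightarrow> t i \<noteq> 0"
    "\<And>i a. i \<in> X \<Longrightarrow> a \<in> A \<Longrightarrow> v i a = t i * w i a"
  shows "indep_on A X v"
  unfolding indep_on_def
proof (intro allI impI ballI)
  fix c i assume c: "\<forall>a\<in>A. (\<Sum>i\<in>X. c i * v i a) = 0" and i: "i \<in> X"
  have "(\<Sum>i\<in>X. (c i * t i) * w i a) = 0" if "a \<in> A" for a
  proof -
    have "(\<Sum>i\<in>X. (c i * t i) * w i a) = (\<Sum>i\<in>X. c i * v i a)"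
      using that assms(3) by (intro sum.cong) (simp_all add: mult.assoc)
    with c that show ?thesis by simp
  qed
  from indep_onD[OF assms(1), of "\<lambda>i. c i * t i", OF this i] show "c i = 0"
    using assms(2)[OF i] by simp
qed

text \<open>Multiplication by \<open>x_i / x_j\<close> preserves the order among monomials divisible
  by \<open>x_j\<close>, and other monomials have derivative 0. So at
  \<open>\<rho> + single i 1\<close> and above only the leading term of \<open>f\<close>
  contributes.\<close>

lemma lookup_deriv_var:
  assumes gt: "term_order gt" and f: "is_lm gt f (\<rho> + single j 1)"
    and a: "a = \<rho> + single i 1 \<or> gt a (\<rho> + single i 1)"
  shows "lookup (deriv_var i j f) a =
    (if a = \<rho> + single i 1 then lookup f (\<rho> + single j 1) * of_nat (Suc (lookup \<rho> j)) else 0)"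
proof -
  let ?\<nu> = "\<rho> + single j 1"
  have "lookup (deriv_var i j f) a = (\<Sum>\<kappa>\<in>keys f. lookup f \<kappa> * lookup (mon_deriv i j \<kappa>) a)"
    by (simp add: deriv_var_def lookup_sum lookup_scale)
  also have "\<dots> = (\<Sum>\<kappa>\<in>keys f. if \<kappa> = ?\<nu> then lookup f ?\<nu> * lookup (mon_deriv i j ?\<nu>) a else 0)"
  proof (rule sum.cong)
    fix \<kappa> assume \<kappa>: "\<kappa> \<in> keys f"
    have "lookup (mon_deriv i j \<kappa>) a = (0 :: 'b)" if ne: "\<kappa> \<noteq> ?\<nu>"
    proof (rule ccontr)
      assume "\<not> ?thesis"
      then have "\<kappa> - single j 1 + single i 1 = a \<and> of_nat (lookup \<kappa> j) \<noteq> (0 :: 'b)"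
        by (simp add: mon_deriv_def lookup_single when_def split: if_splits)
      then have *: "\<kappa> - single j 1 + single i 1 = a" "lookup \<kappa> j \<noteq> 0"
        by (auto intro: gr0I)
      define \<kappa>' where "\<kappa>' = \<kappa> - single j 1"
      have \<kappa>': "\<kappa> = \<kappa>' + single j 1"
        unfolding \<kappa>'_def using *(2)
        by (intro poly_mapping_eqI) (auto simp: lookup_add lookup_minus lookup_single when_def)
      have "gt ?\<nu> \<kappa>" using f \<kappa> ne unfolding is_lm_def by blast
      then have "gt \<rho> \<kappa>'"
        using term_order_total[OF gt, of \<rho> \<kappa>'] term_order_add[OF gt, of \<kappa>' \<rho> "single j 1"]
          term_order_asym[OF gt, of ?\<nu> \<kappa>] term_order_irrefl[OF gt, of ?\<nu>] unfolding \<kappa>' by metis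
      then have "gt (\<rho> + single i 1) a"
        using term_order_add[OF gt, of \<rho> \<kappa>' "single i 1"] *(1) unfolding \<kappa>'_def by simp
      with a show False using term_order_asym[OF gt] term_order_irrefl[OF gt] by metis
    qed
    then show "lookup f \<kappa> * lookup (mon_deriv i j \<kappa>) a =
        (if \<kappa> = ?\<nu> then lookup f ?\<nu> * lookup (mon_deriv i j ?\<nu>) a else 0)" by simp
  qed simp
  also have "\<dots> = lookup f ?\<nu> * lookup (mon_deriv i j ?\<nu>) a"
    using f by (simp add: is_lm_def)
  also have "lookup (mon_deriv i j ?\<nu>) a = (if a = \<rho> + single i 1 then of_nat (Suc (lookup \<rho> j)) else 0)"
    by (simp add: mon_deriv_def lookup_single when_def lookup_add)
  finally show ?thesis by simp
qed

text \<open>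
  Let \<open>f\<close> have leading monomial \<open>\<nu>\<close> and let \<open>A\<close> consist of the monomials above \<open>\<nu>\<close>. Modulo
  higher powers of \<open>s\<close>, the transvection adds \<open>s\<close> times the derivative of \<open>f\<close> to \<open>f\<close>. Since the rank
  of the projection to \<open>A\<close> cannot grow, on \<open>A\<close> the derivative agrees with an element of the ideal.
\<close>

lemma max_rank_deriv_var:
  fixes I :: "('n::finite, 'k::field_char_0) mpol set"
  assumes gt: "term_order gt" and I: "graded I" and g: "invertible g" and rank: "max_rank gt I d g"
    and f: "f \<in> act g ` I" "homogeneous d f" and A: "upset gt d A" "\<And>a. a \<in> A \<Longrightarrow> lookup f a = 0"
  obtains v where "v \<in> act g ` I" "homogeneous d v" "\<forall>a\<in>A. lookup v a = lookup (deriv_var i j f) a"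
proof -
  let ?J = "act g ` I" and ?h = "transvection i j"
  have J: "graded ?J" by (rule graded_act[OF g I])
  have Ad: "A \<subseteq> {\<nu>. mon_deg \<nu> = d}" and Aup: "\<And>a b. a \<in> A \<Longrightarrow> mon_deg b = d \<Longrightarrow> gt b a \<Longrightarrow> b \<in> A"
    using A(1) unfolding upset_def by blast+
  define B where "B = lms gt ?J \<inter> A"
  have finB: "finite B" unfolding B_def using finite_subset[OF Ad finite_mon_deg] by blast
  obtain F where F: "\<forall>\<beta>\<in>B. F \<beta> \<in> ?J \<and> homogeneous d (F \<beta>)" "indep_on A B (\<lambda>\<beta>. lookup (F \<beta>))"
    unfolding B_def by (rule exists_indep_on_lms[OF gt J Ad])
  \<comment> \<open>One row for \<open>f\<close> and one for each \<open>F \<beta>\<close>. The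
    number of the \<open>F \<beta>\<close> is the maximal rank on \<open>A\<close>, so the rows are
    one too many to be independent in any coordinates.\<close>
  define X where "X = insert None (Some ` B)"
  have finX: "finite X" and cardX: "card X = Suc (card B)"
    unfolding X_def using finB by (simp_all add: card_image)
  have sumX: "(\<Sum>x\<in>X. u x) = u None + (\<Sum>\<beta>\<in>B. u (Some \<beta>))" for u :: "'n mon option \<Rightarrow> 'k"
    unfolding X_def using finB by (simp add: sum.reindex)
  obtain Q where Q: "\<forall>s. act (?h s) f = poly (pCons f Q) (single 0 s)" "coeff Q 0 = deriv_var i j f"
    by (rule act_transvection)
  have "\<forall>\<beta>. \<exists>q. (\<forall>s. act (?h s) (F \<beta>) = poly q (single 0 s)) \<and> coeff q 0 = F \<beta>"
  proof
    fix \<beta>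
    obtain q where "\<forall>s. act (?h s) (F \<beta>) = poly (pCons (F \<beta>) q) (single 0 s)"
      "coeff q 0 = deriv_var i j (F \<beta>)"
      by (rule act_transvection)
    then show "\<exists>q. (\<forall>s. act (?h s) (F \<beta>) = poly q (single 0 s)) \<and> coeff q 0 = F \<beta>"
      by (intro exI[of _ "pCons (F \<beta>) q"]) simp
  qed
  from choice[OF this] obtain q where q: "\<And>\<beta> s. act (?h s) (F \<beta>) = poly (q \<beta>) (single 0 s)"
    "\<And>\<beta>. coeff (q \<beta>) 0 = F \<beta>" by blast
  \<comment> \<open>The change of \<open>f\<close> enters divided by \<open>s\<close>: at
    \<open>s = 0\<close> this row is the derivative, while the other rows become the
    \<open>F \<beta>\<close> themselves.\<close>
  define w where "w = (\<lambda>x a. poly (map_poly (\<lambda>c. lookup c a) (case x of None \<Rightarrow> Q | Some \<beta> \<Rightarrow> q \<beta>)))"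
  have w0: "w None a 0 = lookup (deriv_var i j f) a" "w (Some \<beta>) a 0 = lookup (F \<beta>) a" for a \<beta>
    using Q(2) q(2) by (simp_all add: w_def poly_0_coeff_0 coeff_map_poly)
  have "\<not> indep_on A X (\<lambda>x a. w x a 0)"
  proof
    assume ind: "indep_on A X (\<lambda>x a. w x a 0)"
    let ?R = "\<lambda>p :: 'k \<Rightarrow> 'k. \<exists>r. p = poly r"
    have "\<exists>p. ?R p \<and> p 0 \<noteq> 0 \<and> (\<forall>s. p s \<noteq> 0 \<longrightarrow> indep_on A X (\<lambda>x a. w x a s))"
    proof (rule indep_on_open[where R = ?R])
      show "?R (\<lambda>x. p x * p' x)" if pp: "?R p" "?R p'" for p p'
      proof -
        obtain r r' where "p = poly r" "p' = poly r'" using pp by blast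
        then show ?thesis by (intro exI[of _ "r * r'"]) (simp add: fun_eq_iff)
      qed
      show "?R (\<lambda>x. p x - p' x)" if pp: "?R p" "?R p'" for p p'
      proof -
        obtain r r' where "p = poly r" "p' = poly r'" using pp by blast
        then show ?thesis by (intro exI[of _ "r - r'"]) (simp add: fun_eq_iff)
      qed
      show "?R (\<lambda>_. 1)" by (rule exI[of _ 1]) (simp add: fun_eq_iff)
      show "?R (w x a)" for x a unfolding w_def by (rule exI, rule refl)
    qed (fact finX ind)+
    then obtain p r where "p = poly r" "p 0 \<noteq> 0" "\<forall>s. p s \<noteq> 0 \<longrightarrow> indep_on A X (\<lambda>x a. w x a s)"
      by (elim exE conjE)
    then have r: "poly r 0 \<noteq> 0" "\<And>s. poly r s \<noteq> 0 \<Longrightarrow> indep_on A X (\<lambda>x a. w x a s)"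
      by simp_all
    obtain \<delta> where \<delta>: "\<And>s :: 'k. det (\<chi> a b. mat 1 $ a $ b + s * (?h 1 $ a $ b - mat 1 $ a $ b)) = poly \<delta> s"
      using polyfun_line[OF polyfun_det] by blast
    have line: "(\<chi> a b. mat 1 $ a $ b + s * (?h 1 $ a $ b - mat 1 $ a $ b)) = ?h s" for s :: 'k
      by (simp add: vec_eq_iff transvection_def mat_def)
    have det: "det (?h s) = poly \<delta> s" for s :: 'k
      by (subst line[of s, symmetric]) (rule \<delta>)
    have "?h 0 = (mat 1 :: 'k^'n^'n)" by (simp add: vec_eq_iff transvection_def mat_def)
    then have "poly \<delta> 0 \<noteq> 0" using det[of 0] by simp
    \<comment> \<open>The three factors ask for a value of \<open>s\<close> at which independence
      persists, the transvection is invertible, and the division by \<open>s\<close> can be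
      undone.\<close>
    then have "r * \<delta> * [:0, 1:] \<noteq> 0" using r(1) by auto
    then have "finite {s. poly (r * \<delta> * [:0, 1:]) s = 0}" by (rule poly_roots_finite)
    then have "{s. poly (r * \<delta> * [:0, 1:]) s = 0} \<noteq> UNIV" using infinite_UNIV_char_0 by metis
    then obtain s where "poly (r * \<delta> * [:0, 1:]) s \<noteq> 0" by blast
    then have s: "poly r s \<noteq> 0" "det (?h s) \<noteq> 0" "s \<noteq> 0" by (simp_all add: det)
    have inv: "invertible (?h s ** g)"
      using s(2) g by (simp add: invertible_det_nz det_mul)
    let ?v = "\<lambda>x. act (?h s) (case x of None \<Rightarrow> f | Some \<beta> \<Rightarrow> F \<beta>)"
    \<comment> \<open>On \<open>A\<close> the constant term \<open>f\<close> vanishes, so the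
      transformed \<open>f\<close> is \<open>s\<close> times its row there.\<close>
    have "indep_on A X (\<lambda>x. lookup (?v x))"
    proof (rule indep_on_scale[where t = "\<lambda>x. case x of None \<Rightarrow> s | Some \<beta> \<Rightarrow> 1", OF r(2)[OF s(1)]])
      show "(case x of None \<Rightarrow> s | Some \<beta> \<Rightarrow> 1) \<noteq> 0" for x :: "'n mon option"
        using s(3) by (simp split: option.split)
      fix x a assume "x \<in> X" "a \<in> A"
      show "lookup (?v x) a = (case x of None \<Rightarrow> s | Some \<beta> \<Rightarrow> 1) * w x a s"
        using Q(1) q(1) A(2)[OF \<open>a \<in> A\<close>]
        by (cases x) (simp_all add: w_def lookup_poly_single[symmetric] lookup_add lookup_scale)
    qed
    moreover have "\<forall>x\<in>X. ?v x \<in> act (?h s ** g) ` I \<and> homogeneous d (?v x)"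
    proof
      fix x assume "x \<in> X"
      then have "(case x of None \<Rightarrow> f | Some \<beta> \<Rightarrow> F \<beta>) \<in> ?J"
        "homogeneous d (case x of None \<Rightarrow> f | Some \<beta> \<Rightarrow> F \<beta>)"
        using f F(1) unfolding X_def by auto
      then show "?v x \<in> act (?h s ** g) ` I \<and> homogeneous d (?v x)"
        by (auto simp: homogeneous_act act_act)
    qed
    ultimately have "card X \<le> card (lms gt (act (?h s ** g) ` I) \<inter> A)"
      by (intro card_indep_on_le_lms[OF gt graded_poly_ideal[OF graded_act[OF inv I]] finX _ Ad Aup])
    also have "\<dots> \<le> card B"
      using rank A(1) inv unfolding max_rank_def B_def by blast
    finally show False using cardX by simp
  qed
  then obtain c where c: "\<And>a. a \<in> A \<Longrightarrow> (\<Sum>x\<in>X. c x * w x a 0) = 0" and nz: "\<exists>x\<in>X. c x \<noteq> 0"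
    unfolding indep_on_def by blast
  have c_sum: "c None * lookup (deriv_var i j f) a = - (\<Sum>\<beta>\<in>B. c (Some \<beta>) * lookup (F \<beta>) a)" if "a \<in> A" for a
    using c[OF that] unfolding sumX w0 by (simp add: eq_neg_iff_add_eq_0)
  \<comment> \<open>The relation must involve the derivative, because the \<open>F \<beta>\<close>
    alone are independent on \<open>A\<close>; solving for the derivative yields
    \<open>v\<close>.\<close>
  have nz_None: "c None \<noteq> 0"
  proof
    assume 0: "c None = 0"
    have "(\<Sum>\<beta>\<in>B. c (Some \<beta>) * lookup (F \<beta>) a) = 0" if "a \<in> A" for a
      using c_sum[OF that] 0 by simp
    from indep_onD[OF F(2), of "\<lambda>\<beta>. c (Some \<beta>)", OF this] nz 0 show False unfolding X_def by auto
  qed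
  define v where "v = (\<Sum>\<beta>\<in>B. single 0 (- c (Some \<beta>) / c None) * F \<beta>)"
  show ?thesis
  proof (rule that)
    show "v \<in> ?J"
      unfolding v_def using F(1) by (intro poly_ideal_sum poly_ideal_mult graded_poly_ideal[OF J]) blast
    show "homogeneous d v"
      unfolding v_def using F(1) by (intro homogeneous_sum homogeneous_scale) blast
    show "\<forall>a\<in>A. lookup v a = lookup (deriv_var i j f) a"
    proof
      fix a assume "a \<in> A"
      have "lookup v a = - (\<Sum>\<beta>\<in>B. c (Some \<beta>) * lookup (F \<beta>) a) / c None"
        by (simp add: v_def lookup_sum lookup_scale sum_divide_distrib sum_negf)
      also have "\<dots> = lookup (deriv_var i j f) a"
        unfolding c_sum[OF \<open>a \<in> A\<close>, symmetric] using nz_None by simp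
      finally show "lookup v a = lookup (deriv_var i j f) a" .
    qed
  qed
qed

text \<open>Among the monomials above \<open>\<rho> + single j 1\<close>, the derivative of
  \<open>f\<close> has top monomial \<open>\<rho> + single i 1\<close>, with coefficient
  \<open>Suc (lookup \<rho> j)\<close>, which is nonzero in characteristic 0. An element of the
  ideal that agrees with it there has this leading monomial.\<close>

lemma strongly_stable:
  fixes I :: "('n::finite, 'k::field_char_0) mpol set"
  assumes gt: "term_order gt" and I: "graded I" and g: "invertible g"
    and rank: "max_rank gt I (Suc (mon_deg \<rho>)) g"
    and \<nu>: "\<rho> + single j 1 \<in> lms gt (act g ` I)" and ij: "gt (single i 1) (single j 1)"
  shows "\<rho> + single i 1 \<in> lms gt (act g ` I)"
proof -
  let ?d = "Suc (mon_deg \<rho>)" and ?\<nu> = "\<rho> + single j 1" and ?\<mu> = "\<rho> + single i 1"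
  have deg: "mon_deg ?\<nu> = ?d" "mon_deg ?\<mu> = ?d" by (simp_all add: mon_deg_add)
  obtain f where f: "f \<in> act g ` I" "homogeneous ?d f" "is_lm gt f ?\<nu>" "lookup f ?\<nu> = 1"
    by (rule lms_homogeneous[OF graded_act[OF g I] \<nu>, unfolded deg])
  define A where "A = {\<alpha>. mon_deg \<alpha> = ?d \<and> gt \<alpha> ?\<nu>}"
  have up: "upset gt ?d A"
    unfolding upset_def A_def using term_order_trans[OF gt] by auto
  have fA: "lookup f a = 0" if "a \<in> A" for a
  proof (rule ccontr)
    assume "lookup f a \<noteq> 0"
    then have "a = ?\<nu> \<or> gt ?\<nu> a" using f(3) unfolding is_lm_def by (metis in_keys_iff)
    with that show False unfolding A_def using term_order_asym[OF gt] term_order_irrefl[OF gt] by blast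
  qed
  obtain v where v: "v \<in> act g ` I" "homogeneous ?d v" "\<forall>a\<in>A. lookup v a = lookup (deriv_var i j f) a"
    by (rule max_rank_deriv_var[OF gt I g rank f(1,2) up fA])
  have \<mu>\<nu>: "gt ?\<mu> ?\<nu>" using term_order_add[OF gt ij, of \<rho>] by (simp add: add.commute)
  then have \<mu>A: "?\<mu> \<in> A" unfolding A_def using deg by blast
  have "is_lm gt v ?\<mu>"
    unfolding is_lm_def
  proof (intro conjI ballI impI)
    have "lookup v ?\<mu> = of_nat (Suc (lookup \<rho> j))"
      using v(3) \<mu>A lookup_deriv_var[OF gt f(3), of ?\<mu> i] f(4) by simp
    then show "?\<mu> \<in> keys v" unfolding in_keys_iff by (metis of_nat_neq_0)
  next
    fix a assume a: "a \<in> keys v" "a \<noteq> ?\<mu>"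
    show "gt ?\<mu> a"
    proof (rule ccontr)
      assume "\<not> gt ?\<mu> a"
      then have gt_a: "gt a ?\<mu>" using term_order_total[OF gt a(2)] by blast
      moreover have "mon_deg a = ?d" using v(2) a(1) by (rule homogeneousD)
      ultimately have "a \<in> A" unfolding A_def using term_order_trans[OF gt _ \<mu>\<nu>] by blast
      then have "lookup v a = 0"
        using v(3) lookup_deriv_var[OF gt f(3), of a i] gt_a a(2) by simp
      with a(1) show False unfolding in_keys_iff by blast
    qed
  qed
  with v(1) show ?thesis unfolding lms_def by blast
qed


section \<open>Depth and annihilators\<close>

text \<open>The ideal generated by \<open>G\<close> and the first \<open>k\<close> forms, kept in
  the polynomial ring: it is the preimage of the ideal of the quotient ring that occurs in
  \<open>regular_sequence\<close>.\<close>

primrec adjoin :: "('n, 'k::field) mpol set \<Rightarrow> ('n, 'k) mpol list \<Rightarrow> nat \<Rightarrow> ('n, 'k) mpol set" where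
  "adjoin G ls 0 = G"
| "adjoin G ls (Suc k) = {f + ls ! k * h | f h. f \<in> adjoin G ls k}"

lemma poly_ideal_adjoin: "poly_ideal G \<Longrightarrow> poly_ideal (adjoin G ls k)"
proof (induction k)
  case (Suc k)
  then have idl: "poly_ideal (adjoin G ls k)" by blast
  show ?case
    unfolding poly_ideal_def adjoin.simps
  proof (intro conjI ballI allI)
    have "0 = 0 + ls ! k * 0" by simp
    then show "0 \<in> {f + ls ! k * h |f h. f \<in> adjoin G ls k}"
      using poly_ideal_0[OF idl] by blast
  next
    fix a b assume "a \<in> {f + ls ! k * h |f h. f \<in> adjoin G ls k}" "b \<in> {f + ls ! k * h |f h. f \<in> adjoin G ls k}"
    then obtain f h f' h' where "a = f + ls ! k * h" "b = f' + ls ! k * h'"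
      "f \<in> adjoin G ls k" "f' \<in> adjoin G ls k" by blast
    moreover from this have "a + b = (f + f') + ls ! k * (h + h')" by (simp add: distrib_left)
    ultimately show "a + b \<in> {f + ls ! k * h |f h. f \<in> adjoin G ls k}"
      using poly_ideal_add[OF idl] by blast
  next
    fix a r assume "a \<in> {f + ls ! k * h |f h. f \<in> adjoin G ls k}"
    then obtain f h where "a = f + ls ! k * h" "f \<in> adjoin G ls k" by blast
    moreover from this have "r * a = r * f + ls ! k * (r * h)" by (simp add: distrib_left mult.left_commute)
    ultimately show "r * a \<in> {f + ls ! k * h |f h. f \<in> adjoin G ls k}"
      using poly_ideal_mult[OF idl] by blast
  qed
qed simp

lemma graded_adjoin:
  assumes G: "graded G" and ls: "\<forall>l\<in>set ls. homogeneous 1 l"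
  shows "k \<le> length ls \<Longrightarrow> graded (adjoin G ls k)"
proof (induction k)
  case (Suc k)
  then have gr: "graded (adjoin G ls k)" by simp
  have l: "homogeneous 1 (ls ! k)" using ls Suc.prems by simp
  have "hom_part d (f + ls ! k * h) \<in> adjoin G ls (Suc k)" if f: "f \<in> adjoin G ls k" for f h d
  proof -
    have "hom_part d (f + ls ! k * h) =
        hom_part d f + ls ! k * (if 1 \<le> d then hom_part (d - 1) h else 0)"
      by (simp add: hom_part_add hom_part_mult_homogeneous[OF l])
    then show ?thesis using graded_hom_part[OF gr f] unfolding adjoin.simps by blast
  qed
  then show ?case
    unfolding graded_def using poly_ideal_adjoin[OF graded_poly_ideal[OF G], of ls "Suc k"] by auto
qed (use G in simp)

lemma adjoin_mono:
  assumes "j \<le> k"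
  shows "adjoin G ls j \<subseteq> adjoin G ls k"
  using assms
proof (induction rule: dec_induct)
  case (step k)
  have "f \<in> adjoin G ls (Suc k)" if "f \<in> adjoin G ls k" for f
  proof -
    have "f = f + ls ! k * 0" by simp
    with that show ?thesis unfolding adjoin.simps by blast
  qed
  with step.IH show ?case by blast
qed simp

lemma nth_in_adjoin:
  assumes "poly_ideal G" "j < k"
  shows "ls ! j \<in> adjoin G ls k"
proof -
  have "ls ! j = 0 + ls ! j * 1" by simp
  then have "ls ! j \<in> adjoin G ls (Suc j)"
    using poly_ideal_0[OF poly_ideal_adjoin[OF assms(1)]] unfolding adjoin.simps by blast
  then show ?thesis using adjoin_mono[of "Suc j" k G ls] assms(2) by auto
qed

text \<open>In one direction, the image of \<open>adjoin G ls k\<close> is an ideal of the quotient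
  that contains the generators. In the other, the preimage of the generated ideal is an ideal that
  contains \<open>G\<close> and the first \<open>k\<close> forms.\<close>

lemma coset_in_Idl_iff:
  fixes G :: "('n, 'k::field) mpol set"
  assumes G: "poly_ideal G" and k: "k \<le> length ls"
  shows "G +>\<^bsub>mpol_ring\<^esub> y \<in> Idl\<^bsub>mpol_ring Quot G\<^esub> (set (take k (map (\<lambda>l. G +>\<^bsub>mpol_ring\<^esub> l) ls)))
    \<longleftrightarrow> y \<in> adjoin G ls k"
proof -
  let ?R = "mpol_ring :: ('n, 'k) mpol ring"
  let ?Q = "?R Quot G" and ?S = "set (take k (map (\<lambda>l. G +>\<^bsub>?R\<^esub> l) ls))"
  have idl: "ideal G ?R" using G by (simp add: ideal_mpol_ring_iff)
  interpret R: ring ?R by (rule ring_mpol_ring)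
  interpret Q: ring ?Q using idl by (rule ideal.quotient_is_ring)
  interpret h: ring_hom_ring ?R ?Q "(+>\<^bsub>?R\<^esub>) G" using idl by (rule ideal.rcos_ring_hom_ring)
  have S: "?S \<subseteq> carrier ?Q"
    using h.hom_closed by (auto dest!: in_set_takeD)
  have S_eq: "?S = (\<lambda>j. G +>\<^bsub>?R\<^esub> (ls ! j)) ` {..<k}"
    using k by (simp add: take_map set_map nth_image[symmetric] image_image atLeast0LessThan)
  show ?thesis
  proof
    assume y: "G +>\<^bsub>?R\<^esub> y \<in> Idl\<^bsub>?Q\<^esub> ?S"
    have "ideal ((+>\<^bsub>?R\<^esub>) G ` adjoin G ls k) ?Q"
      using idl poly_ideal_adjoin[OF G, of ls k]
      by (intro R.ring_ideal_imp_quot_ideal) (simp_all add: ideal_mpol_ring_iff)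
    moreover have "?S \<subseteq> (+>\<^bsub>?R\<^esub>) G ` adjoin G ls k"
      unfolding S_eq using nth_in_adjoin[OF G] by blast
    ultimately have "Idl\<^bsub>?Q\<^esub> ?S \<subseteq> (+>\<^bsub>?R\<^esub>) G ` adjoin G ls k"
      by (rule Q.genideal_minimal)
    with y obtain z where z: "z \<in> adjoin G ls k" "G +>\<^bsub>?R\<^esub> y = G +>\<^bsub>?R\<^esub> z" by blast
    then have "y - z \<in> G"
      using R.quotient_eq_iff_same_a_r_cos[OF idl, of y z]
      by (simp add: a_minus_def a_inv_mpol_ring)
    then have "y - z \<in> adjoin G ls k" using adjoin_mono[of 0 k G ls] by auto
    then have "(y - z) + z \<in> adjoin G ls k"
      using z(1) by (rule poly_ideal_add[OF poly_ideal_adjoin[OF G]])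
    then show "y \<in> adjoin G ls k" by simp
  next
    let ?V = "{r. G +>\<^bsub>?R\<^esub> r \<in> Idl\<^bsub>?Q\<^esub> ?S}"
    have "poly_ideal ?V"
      using h.ideal_vimage[OF Q.genideal_ideal[OF S]] by (simp add: ideal_mpol_ring_iff)
    note V = this
    have "G \<subseteq> ?V"
    proof
      fix f assume "f \<in> G"
      then have "G +>\<^bsub>?R\<^esub> f = G +>\<^bsub>?R\<^esub> 0"
        using R.quotient_eq_iff_same_a_r_cos[OF idl, of f 0] by (simp add: a_minus_def a_inv_mpol_ring)
      then show "f \<in> ?V" using poly_ideal_0[OF V] by simp
    qed
    have "adjoin G ls j \<subseteq> ?V" if "j \<le> k" for j
      using that
    proof (induction j)
      case 0
      then show ?case using \<open>G \<subseteq> ?V\<close> by simp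
    next
      case (Suc j)
      have "ls ! j \<in> ?V"
        using Q.genideal_self[OF S] Suc.prems unfolding S_eq by auto
      then have "ls ! j * h \<in> ?V" for h
        using poly_ideal_mult[OF V, of "ls ! j" h] by (simp only: mult.commute)
      then show ?case
        using Suc poly_ideal_add[OF V] unfolding adjoin.simps by (auto simp del: mem_Collect_eq)
    qed
    then show "y \<in> adjoin G ls k \<Longrightarrow> G +>\<^bsub>?R\<^esub> y \<in> Idl\<^bsub>?Q\<^esub> ?S" by blast
  qed
qed

lemma regular_sequence_adjoin:
  fixes G :: "('n, 'k::field) mpol set"
  assumes G: "poly_ideal G"
    and reg: "regular_sequence (mpol_ring Quot G) (map (\<lambda>l. G +>\<^bsub>mpol_ring\<^esub> l) ls)"
    and k: "k < length ls" and y: "ls ! k * y \<in> adjoin G ls k"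
  shows "y \<in> adjoin G ls k"
proof -
  let ?R = "mpol_ring :: ('n, 'k) mpol ring"
  let ?Q = "?R Quot G" and ?xs = "map (\<lambda>l. G +>\<^bsub>?R\<^esub> l) ls"
  have idl: "ideal G ?R" using G by (simp add: ideal_mpol_ring_iff)
  interpret h: ring_hom_ring ?R ?Q "(+>\<^bsub>?R\<^esub>) G" using idl by (rule ideal.rcos_ring_hom_ring)
  have "?xs ! k \<otimes>\<^bsub>?Q\<^esub> (G +>\<^bsub>?R\<^esub> y) = G +>\<^bsub>?R\<^esub> (ls ! k * y)"
    using h.hom_mult[of "ls ! k" y, symmetric] k by (simp only: nth_map mpol_ring_simps UNIV_I simp_thms)
  then have "?xs ! k \<otimes>\<^bsub>?Q\<^esub> (G +>\<^bsub>?R\<^esub> y) \<in> Idl\<^bsub>?Q\<^esub> (set (take k ?xs))"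
    using coset_in_Idl_iff[OF G, of k ls "ls ! k * y"] y k by simp
  moreover have "G +>\<^bsub>?R\<^esub> y \<in> carrier ?Q" using h.hom_closed[of y] by simp
  moreover have "\<forall>i<length ?xs. \<forall>y\<in>carrier ?Q.
      ?xs ! i \<otimes>\<^bsub>?Q\<^esub> y \<in> Idl\<^bsub>?Q\<^esub> (set (take i ?xs)) \<longrightarrow> y \<in> Idl\<^bsub>?Q\<^esub> (set (take i ?xs))"
    using reg unfolding regular_sequence_def by (elim conjE)
  moreover have "k < length ?xs" using k by simp
  ultimately have "G +>\<^bsub>?R\<^esub> y \<in> Idl\<^bsub>?Q\<^esub> (set (take k ?xs))" by metis
  then show ?thesis using coset_in_Idl_iff[OF G, of k ls y] k by simp
qed

lemma mon_deg_1:
  assumes "mon_deg \<nu> = 1"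
  obtains i where "\<nu> = single i 1"
proof -
  obtain i where i: "lookup \<nu> i \<noteq> 0"
    using assms unfolding mon_deg_def by (metis sum.neutral zero_neq_one)
  have "lookup (single i 1) j \<le> lookup \<nu> j" for j
    using i by (auto simp: lookup_single when_def)
  then obtain \<rho> where \<rho>: "\<nu> = single i 1 + \<rho>" by (rule exists_diff_mon)
  then have "\<rho> = 0" using assms by (simp add: mon_deg_add mon_deg_eq_0_iff)
  with \<rho> show ?thesis using that by simp
qed

text \<open>
  If \<open>u\<close> of minimal degree outside \<open>adjoin G ls j\<close> is annihilated by \<open>P\<close>, then \<open>u\<close> is not a multiple
  of \<open>ls ! j\<close> modulo \<open>adjoin G ls j\<close>, since the cofactor would have the same properties.
\<close>

lemma annihilated_element_adjoin:
  fixes G :: "('n::finite, 'k::field) mpol set"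
  assumes G: "graded G" and ls: "\<forall>l\<in>set ls. homogeneous 1 l"
    and reg: "regular_sequence (mpol_ring Quot G) (map (\<lambda>l. G +>\<^bsub>mpol_ring\<^esub> l) ls)"
    and u: "u \<notin> G" "\<And>p. p \<in> P \<Longrightarrow> p * u \<in> G"
    and P: "\<And>p. p \<in> P \<Longrightarrow> homogeneous 1 p"
  shows "k \<le> length ls \<Longrightarrow> \<exists>d u. homogeneous d u \<and> u \<notin> adjoin G ls k \<and> (\<forall>p\<in>P. p * u \<in> adjoin G ls k)"
proof (induction k)
  case 0
  \<comment> \<open>A homogeneous part outside \<open>G\<close> inherits the annihilators, since
    these are homogeneous of degree 1.\<close>
  have "\<exists>d. hom_part d u \<notin> G"
  proof (rule ccontr)
    assume "\<not> ?thesis"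
    then have "(\<Sum>d\<in>mon_deg ` keys u. hom_part d u) \<in> G"
      by (intro poly_ideal_sum graded_poly_ideal[OF G]) blast
    then show False using u(1) by (simp add: sum_hom_part)
  qed
  then obtain d where d: "hom_part d u \<notin> G" by blast
  have "p * hom_part d u \<in> G" if "p \<in> P" for p
    using graded_hom_part[OF G u(2)[OF that], of "Suc d"]
    by (simp add: hom_part_mult_homogeneous[OF P[OF that]])
  with d homogeneous_hom_part show ?case unfolding adjoin.simps by blast
next
  case (Suc k)
  define A where "A = adjoin G ls k"
  define D where "D d \<longleftrightarrow> (\<exists>u. homogeneous d u \<and> u \<notin> A \<and> (\<forall>p\<in>P. p * u \<in> A))" for d
  have A: "graded A" unfolding A_def by (rule graded_adjoin[OF G ls]) (use Suc.prems in simp)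
  have "\<exists>d. D d" using Suc unfolding D_def A_def by simp
  then have least: "D (LEAST d. D d)" by (rule LeastI_ex)
  define d where "d = (LEAST d. D d)"
  obtain u where u: "homogeneous d u" "u \<notin> A" "\<forall>p\<in>P. p * u \<in> A"
    using least unfolding d_def[symmetric] D_def[of d] by blast
  have "u \<notin> adjoin G ls (Suc k)"
  proof
    assume "u \<in> adjoin G ls (Suc k)"
    then obtain f h where f: "f \<in> A" "u = f + ls ! k * h" unfolding adjoin.simps A_def by blast
    have l: "homogeneous 1 (ls ! k)" using ls Suc.prems by simp
    have u_eq: "u = hom_part d f + (if 1 \<le> d then ls ! k * hom_part (d - 1) h else 0)"
      using hom_part_homogeneous[OF u(1), of d] unfolding f(2) hom_part_add hom_part_mult_homogeneous[OF l]
      by simp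
    have fd: "hom_part d f \<in> A" by (rule graded_hom_part[OF A f(1)])
    with u_eq u(2) have "1 \<le> d" by (auto split: if_splits)
    define h' where "h' = hom_part (d - 1) h"
    have u': "u = hom_part d f + ls ! k * h'" using u_eq \<open>1 \<le> d\<close> by (simp add: h'_def)
    have "h' \<notin> A"
    proof
      assume "h' \<in> A"
      then have "u \<in> A"
        unfolding u' by (intro poly_ideal_add poly_ideal_mult fd graded_poly_ideal[OF A])
      with u(2) show False ..
    qed
    moreover have "p * h' \<in> A" if p: "p \<in> P" for p
    proof -
      \<comment> \<open>Modulo \<open>A\<close> the product of \<open>ls ! k\<close> and
        \<open>p * h'\<close> equals \<open>p * u\<close>, hence 0; regularity cancels the
        form.\<close>
      have "ls ! k * (p * h') = p * u - p * hom_part d f"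
        unfolding u' by (simp add: distrib_left mult.left_commute)
      also have "\<dots> \<in> A"
        using u(3) p by (intro poly_ideal_diff poly_ideal_mult[OF _ fd] graded_poly_ideal[OF A]) blast
      finally have mem: "ls ! k * (p * h') \<in> adjoin G ls k" unfolding A_def .
      have "k < length ls" using Suc.prems by simp
      from regular_sequence_adjoin[OF graded_poly_ideal[OF G] reg this mem]
      show ?thesis unfolding A_def .
    qed
    ultimately have "D (d - 1)"
      unfolding D_def h'_def using homogeneous_hom_part by blast
    then have "d \<le> d - 1" unfolding d_def by (rule Least_le)
    with \<open>1 \<le> d\<close> show False by simp
  qed
  moreover have "\<forall>p\<in>P. p * u \<in> adjoin G ls (Suc k)"
    using u(3) adjoin_mono[of k "Suc k" G ls] unfolding A_def by auto
  ultimately show ?case using u(1) by blast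
qed

text \<open>With more forms than variables outside \<open>P\<close>, some nontrivial combination
  \<open>m\<close> of the forms involves only variables in \<open>P\<close>. Let \<open>k\<close> be
  the last index occurring in it. An element \<open>v\<close> annihilated by these variables modulo
  the forms before \<open>k\<close> is annihilated by \<open>m\<close>, hence by form
  \<open>k\<close>, against regularity.\<close>

lemma regular_sequence_length_le:
  fixes G :: "('n::finite, 'k::field) mpol set"
  assumes G: "graded G" and ls: "\<forall>l\<in>set ls. homogeneous 1 l"
    and reg: "regular_sequence (mpol_ring Quot G) (map (\<lambda>l. G +>\<^bsub>mpol_ring\<^esub> l) ls)"
    and u: "u \<notin> G" "\<And>i. i \<in> P \<Longrightarrow> single (single i 1) 1 * u \<in> G"
  shows "length ls \<le> card (- P)"
proof (rule ccontr)
  assume "\<not> ?thesis"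
  then have "\<not> indep_on (- P) {..<length ls} (\<lambda>k i. lookup (ls ! k) (single i 1))"
    using indep_on_card_le[of "- P" "{..<length ls}"] by auto
  then obtain c where c: "\<And>i. i \<in> - P \<Longrightarrow> (\<Sum>k<length ls. c k * lookup (ls ! k) (single i 1)) = 0"
    and nz: "\<exists>k<length ls. c k \<noteq> 0"
    unfolding indep_on_def by blast
  define K where "K = {k. k < length ls \<and> c k \<noteq> 0}"
  define k where "k = Max K"
  have K: "finite K" "K \<noteq> {}" using nz by (auto simp: K_def)
  have k: "k < length ls" "c k \<noteq> 0" using Max_in[OF K] unfolding k_def[symmetric] by (auto simp: K_def)
  have k_max: "c j = 0" if "k < j" "j < length ls" for j
    using Max_ge[OF K(1), of j] that unfolding k_def[symmetric] by (auto simp: K_def)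
  define A where "A = adjoin G ls k"
  have A: "poly_ideal A" unfolding A_def by (rule poly_ideal_adjoin[OF graded_poly_ideal[OF G]])
  have "\<exists>d v. homogeneous d v \<and> v \<notin> adjoin G ls k \<and>
      (\<forall>p\<in>(\<lambda>i. single (single i 1) 1) ` P. p * v \<in> adjoin G ls k)"
  proof (rule annihilated_element_adjoin[OF G ls reg u(1)])
    show "p * u \<in> G" if "p \<in> (\<lambda>i. single (single i 1) 1) ` P" for p using that u(2) by blast
    show "homogeneous 1 p" if "p \<in> (\<lambda>i. single (single i 1) (1 :: 'k)) ` P" for p
      using that homogeneous_single[of "single _ 1" "1 :: 'k"] by auto
    show "k \<le> length ls" using k(1) by simp
  qed
  then obtain v where v: "v \<notin> A" "\<And>i. i \<in> P \<Longrightarrow> single (single i 1) 1 * v \<in> A"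
    unfolding A_def by blast
  define m where "m = (\<Sum>j<length ls. single 0 (c j) * ls ! j)"
  have m_deg: "homogeneous 1 m"
    unfolding m_def using ls by (intro homogeneous_sum homogeneous_scale) simp
  have m_keys: "\<exists>i\<in>P. \<nu> = single i 1" if \<nu>: "\<nu> \<in> keys m" for \<nu>
  proof -
    obtain i where i: "\<nu> = single i 1" by (rule mon_deg_1[OF homogeneousD[OF m_deg \<nu>]])
    have "lookup m \<nu> \<noteq> 0" using \<nu> unfolding in_keys_iff .
    then have "i \<in> P" using c[of i] unfolding i m_def by (auto simp: lookup_sum lookup_scale)
    with i show ?thesis by blast
  qed
  have "m * v = (\<Sum>\<nu>\<in>keys m. single \<nu> (lookup m \<nu>) * v)"
    unfolding sum_distrib_right[symmetric] by (simp add: poly_mapping_sum_single)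
  also have "\<dots> \<in> A"
  proof (rule poly_ideal_sum[OF A])
    fix \<nu> assume "\<nu> \<in> keys m"
    then obtain i where i: "i \<in> P" "\<nu> = single i 1" using m_keys by blast
    have "single \<nu> (lookup m \<nu>) * v = single 0 (lookup m \<nu>) * (single (single i 1) 1 * v)"
      unfolding i(2) by (simp add: mult_single flip: mult.assoc)
    then show "single \<nu> (lookup m \<nu>) * v \<in> A" using poly_ideal_mult[OF A v(2)[OF i(1)]] by simp
  qed
  finally have mv: "m * v \<in> A" .
  have "m = single 0 (c k) * ls ! k + (\<Sum>j\<in>{..<length ls} - {k}. single 0 (c j) * ls ! j)"
    unfolding m_def using k(1) by (intro sum.remove) simp_all
  then have "m * v = single 0 (c k) * ls ! k * v + (\<Sum>j\<in>{..<length ls} - {k}. single 0 (c j) * ls ! j * v)"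
    by (simp only: distrib_right sum_distrib_right)
  then have split: "single 0 (c k) * (ls ! k * v) =
      m * v - (\<Sum>j\<in>{..<length ls} - {k}. single 0 (c j) * v * ls ! j)"
    by (simp add: mult.assoc mult.commute[of v])
  have "(\<Sum>j\<in>{..<length ls} - {k}. single 0 (c j) * v * ls ! j) \<in> A"
  proof (rule poly_ideal_sum[OF A])
    fix j assume j: "j \<in> {..<length ls} - {k}"
    show "single 0 (c j) * v * ls ! j \<in> A"
    proof (cases "j < k")
      case True
      then have "ls ! j \<in> A" unfolding A_def by (rule nth_in_adjoin[OF graded_poly_ideal[OF G]])
      then show ?thesis by (rule poly_ideal_mult[OF A])
    next
      case False
      then have "c j = 0" using j k_max by simp
      then show ?thesis using poly_ideal_0[OF A] by simp
    qed
  qed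
  then have "single 0 (c k) * (ls ! k * v) \<in> A"
    unfolding split using mv by (intro poly_ideal_diff[OF A])
  then have "single 0 (inverse (c k)) * (single 0 (c k) * (ls ! k * v)) \<in> A"
    by (rule poly_ideal_mult[OF A])
  moreover have "single 0 (inverse (c k)) * (single 0 (c k) * (ls ! k * v)) = ls ! k * v"
    using k(2) by (simp add: mult_single flip: mult.assoc)
  ultimately have "ls ! k * v \<in> A" by simp
  then have "v \<in> A"
    unfolding A_def by (rule regular_sequence_adjoin[OF graded_poly_ideal[OF G] reg k(1)])
  with v(1) show False ..
qed

text \<open>A supremum in \<open>enat\<close> need not be attained a priori; but if all lengths were
  below \<open>t\<close>, it would be at most \<open>t - 1\<close>, which is less than
  \<open>t\<close> as \<open>t\<close> is positive.\<close>

lemma depth_ideal_ge: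
  assumes "enat t \<le> depth_ideal G" "0 < t"
  obtains ls where "\<forall>l\<in>set ls. homogeneous 1 l" "t \<le> length ls"
    "regular_sequence (mpol_ring Quot G) (map (\<lambda>l. G +>\<^bsub>mpol_ring\<^esub> l) ls)"
proof (rule ccontr)
  assume none: "\<not> thesis"
  have "depth_ideal G \<le> enat (t - 1)"
    unfolding depth_ideal_def
  proof (rule Sup_least)
    fix x assume "x \<in> {enat (length ls) | ls. (\<forall>l\<in>set ls. homogeneous 1 l) \<and>
      regular_sequence (mpol_ring Quot G) (map (\<lambda>l. G +>\<^bsub>mpol_ring\<^esub> l) ls)}"
    then obtain ls where ls: "x = enat (length ls)" "\<forall>l\<in>set ls. homogeneous 1 l"
      "regular_sequence (mpol_ring Quot G) (map (\<lambda>l. G +>\<^bsub>mpol_ring\<^esub> l) ls)"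
      by blast
    have "\<not> t \<le> length ls" using none that[OF ls(2) _ ls(3)] by blast
    with ls(1) show "x \<le> enat (t - 1)" by simp
  qed
  with assms(1) have "enat t \<le> enat (t - 1)" by (rule order.trans)
  with assms(2) show False by simp
qed


section \<open>Weight refinements of a term order\<close>

definition var_index :: "'n::finite \<Rightarrow> nat" where
  "var_index = (SOME f. inj f)"

lemma inj_var_index: "inj (var_index :: 'n::finite \<Rightarrow> nat)"
proof -
  have "\<exists>f :: 'n \<Rightarrow> nat. inj f"
    using finite_imp_inj_to_nat_seg[of "UNIV :: 'n set"] by auto
  then show ?thesis unfolding var_index_def by (rule someI_ex)
qed

definition lex_gt :: "'n::finite mon \<Rightarrow> 'n mon \<Rightarrow> bool" where
  "lex_gt \<nu> \<mu> \<longleftrightarrow> (\<exists>i. lookup \<mu> i < lookup \<nu> i \<and>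
     (\<forall>j. var_index j < var_index i \<longrightarrow> lookup \<nu> j = lookup \<mu> j))"

lemma lex_gt_trans:
  assumes "lex_gt \<nu> \<mu>" "lex_gt \<mu> \<rho>"
  shows "lex_gt \<nu> \<rho>"
proof -
  obtain i where i: "lookup \<mu> i < lookup \<nu> i" "\<And>j. var_index j < var_index i \<Longrightarrow> lookup \<nu> j = lookup \<mu> j"
    using assms(1) unfolding lex_gt_def by blast
  obtain k where k: "lookup \<rho> k < lookup \<mu> k" "\<And>j. var_index j < var_index k \<Longrightarrow> lookup \<mu> j = lookup \<rho> j"
    using assms(2) unfolding lex_gt_def by blast
  consider "var_index i < var_index k" | "var_index k < var_index i" | "i = k"
    using inj_var_index unfolding inj_def by (metis linorder_neqE_nat)
  then show ?thesis
  proof cases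
    case 1
    then show ?thesis unfolding lex_gt_def using i k(2) by (intro exI[of _ i]) auto
  next
    case 2
    then show ?thesis unfolding lex_gt_def using i(2) k by (intro exI[of _ k]) auto
  next
    case 3
    then show ?thesis unfolding lex_gt_def using i k by (intro exI[of _ i]) auto
  qed
qed

lemma lex_gt_total:
  fixes \<nu> \<mu> :: "'n::finite mon"
  assumes "\<nu> \<noteq> \<mu>"
  shows "lex_gt \<nu> \<mu> \<or> lex_gt \<mu> \<nu>"
proof -
  obtain i\<^sub>0 where "lookup \<nu> i\<^sub>0 \<noteq> lookup \<mu> i\<^sub>0"
    using assms poly_mapping_eqI by metis
  then obtain i where i: "lookup \<nu> i \<noteq> lookup \<mu> i"
    "\<And>j. lookup \<nu> j \<noteq> lookup \<mu> j \<Longrightarrow> var_index i \<le> var_index j"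
    using ex_has_least_nat[of "\<lambda>i. lookup \<nu> i \<noteq> lookup \<mu> i" i\<^sub>0 var_index] by blast
  then have "\<forall>j. var_index j < var_index i \<longrightarrow> lookup \<nu> j = lookup \<mu> j"
    by (metis not_le)
  then show ?thesis
    using i(1) unfolding lex_gt_def by (metis linorder_neqE_nat)
qed

text \<open>
  The weight enters with reversed sign because initial forms are of minimal weight; putting
  the degree first makes the relation a term order and is harmless for graded ideals.
\<close>

definition weight_order :: "real^'n \<Rightarrow> 'n::finite mon \<Rightarrow> 'n mon \<Rightarrow> bool" where
  "weight_order w \<nu> \<mu> \<longleftrightarrow> mon_deg \<mu> < mon_deg \<nu> \<or> mon_deg \<mu> = mon_deg \<nu> \<and>
     (weight w \<nu> < weight w \<mu> \<or> weight w \<nu> = weight w \<mu> \<and> lex_gt \<nu> \<mu>)"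

lemma term_order_weight_order: "term_order (weight_order w)"
  unfolding term_order_def
proof (intro conjI allI impI)
  show "irreflp (weight_order w)"
    by (rule irreflpI) (simp add: weight_order_def lex_gt_def)
  show "transp (weight_order w)"
    by (rule transpI) (auto simp: weight_order_def intro: lex_gt_trans)
  show "totalp (weight_order w)"
  proof (rule totalpI)
    fix \<nu> \<mu> :: "'a mon" assume "\<nu> \<noteq> \<mu>"
    then show "weight_order w \<nu> \<mu> \<or> weight_order w \<mu> \<nu>"
      using lex_gt_total[of \<nu> \<mu>] unfolding weight_order_def by linarith
  qed
  show "weight_order w \<nu> 0" if "\<nu> \<noteq> 0" for \<nu>
    using that mon_deg_eq_0_iff[of \<nu>] by (simp add: weight_order_def)
  show "weight_order w (\<nu> + \<rho>) (\<mu> + \<rho>)" if "weight_order w \<nu> \<mu>" for \<nu> \<mu> \<rho>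
    using that by (simp add: weight_order_def mon_deg_add weight_add lex_gt_def lookup_add)
qed

section \<open>Weights and initial forms\<close>

lemma weight_zero [simp]: "weight 0 \<nu> = 0"
  by (simp add: weight_def)

lemma weight_scale: "weight (c *\<^sub>R w) \<nu> = c * weight w \<nu>"
  by (simp add: weight_def sum_distrib_left mult.assoc)

lemma weight_plus: "weight (v + w) \<nu> = weight v \<nu> + weight w \<nu>"
  by (simp add: weight_def distrib_right sum.distrib)

definition min_mons :: "real^'n \<Rightarrow> ('n::finite, 'k::field) mpol \<Rightarrow> 'n mon set" where
  "min_mons w f = {\<nu>\<in>keys f. \<forall>\<mu>\<in>keys f. weight w \<nu> \<le> weight w \<mu>}"

lemma in_weight_eq_restr: "in_weight w f = restr (min_mons w f) f"
proof -
  have "keys f \<inter> min_mons w f = min_mons w f" by (auto simp: min_mons_def)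
  then show ?thesis by (simp add: in_weight_def restr_def min_mons_def)
qed

lemma keys_in_weight: "keys (in_weight w f) = min_mons w f"
  unfolding in_weight_eq_restr keys_restr by (auto simp: min_mons_def)

text \<open>The part of weight \<open>x\<close> is additive in \<open>f\<close>, unlike the initial
  form, so arguments with sums pass to it once the least weight is known.\<close>

lemma in_weight_eq_part:
  assumes "\<nu> \<in> keys f" "weight w \<nu> = x" "\<And>\<mu>. \<mu> \<in> keys f \<Longrightarrow> x \<le> weight w \<mu>"
  shows "in_weight w f = restr {\<nu>. weight w \<nu> = x} f"
proof -
  have "keys f \<inter> min_mons w f = keys f \<inter> {\<nu>. weight w \<nu> = x}"
    unfolding min_mons_def using assms by (auto intro: order.antisym)
  then show ?thesis unfolding in_weight_eq_restr restr_def by simp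
qed

lemma min_mons_nonempty:
  assumes "f \<noteq> 0"
  obtains \<nu> where "\<nu> \<in> min_mons w f"
proof -
  have ne: "keys f \<noteq> {}" using assms by simp
  have "Min (weight w ` keys f) \<in> weight w ` keys f" using ne by (intro Min_in) simp_all
  then obtain \<nu> where "\<nu> \<in> keys f" "weight w \<nu> = Min (weight w ` keys f)" by auto
  then show ?thesis using that[of \<nu>] by (simp add: min_mons_def)
qed

lemma in_weight_ideal_mem: "f \<in> J \<Longrightarrow> in_weight w f \<in> in_weight_ideal w J"
  unfolding in_weight_ideal_def by (intro in_Idl imageI)

lemma poly_ideal_in_weight_ideal: "poly_ideal (in_weight_ideal w J)"
  unfolding in_weight_ideal_def by (rule poly_ideal_Idl)

text \<open>Each component of \<open>h\<close> of given degree and weight is 0 or an initial form of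
  an element of \<open>J\<close>. The polynomials with this property for all degrees and weights
  form an ideal containing the initial forms; both parameters vary because multiplication by a
  monomial shifts them.\<close>

lemma in_weight_ideal_parts:
  assumes J: "graded J" and h: "h \<in> in_weight_ideal w J"
  shows "\<exists>F\<in>J. homogeneous d F \<and> (\<forall>\<kappa>\<in>keys F. x \<le> weight w \<kappa>) \<and>
    restr {\<nu>. weight w \<nu> = x} (hom_part d h) = restr {\<nu>. weight w \<nu> = x} F"
proof -
  note idl = graded_poly_ideal[OF J]
  define R where "R d x h \<longleftrightarrow> (\<exists>F\<in>J. homogeneous d F \<and> (\<forall>\<kappa>\<in>keys F. x \<le> weight w \<kappa>) \<and>
    restr {\<nu>. weight w \<nu> = x} (hom_part d h) = restr {\<nu>. weight w \<nu> = x} F)" for d x h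
  have zero: "R d x 0" for d x
    unfolding R_def by (rule bexI[of _ 0]) (simp_all add: poly_ideal_0[OF idl])
  have add: "R d x (f + g)" if fg: "R d x f" "R d x g" for d x f g
  proof -
    obtain F where F: "F \<in> J" "homogeneous d F" "\<forall>\<kappa>\<in>keys F. x \<le> weight w \<kappa>"
      "restr {\<nu>. weight w \<nu> = x} (hom_part d f) = restr {\<nu>. weight w \<nu> = x} F"
      using fg(1) unfolding R_def by blast
    obtain H where H: "H \<in> J" "homogeneous d H" "\<forall>\<kappa>\<in>keys H. x \<le> weight w \<kappa>"
      "restr {\<nu>. weight w \<nu> = x} (hom_part d g) = restr {\<nu>. weight w \<nu> = x} H"
      using fg(2) unfolding R_def by blast
    show ?thesis
      unfolding R_def
    proof (intro bexI[of _ "F + H"] conjI ballI)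
      show "F + H \<in> J" using F(1) H(1) by (rule poly_ideal_add[OF idl])
      show "homogeneous d (F + H)" using F(2) H(2) by (rule homogeneous_add)
      show "x \<le> weight w \<kappa>" if "\<kappa> \<in> keys (F + H)" for \<kappa>
        using that keys_add[of F H] F(3) H(3) by blast
      show "restr {\<nu>. weight w \<nu> = x} (hom_part d (f + g)) = restr {\<nu>. weight w \<nu> = x} (F + H)"
        by (simp add: hom_part_add restr_add F(4) H(4))
    qed
  qed
  have mult: "R d x (single a c * f)" if f: "\<And>d x. R d x f" for d x f a c
  proof (cases "mon_deg a \<le> d")
    case True
    obtain F where F: "F \<in> J" "homogeneous (d - mon_deg a) F" "\<forall>\<kappa>\<in>keys F. x - weight w a \<le> weight w \<kappa>"
      "restr {\<nu>. weight w \<nu> = x - weight w a} (hom_part (d - mon_deg a) f) =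
        restr {\<nu>. weight w \<nu> = x - weight w a} F"
      using f[of "d - mon_deg a" "x - weight w a"] unfolding R_def by blast
    have restr: "restr {\<nu>. weight w \<nu> = x} (single a c * g) =
        single a c * restr {\<nu>. weight w \<nu> = x - weight w a} g" for g
      by (rule restr_single_mult) (auto simp: weight_add)
    show ?thesis
      unfolding R_def
    proof (intro bexI[of _ "single a c * F"] conjI ballI)
      show "single a c * F \<in> J" using F(1) by (rule poly_ideal_mult[OF idl])
      show "homogeneous d (single a c * F)"
        using homogeneous_mult[OF homogeneous_single F(2), of a c] True by simp
      show "x \<le> weight w \<kappa>" if \<kappa>: "\<kappa> \<in> keys (single a c * F)" for \<kappa>
      proof -
        obtain \<mu> where "\<mu> \<in> keys F" "\<kappa> = a + \<mu>"
          using \<kappa> keys_single_mult_subset[of a c F] by blast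
        with F(3) show ?thesis by (force simp: weight_add)
      qed
      show "restr {\<nu>. weight w \<nu> = x} (hom_part d (single a c * f)) =
          restr {\<nu>. weight w \<nu> = x} (single a c * F)"
        using True by (simp add: hom_part_single_mult restr F(4))
    qed
  next
    case False
    with zero[of d x] show ?thesis by (simp add: R_def hom_part_single_mult)
  qed
  have ideal: "poly_ideal {f. \<forall>d x. R d x f}"
    unfolding poly_ideal_def
  proof (intro conjI ballI allI)
    fix f h assume f: "f \<in> {f. \<forall>d x. R d x f}"
    show "h * f \<in> {f. \<forall>d x. R d x f}"
    proof (induction h rule: poly_mapping_sum_induct)
      case (single a c)
      show ?case using f mult by simp
    next
      case (add p q)
      have "(p + q) * f = p * f + q * f" by (rule distrib_right)
      with add show ?case using \<open>\<And>d x f g. R d x f \<Longrightarrow> R d x g \<Longrightarrow> R d x (f + g)\<close> by simp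
    qed (use zero in simp)
  qed (use zero add in simp_all)
  have "R d x (in_weight w f)" if f: "f \<in> J" for f d x
  proof (cases "\<exists>\<kappa>\<in>min_mons w f. weight w \<kappa> = x")
    case True
    then obtain \<kappa> where \<kappa>: "\<kappa> \<in> keys f" "weight w \<kappa> = x" "\<And>\<mu>. \<mu> \<in> keys f \<Longrightarrow> x \<le> weight w \<mu>"
      unfolding min_mons_def by blast
    have eq: "in_weight w f = restr {\<nu>. weight w \<nu> = x} f" by (rule in_weight_eq_part[OF \<kappa>])
    show ?thesis
      unfolding R_def
    proof (intro bexI[of _ "hom_part d f"] conjI ballI)
      show "hom_part d f \<in> J" using f by (rule graded_hom_part[OF J])
      show "x \<le> weight w \<mu>" if "\<mu> \<in> keys (hom_part d f)" for \<mu>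
        using that \<kappa>(3) by (simp add: hom_part_def keys_restr)
      show "restr {\<nu>. weight w \<nu> = x} (hom_part d (in_weight w f)) = restr {\<nu>. weight w \<nu> = x} (hom_part d f)"
        unfolding eq hom_part_def restr_restr by (simp add: Int_ac)
    qed (rule homogeneous_hom_part)
  next
    case False
    then have "restr {\<nu>. weight w \<nu> = x} (hom_part d (in_weight w f)) = 0"
      by (intro restr_eq_0) (auto simp: hom_part_def keys_restr keys_in_weight)
    with zero[of d x] show ?thesis by (simp add: R_def)
  qed
  then have "in_weight_ideal w J \<subseteq> {f. \<forall>d x. R d x f}"
    unfolding in_weight_ideal_def by (intro Idl_minimal ideal) blast
  with h have "R d x h" by blast
  then show ?thesis unfolding R_def .
qed

lemma is_lm_weight_order_min:
  assumes "homogeneous d f" "is_lm (weight_order w) f \<beta>"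
  shows "\<beta> \<in> min_mons w f"
  unfolding min_mons_def
proof (intro CollectI conjI ballI)
  show \<beta>: "\<beta> \<in> keys f" using assms(2) by (simp add: is_lm_def)
  fix \<mu> assume \<mu>: "\<mu> \<in> keys f"
  have "mon_deg \<mu> = mon_deg \<beta>" using homogeneousD[OF assms(1)] \<beta> \<mu> by metis
  moreover have "\<mu> = \<beta> \<or> weight_order w \<beta> \<mu>" using assms(2) \<mu> unfolding is_lm_def by blast
  ultimately show "weight w \<beta> \<le> weight w \<mu>" by (auto simp: weight_order_def)
qed

text \<open>\<open>weight_order 0\<close> is the degree-lexicographic order, which breaks the ties
  of \<open>weight_order w\<close>: within one degree, the largest monomial is sought among those of
  least weight.\<close>

lemma is_lm_weight_order_iff:
  assumes "homogeneous d f"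
  shows "is_lm (weight_order w) f \<beta> \<longleftrightarrow> is_lm (weight_order 0) (in_weight w f) \<beta>"
proof
  assume lm: "is_lm (weight_order w) f \<beta>"
  have min: "\<beta> \<in> min_mons w f" by (rule is_lm_weight_order_min[OF assms lm])
  have "weight_order 0 \<beta> \<mu>" if \<mu>: "\<mu> \<in> min_mons w f" "\<mu> \<noteq> \<beta>" for \<mu>
  proof -
    have "mon_deg \<mu> = mon_deg \<beta>" using homogeneousD[OF assms] min \<mu>(1) unfolding min_mons_def by force
    moreover have "weight w \<mu> = weight w \<beta>" using min \<mu>(1) unfolding min_mons_def by force
    moreover have "weight_order w \<beta> \<mu>" using lm \<mu> unfolding is_lm_def min_mons_def by blast
    ultimately show ?thesis by (simp add: weight_order_def)
  qed
  with min show "is_lm (weight_order 0) (in_weight w f) \<beta>"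
    unfolding is_lm_def keys_in_weight by blast
next
  assume lm: "is_lm (weight_order 0) (in_weight w f) \<beta>"
  then have min: "\<beta> \<in> min_mons w f" unfolding is_lm_def keys_in_weight by blast
  have "weight_order w \<beta> \<mu>" if \<mu>: "\<mu> \<in> keys f" "\<mu> \<noteq> \<beta>" for \<mu>
  proof -
    have deg: "mon_deg \<mu> = mon_deg \<beta>" using homogeneousD[OF assms] min \<mu>(1) unfolding min_mons_def by force
    have le: "weight w \<beta> \<le> weight w \<mu>" using min \<mu>(1) unfolding min_mons_def by blast
    show ?thesis
    proof (cases "weight w \<beta> = weight w \<mu>")
      case True
      then have "\<mu> \<in> min_mons w f" using min \<mu>(1) unfolding min_mons_def by simp
      then have "weight_order 0 \<beta> \<mu>" using lm \<mu>(2) unfolding is_lm_def keys_in_weight by blast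
      with deg True show ?thesis by (simp add: weight_order_def)
    next
      case False
      with deg le show ?thesis by (simp add: weight_order_def)
    qed
  qed
  with min show "is_lm (weight_order w) f \<beta>"
    unfolding is_lm_def min_mons_def by blast
qed

text \<open>The initial ideal in two stages, first by weight and then by the tie-breaker. A leading
  monomial in the weight initial ideal survives in the component of its degree and weight, which
  \<open>in_weight_ideal_parts\<close> lifts to \<open>J\<close>.\<close>

lemma lms_in_weight_ideal:
  assumes J: "graded J"
  shows "lms (weight_order 0) (in_weight_ideal w J) = lms (weight_order w) J"
proof
  show "lms (weight_order w) J \<subseteq> lms (weight_order 0) (in_weight_ideal w J)"
  proof
    fix \<beta> assume \<beta>: "\<beta> \<in> lms (weight_order w) J"
    obtain f where f: "f \<in> J" "homogeneous (mon_deg \<beta>) f" "is_lm (weight_order w) f \<beta>" "lookup f \<beta> = 1"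
      by (rule lms_homogeneous[OF J \<beta>])
    have "is_lm (weight_order 0) (in_weight w f) \<beta>"
      using is_lm_weight_order_iff[OF f(2)] f(3) by blast
    then show "\<beta> \<in> lms (weight_order 0) (in_weight_ideal w J)"
      using in_weight_ideal_mem[OF f(1)] unfolding lms_def by blast
  qed
next
  show "lms (weight_order 0) (in_weight_ideal w J) \<subseteq> lms (weight_order w) J"
  proof
    fix \<beta> assume "\<beta> \<in> lms (weight_order 0) (in_weight_ideal w J)"
    then obtain h where h: "h \<in> in_weight_ideal w J" "is_lm (weight_order 0) h \<beta>"
      unfolding lms_def by blast
    define x where "x = weight w \<beta>"
    obtain F where F: "F \<in> J" "homogeneous (mon_deg \<beta>) F" "\<forall>\<kappa>\<in>keys F. x \<le> weight w \<kappa>"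
      "restr {\<nu>. weight w \<nu> = x} (hom_part (mon_deg \<beta>) h) = restr {\<nu>. weight w \<nu> = x} F"
      using in_weight_ideal_parts[OF J h(1)] by blast
    have keys: "\<kappa> \<in> keys h \<and> mon_deg \<kappa> = mon_deg \<beta> \<and> weight w \<kappa> = x \<longleftrightarrow> \<kappa> \<in> keys F \<and> weight w \<kappa> = x" for \<kappa>
      using arg_cong[OF F(4), of keys] unfolding hom_part_def keys_restr by blast
    have \<beta>: "\<beta> \<in> keys F" using keys[of \<beta>] h(2) unfolding is_lm_def x_def by blast
    have "in_weight w F = restr {\<nu>. weight w \<nu> = x} F"
      by (rule in_weight_eq_part[OF \<beta>]) (use F(3) x_def in auto)
    then have key_in: "keys (in_weight w F) = keys F \<inter> {\<nu>. weight w \<nu> = x}" by (simp add: keys_restr)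
    have "is_lm (weight_order 0) (in_weight w F) \<beta>"
      unfolding is_lm_def key_in
    proof (intro conjI ballI impI)
      show "\<beta> \<in> keys F \<inter> {\<nu>. weight w \<nu> = x}" using \<beta> by (simp add: x_def)
      fix \<mu> assume "\<mu> \<in> keys F \<inter> {\<nu>. weight w \<nu> = x}" "\<mu> \<noteq> \<beta>"
      then show "weight_order 0 \<beta> \<mu>" using keys[of \<mu>] h(2) unfolding is_lm_def by blast
    qed
    then have "is_lm (weight_order w) F \<beta>" using is_lm_weight_order_iff[OF F(2)] by blast
    with F(1) show "\<beta> \<in> lms (weight_order w) J" unfolding lms_def by blast
  qed
qed

text \<open>
  A division algorithm with respect to the elements supplied by the last assumption, in which only
  the terms of least weight matter.
\<close>

lemma in_weight_ideal_subset:
  assumes J: "graded J" and L: "poly_ideal L"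
    and lift: "\<And>\<beta>. \<beta> \<in> lms (weight_order w) J \<Longrightarrow>
      \<exists>f\<in>J. homogeneous (mon_deg \<beta>) f \<and> is_lm (weight_order w) f \<beta> \<and> in_weight w f \<in> L"
  shows "in_weight_ideal w J \<subseteq> L"
proof -
  note gt = term_order_weight_order[of w]
  note idl = graded_poly_ideal[OF J]
  let ?P = "\<lambda>x. restr {\<nu>. weight w \<nu> = x}"
  \<comment> \<open>Induction on a bound for the order ranks. The number \<open>x\<close> is only a
    lower bound for the weights, since a reduction may cancel all terms of least weight.\<close>
  have part: "?P x h \<in> L" if "h \<in> J" "homogeneous d h" "\<And>\<kappa>. \<kappa> \<in> keys h \<Longrightarrow> x \<le> weight w \<kappa>"
    "\<And>\<kappa>. \<kappa> \<in> keys h \<Longrightarrow> order_rank (weight_order w) \<kappa> < k" for d x k h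
    using that
  proof (induction k arbitrary: h)
    case 0
    then have "keys h = {}" by blast
    then show ?case using poly_ideal_0[OF L] by simp
  next
    case (Suc k)
    show ?case
    proof (cases "h = 0")
      case True
      then show ?thesis using poly_ideal_0[OF L] by simp
    next
      case False
      then obtain \<beta> where \<beta>: "is_lm (weight_order w) h \<beta>" by (rule is_lm_exists[OF gt])
      then have \<beta>h: "\<beta> \<in> keys h" by (simp add: is_lm_def)
      have deg: "mon_deg \<beta> = d" by (rule homogeneousD[OF Suc.prems(2) \<beta>h])
      have "\<beta> \<in> lms (weight_order w) J" using \<beta> Suc.prems(1) unfolding lms_def by blast
      then obtain f where f: "f \<in> J" "homogeneous (mon_deg \<beta>) f" "is_lm (weight_order w) f \<beta>"
        "in_weight w f \<in> L"
        using lift by blast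
      have fd: "homogeneous d f" using f(2) deg by simp
      have \<beta>_f: "\<beta> \<in> keys f" using f(3) by (simp add: is_lm_def)
      have f_min: "weight w \<beta> \<le> weight w \<kappa>" if "\<kappa> \<in> keys f" for \<kappa>
        using is_lm_weight_order_min[OF fd f(3)] that unfolding min_mons_def by blast
      have x_le: "x \<le> weight w \<beta>" using Suc.prems(3)[OF \<beta>h] .
      define c where "c = lookup h \<beta> / lookup f \<beta>"
      define h' where "h' = h - single 0 c * f"
      have lf: "lookup f \<beta> \<noteq> 0" using \<beta>_f unfolding in_keys_iff .
      have lh': "lookup h' \<kappa> = lookup h \<kappa> - c * lookup f \<kappa>" for \<kappa>
        by (simp add: h'_def lookup_minus lookup_scale)
      have "lookup h' \<beta> = 0" using lf by (simp add: lh' c_def)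
      then have \<beta>_h': "\<beta> \<notin> keys h'" unfolding in_keys_iff by simp
      have keys_h': "\<kappa> \<in> keys h \<or> \<kappa> \<in> keys f" if "\<kappa> \<in> keys h'" for \<kappa>
      proof (rule ccontr)
        assume "\<not> ?thesis"
        then have "lookup h' \<kappa> = 0" by (simp add: lh' not_in_keys_iff_lookup_eq_zero)
        with that show False unfolding in_keys_iff by blast
      qed
      have "?P x h' \<in> L"
      proof (rule Suc.IH)
        show "h' \<in> J"
          unfolding h'_def using Suc.prems(1) f(1) by (intro poly_ideal_diff poly_ideal_mult idl)
        show h'd: "homogeneous d h'"
          unfolding h'_def using Suc.prems(2) fd by (intro homogeneous_diff homogeneous_scale)
        fix \<kappa> assume \<kappa>: "\<kappa> \<in> keys h'"
        show "x \<le> weight w \<kappa>"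
          using keys_h'[OF \<kappa>] Suc.prems(3) f_min x_le by force
        have "weight_order w \<beta> \<kappa>"
          using keys_h'[OF \<kappa>] \<beta> f(3) \<kappa> \<beta>_h' unfolding is_lm_def by metis
        moreover have "mon_deg \<beta> = mon_deg \<kappa>" using homogeneousD[OF h'd \<kappa>] deg by simp
        ultimately have "order_rank (weight_order w) \<kappa> < order_rank (weight_order w) \<beta>"
          by (intro order_rank_less[OF gt])
        with Suc.prems(4)[OF \<beta>h] show "order_rank (weight_order w) \<kappa> < k" by simp
      qed
      moreover have "?P x f \<in> L"
      proof (cases "x = weight w \<beta>")
        case True
        have "in_weight w f = ?P x f"
          by (rule in_weight_eq_part[OF \<beta>_f]) (use True f_min in simp_all)
        with f(4) show ?thesis by simp
      next
        case False
        then have "keys f \<inter> {\<nu>. weight w \<nu> = x} = {}" using f_min x_le by fastforce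
        then show ?thesis using restr_eq_0 poly_ideal_0[OF L] by metis
      qed
      moreover have "?P x h = ?P x h' + single 0 c * ?P x f"
        by (rule poly_mapping_eqI) (simp add: lookup_restr lookup_add lookup_scale lh')
      ultimately show ?thesis by (simp add: poly_ideal_add[OF L] poly_ideal_mult[OF L])
    qed
  qed
  have "in_weight w f \<in> L" if f: "f \<in> J" for f
  proof (cases "f = 0")
    case True
    then show ?thesis using poly_ideal_0[OF L] by (simp add: in_weight_def)
  next
    case False
    then obtain \<nu> where \<nu>: "\<nu> \<in> min_mons w f" by (rule min_mons_nonempty)
    define x where "x = weight w \<nu>"
    have min: "x \<le> weight w \<kappa>" if "\<kappa> \<in> keys f" for \<kappa>
      using \<nu> that unfolding min_mons_def x_def by blast
    have "in_weight w f = ?P x f"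
      using \<nu> min by (intro in_weight_eq_part[of \<nu>]) (simp_all add: min_mons_def x_def)
    also have "\<dots> = (\<Sum>d\<in>mon_deg ` keys f. ?P x (hom_part d f))"
    proof -
      have "?P x (sum u Y) = (\<Sum>y\<in>Y. ?P x (u y))" for u :: "nat \<Rightarrow> ('a, 'b) mpol" and Y
        by (induction Y rule: infinite_finite_induct) (simp_all add: restr_add)
      then show ?thesis using sum_hom_part[of f] by metis
    qed
    also have "\<dots> \<in> L"
    proof (rule poly_ideal_sum[OF L])
      fix d
      have keys: "\<kappa> \<in> keys f" if "\<kappa> \<in> keys (hom_part d f)" for \<kappa>
        using that by (simp add: hom_part_def keys_restr)
      show "?P x (hom_part d f) \<in> L"
      proof (rule part[OF graded_hom_part[OF J f] homogeneous_hom_part])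
        show "x \<le> weight w \<kappa>" if "\<kappa> \<in> keys (hom_part d f)" for \<kappa>
          using min keys that by blast
        show "order_rank (weight_order w) \<kappa> < Suc (Max (order_rank (weight_order w) ` keys f))"
          if "\<kappa> \<in> keys (hom_part d f)" for \<kappa>
          using keys[OF that] by (simp add: less_Suc_eq_le)
      qed
    qed
    finally show ?thesis .
  qed
  then show ?thesis
    unfolding in_weight_ideal_def by (intro Idl_minimal[OF L]) blast
qed

text \<open>A common initial form makes \<beta> the leading monomial of \<open>f\<close> for both
  orders. The resulting inclusion of leading monomials is an equality by counting, so the same
  elements drive the division algorithm in both directions.\<close>

lemma in_weight_ideal_eqI:
  assumes J: "graded J"
    and lift: "\<And>\<beta>. \<beta> \<in> lms (weight_order w) J \<Longrightarrow>
      \<exists>f\<in>J. homogeneous (mon_deg \<beta>) f \<and> is_lm (weight_order w) f \<beta> \<and> in_weight w f = in_weight w' f"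
  shows "in_weight_ideal w J = in_weight_ideal w' J"
proof -
  have lift': "\<exists>f\<in>J. homogeneous (mon_deg \<beta>) f \<and> is_lm (weight_order w) f \<beta> \<and>
      is_lm (weight_order w') f \<beta> \<and> in_weight w f = in_weight w' f"
    if \<beta>: "\<beta> \<in> lms (weight_order w) J" for \<beta>
  proof -
    obtain f where f: "f \<in> J" "homogeneous (mon_deg \<beta>) f" "is_lm (weight_order w) f \<beta>"
      "in_weight w f = in_weight w' f"
      using lift[OF \<beta>] by blast
    moreover have "is_lm (weight_order w') f \<beta>"
      using is_lm_weight_order_iff[OF f(2), of w] is_lm_weight_order_iff[OF f(2), of w'] f(3,4) by simp
    ultimately show ?thesis by blast
  qed
  then have "lms (weight_order w) J \<subseteq> lms (weight_order w') J"
    unfolding lms_def[of "weight_order w'"] by blast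
  then have eq: "lms (weight_order w) J = lms (weight_order w') J"
    by (rule lms_eqI[OF term_order_weight_order term_order_weight_order J])
  show ?thesis
  proof
    show "in_weight_ideal w J \<subseteq> in_weight_ideal w' J"
    proof (rule in_weight_ideal_subset[OF J poly_ideal_in_weight_ideal])
      fix \<beta> assume "\<beta> \<in> lms (weight_order w) J"
      from lift'[OF this] show "\<exists>f\<in>J. homogeneous (mon_deg \<beta>) f \<and> is_lm (weight_order w) f \<beta> \<and>
          in_weight w f \<in> in_weight_ideal w' J"
        using in_weight_ideal_mem by metis
    qed
    show "in_weight_ideal w' J \<subseteq> in_weight_ideal w J"
    proof (rule in_weight_ideal_subset[OF J poly_ideal_in_weight_ideal])
      fix \<beta> assume "\<beta> \<in> lms (weight_order w') J"
      then have "\<beta> \<in> lms (weight_order w) J" using eq by simp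
      from lift'[OF this] show "\<exists>f\<in>J. homogeneous (mon_deg \<beta>) f \<and> is_lm (weight_order w') f \<beta> \<and>
          in_weight w' f \<in> in_weight_ideal w J"
        using in_weight_ideal_mem by metis
    qed
  qed
qed

text \<open>A monomial of \<open>f\<close> is minimal for both weights or for neither. In the second
  case it is strictly heavier than a common minimal monomial for both, hence for the combination, as
  \<open>a\<close> or \<open>b\<close> is positive.\<close>

lemma in_weight_convex:
  assumes eq: "in_weight w f = in_weight w' f" and ab: "0 \<le> a" "0 \<le> b" "a + b = 1"
  shows "in_weight w f = in_weight (a *\<^sub>R w + b *\<^sub>R w') f"
proof (cases "f = 0")
  case False
  let ?v = "a *\<^sub>R w + b *\<^sub>R w'"
  have mins: "min_mons w f = min_mons w' f"
    using arg_cong[OF eq, of keys] by (simp add: keys_in_weight)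
  have wt: "weight ?v \<mu> = a * weight w \<mu> + b * weight w' \<mu>" for \<mu>
    by (simp add: weight_plus weight_scale)
  obtain \<nu> where \<nu>: "\<nu> \<in> min_mons w f" using False by (rule min_mons_nonempty)
  then have \<nu>': "\<nu> \<in> min_mons w' f" using mins by simp
  have \<nu>k: "\<nu> \<in> keys f" and le: "\<And>\<mu>. \<mu> \<in> keys f \<Longrightarrow> weight w \<nu> \<le> weight w \<mu>"
    and le': "\<And>\<mu>. \<mu> \<in> keys f \<Longrightarrow> weight w' \<nu> \<le> weight w' \<mu>"
    using \<nu> \<nu>' unfolding min_mons_def by blast+
  have le_v: "weight ?v \<nu> \<le> weight ?v \<mu>" if "\<mu> \<in> keys f" for \<mu>
    unfolding wt using le[OF that] le'[OF that] ab by (intro add_mono mult_left_mono)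
  have "\<mu> \<in> min_mons ?v f \<longleftrightarrow> \<mu> \<in> min_mons w f" if \<mu>: "\<mu> \<in> keys f" for \<mu>
  proof
    assume min: "\<mu> \<in> min_mons w f"
    then have "\<mu> \<in> min_mons w' f" using mins by simp
    with min have "weight w \<mu> \<le> weight w \<nu>" "weight w' \<mu> \<le> weight w' \<nu>"
      using \<nu>k unfolding min_mons_def by blast+
    then have "weight ?v \<mu> \<le> weight ?v \<nu>"
      unfolding wt using ab by (intro add_mono mult_left_mono)
    with \<mu> le_v show "\<mu> \<in> min_mons ?v f" unfolding min_mons_def by force
  next
    assume min: "\<mu> \<in> min_mons ?v f"
    show "\<mu> \<in> min_mons w f"
    proof (rule ccontr)
      assume no: "\<mu> \<notin> min_mons w f"
      then have no': "\<mu> \<notin> min_mons w' f" using mins by simp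
      have "weight w \<nu> < weight w \<mu>"
        using no \<mu> le le[OF \<mu>] unfolding min_mons_def by force
      moreover have "weight w' \<nu> < weight w' \<mu>"
        using no' \<mu> le' le'[OF \<mu>] unfolding min_mons_def by force
      moreover have "weight ?v \<mu> \<le> weight ?v \<nu>" using min \<nu>k unfolding min_mons_def by blast
      ultimately have "a * (weight w \<mu> - weight w \<nu>) + b * (weight w' \<mu> - weight w' \<nu>) \<le> 0"
        "0 < weight w \<mu> - weight w \<nu>" "0 < weight w' \<mu> - weight w' \<nu>"
        unfolding wt by (simp_all add: algebra_simps)
      moreover have "0 < a \<or> 0 < b" using ab by linarith
      ultimately show False
        using ab(1,2) by (smt (verit) mult_nonneg_nonneg mult_pos_pos)
    qed
  qed
  moreover have "min_mons ?v f \<subseteq> keys f" "min_mons w f \<subseteq> keys f" by (auto simp: min_mons_def)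
  ultimately have "min_mons ?v f = min_mons w f" by blast
  then show ?thesis by (simp add: in_weight_eq_restr)
qed (simp add: in_weight_def)

text \<open>Both weights give the same set \<open>N\<close> of leading monomials, so an element
  reduced for one order has the same leading monomial for the other. The difference of its two
  initial forms lies in \<open>L\<close> but has no monomial in \<open>N\<close>, hence is 0, and
  the initial form is constant along the segment.\<close>

lemma convex_in_weight_ideal_class:
  assumes J: "graded J"
  shows "convex {w. in_weight_ideal w J = L}"
proof (rule convexI)
  fix w w' and a b :: real
  assume w: "w \<in> {w. in_weight_ideal w J = L}" "w' \<in> {w. in_weight_ideal w J = L}"
    and ab: "0 \<le> a" "0 \<le> b" "a + b = 1"
  define N where "N = lms (weight_order 0) L"
  have N: "lms (weight_order w) J = N" "lms (weight_order w') J = N"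
    using w unfolding N_def lms_in_weight_ideal[OF J, symmetric] by simp_all
  have L: "poly_ideal L" using w(1) poly_ideal_in_weight_ideal by blast
  have "in_weight_ideal w J = in_weight_ideal (a *\<^sub>R w + b *\<^sub>R w') J"
  proof (rule in_weight_ideal_eqI[OF J])
    fix \<beta> assume \<beta>: "\<beta> \<in> lms (weight_order w) J"
    obtain f where f: "f \<in> J" "homogeneous (mon_deg \<beta>) f" "is_lm (weight_order w) f \<beta>" "lookup f \<beta> = 1"
      "keys f \<inter> lms (weight_order w) J = {\<beta>}"
      by (rule reduced_element[OF term_order_weight_order J \<beta>])
    have "f \<noteq> 0" using f(4) by auto
    then obtain \<gamma> where \<gamma>: "is_lm (weight_order w') f \<gamma>" by (rule is_lm_exists[OF term_order_weight_order])
    then have "\<gamma> \<in> lms (weight_order w') J" "\<gamma> \<in> keys f" using f(1) unfolding lms_def is_lm_def by blast+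
    then have "\<gamma> = \<beta>" using f(5) N by blast
    with \<gamma> have lm': "is_lm (weight_order w') f \<beta>" by simp
    have min: "\<beta> \<in> min_mons w f" "\<beta> \<in> min_mons w' f"
      using is_lm_weight_order_min[OF f(2)] f(3) lm' by blast+
    define h where "h = in_weight w f - in_weight w' f"
    have "h \<in> L"
      unfolding h_def using in_weight_ideal_mem[OF f(1)] w by (intro poly_ideal_diff[OF L]) auto
    have h_keys: "\<kappa> \<in> keys f \<and> \<kappa> \<noteq> \<beta>" if "\<kappa> \<in> keys h" for \<kappa>
    proof -
      have lh: "lookup h \<kappa> = (if \<kappa> \<in> min_mons w f then lookup f \<kappa> else 0) -
          (if \<kappa> \<in> min_mons w' f then lookup f \<kappa> else 0)"
        by (simp add: h_def in_weight_eq_restr lookup_minus lookup_restr)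
      have ne: "lookup h \<kappa> \<noteq> 0" using that unfolding in_keys_iff .
      then have "\<kappa> \<noteq> \<beta>" using lh min by auto
      moreover have "lookup f \<kappa> \<noteq> 0" using ne lh by (auto split: if_splits)
      ultimately show ?thesis unfolding in_keys_iff by blast
    qed
    have "h = 0"
    proof (rule ccontr)
      assume "h \<noteq> 0"
      then obtain \<kappa> where \<kappa>: "is_lm (weight_order 0) h \<kappa>" by (rule is_lm_exists[OF term_order_weight_order])
      then have "\<kappa> \<in> N" "\<kappa> \<in> keys h" using \<open>h \<in> L\<close> unfolding N_def lms_def is_lm_def by blast+
      with h_keys f(5) N(1) show False by blast
    qed
    then have "in_weight w f = in_weight w' f" by (simp add: h_def)
    from in_weight_convex[OF this ab] f(1-3)
    show "\<exists>f\<in>J. homogeneous (mon_deg \<beta>) f \<and> is_lm (weight_order w) f \<beta> \<and>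
        in_weight w f = in_weight (a *\<^sub>R w + b *\<^sub>R w') f" by blast
  qed
  with w(1) show "a *\<^sub>R w + b *\<^sub>R w' \<in> {w. in_weight_ideal w J = L}" by simp
qed


section \<open>Monomial initial ideals\<close>

lemma graded_monomial_ideal:
  assumes "\<And>\<nu> a. \<nu> \<in> N \<Longrightarrow> a + \<nu> \<in> N"
  shows "graded {h. keys h \<subseteq> N}"
  unfolding graded_def poly_ideal_def
proof (intro conjI ballI allI)
  show "0 \<in> {h. keys h \<subseteq> N}" by simp
  show "f + g \<in> {h. keys h \<subseteq> N}" if "f \<in> {h. keys h \<subseteq> N}" "g \<in> {h. keys h \<subseteq> N}" for f g
    using that keys_add[of f g] by blast
  show "h * f \<in> {h. keys h \<subseteq> N}" if "f \<in> {h. keys h \<subseteq> N}" for f h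
    using that keys_mult[of h f] assms by blast
  show "hom_part d f \<in> {h. keys h \<subseteq> N}" if "f \<in> {h. keys h \<subseteq> N}" for f d
    using that by (auto simp: hom_part_def keys_restr)
qed

lemma in_order_eq_single:
  assumes "term_order gt" "is_lm gt f \<nu>"
  shows "in_order gt f = single \<nu> (lookup f \<nu>)"
proof -
  have "{\<nu>\<in>keys f. \<forall>\<mu>\<in>keys f. \<mu> \<noteq> \<nu> \<longrightarrow> gt \<nu> \<mu>} = {\<mu>. is_lm gt f \<mu>}"
    by (simp add: is_lm_def)
  also have "\<dots> = {\<nu>}" using is_lm_unique[OF assms(1)] assms(2) by blast
  finally show ?thesis by (simp add: in_order_def)
qed

lemma in_order_ideal_eq:
  fixes J :: "('n::finite, 'k::field) mpol set"
  assumes gt: "term_order gt" and J: "poly_ideal J"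
  shows "in_order_ideal gt J = {h. keys h \<subseteq> lms gt J}"
proof
  have G: "poly_ideal {h. keys h \<subseteq> lms gt J}"
    by (rule graded_poly_ideal[OF graded_monomial_ideal]) (rule lms_add[OF gt J])
  show "in_order_ideal gt J \<subseteq> {h. keys h \<subseteq> lms gt J}"
    unfolding in_order_ideal_def
  proof (rule Idl_minimal[OF G], rule image_subsetI)
    fix f assume f: "f \<in> J"
    show "in_order gt f \<in> {h. keys h \<subseteq> lms gt J}"
    proof (cases "f = 0")
      case False
      then obtain \<nu> where \<nu>: "is_lm gt f \<nu>" by (rule is_lm_exists[OF gt])
      then have "\<nu> \<in> lms gt J" using f unfolding lms_def by blast
      then show ?thesis by (simp add: in_order_eq_single[OF gt \<nu>])
    qed (simp add: in_order_def)
  qed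
next
  show "{h. keys h \<subseteq> lms gt J} \<subseteq> in_order_ideal gt J"
  proof
    fix h :: "('n, 'k) mpol" assume h: "h \<in> {h. keys h \<subseteq> lms gt J}"
    have idl: "poly_ideal (in_order_ideal gt J)"
      unfolding in_order_ideal_def by (rule poly_ideal_Idl)
    have "(\<Sum>\<nu>\<in>keys h. single \<nu> (lookup h \<nu>)) \<in> in_order_ideal gt J"
    proof (rule poly_ideal_sum[OF idl])
      fix \<nu> assume "\<nu> \<in> keys h"
      then have "\<nu> \<in> lms gt J" using h by blast
      then obtain f where f: "f \<in> J" "is_lm gt f \<nu>" unfolding lms_def by blast
      have "lookup f \<nu> \<noteq> 0" using f(2) unfolding is_lm_def in_keys_iff by blast
      then have "single \<nu> (lookup h \<nu>) = single 0 (lookup h \<nu> / lookup f \<nu>) * in_order gt f"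
        by (simp add: in_order_eq_single[OF gt f(2)] mult_single)
      moreover have "in_order gt f \<in> in_order_ideal gt J"
        unfolding in_order_ideal_def using f(1) by (intro in_Idl imageI)
      ultimately show "single \<nu> (lookup h \<nu>) \<in> in_order_ideal gt J"
        using poly_ideal_mult[OF idl] by simp
    qed
    then show "h \<in> in_order_ideal gt J" by (simp add: poly_mapping_sum_single)
  qed
qed

lemma min_mon_gens_generate:
  fixes N :: "'n::finite mon set"
  assumes "\<nu> \<in> N"
  shows "\<exists>\<mu>\<in>min_mon_gens {h :: ('n, 'k::field) mpol. keys h \<subseteq> N}. \<exists>a. \<nu> = a + \<mu>"
  using assms
proof (induction "mon_deg \<nu>" arbitrary: \<nu> rule: less_induct)
  case less
  let ?M = "min_mon_gens {h :: ('n, 'k) mpol. keys h \<subseteq> N}"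
  show ?case
  proof (cases "\<nu> \<in> ?M")
    case True
    then show ?thesis by (intro bexI[of _ \<nu>] exI[of _ 0]) simp_all
  next
    case False
    then obtain \<mu> where \<mu>: "\<mu> \<in> N" "\<And>i. lookup \<mu> i \<le> lookup \<nu> i" "\<mu> \<noteq> \<nu>"
      using less.prems unfolding min_mon_gens_def by auto
    obtain \<rho> where \<rho>: "\<nu> = \<mu> + \<rho>" by (rule exists_diff_mon[OF \<mu>(2)])
    then have "mon_deg \<rho> \<noteq> 0" using \<mu>(3) by (metis add.right_neutral mon_deg_eq_0_iff)
    then have "mon_deg \<mu> < mon_deg \<nu>" using \<rho> by (simp add: mon_deg_add)
    from less.hyps[OF this \<mu>(1)] obtain \<kappa> a where "\<kappa> \<in> ?M" "\<mu> = a + \<kappa>" by blast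
    with \<rho> show ?thesis
      by (intro bexI[of _ \<kappa>] exI[of _ "a + \<rho>"]) (simp_all add: add_ac)
  qed
qed

text \<open>
  Modulo the monomial ideal, all variables that are not smaller than \<open>x\<^sub>b\<close> annihilate \<open>\<nu> / x\<^sub>b\<close>, which
  bounds the depth.
\<close>

lemma min_mon_gens_depth:
  fixes N :: "'n::finite mon set"
  defines "G \<equiv> {h :: ('n, 'k::field) mpol. keys h \<subseteq> N}"
  assumes add: "\<And>\<nu> a. \<nu> \<in> N \<Longrightarrow> a + \<nu> \<in> N"
    and stable: "\<And>\<rho> i j. \<rho> + single j 1 \<in> N \<Longrightarrow> gt (single i 1) (single j 1) \<Longrightarrow> \<rho> + single i 1 \<in> N"
    and t: "enat t \<le> depth_ideal G" "0 < t"
    and \<nu>: "\<nu> \<in> min_mon_gens G" and b: "lookup \<nu> b \<noteq> 0"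
  shows "t \<le> card {i. i \<noteq> b \<and> \<not> gt (single i 1) (single b 1)}"
proof -
  obtain ls where ls: "\<forall>l\<in>set ls. homogeneous 1 l" "t \<le> length ls"
    "regular_sequence (mpol_ring Quot G) (map (\<lambda>l. G +>\<^bsub>mpol_ring\<^esub> l) ls)"
    by (rule depth_ideal_ge[OF t])
  have "lookup (single b 1) i \<le> lookup \<nu> i" for i
    using b by (auto simp: lookup_single when_def)
  then obtain \<rho> where "\<nu> = single b 1 + \<rho>" by (rule exists_diff_mon)
  then have \<rho>: "\<nu> = \<rho> + single b 1" by (simp add: add.commute)
  have \<nu>N: "\<nu> \<in> N" and min: "\<And>\<mu>. \<mu> \<in> N \<Longrightarrow> (\<forall>i. lookup \<mu> i \<le> lookup \<nu> i) \<Longrightarrow> \<mu> = \<nu>"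
    using \<nu> unfolding min_mon_gens_def G_def by auto
  have "\<rho> \<notin> N"
  proof
    assume "\<rho> \<in> N"
    then have "\<rho> = \<nu>" by (rule min) (simp add: \<rho> lookup_add)
    moreover have "mon_deg \<nu> = mon_deg \<rho> + 1" by (simp add: \<rho> mon_deg_add)
    ultimately show False by simp
  qed
  let ?P = "{i. i = b \<or> gt (single i 1) (single b 1)}"
  have "length ls \<le> card (- ?P)"
  proof (rule regular_sequence_length_le[OF _ ls(1,3)])
    show "graded G" unfolding G_def by (rule graded_monomial_ideal[OF add])
    show "single \<rho> 1 \<notin> G" using \<open>\<rho> \<notin> N\<close> by (simp add: G_def)
    fix i assume "i \<in> ?P"
    then have "\<rho> + single i 1 \<in> N" using stable[of \<rho> b i] \<nu>N \<rho> by blast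
    then show "single (single i 1) 1 * single \<rho> 1 \<in> G"
      by (simp add: G_def mult_single add.commute)
  qed
  moreover have "- ?P = {i. i \<noteq> b \<and> \<not> gt (single i 1) (single b 1)}" by blast
  ultimately show ?thesis using ls(2) by simp
qed

lemma min_mons_single_mult:
  "min_mons w (single a 1 * f) = (+) a ` min_mons w f"
  unfolding min_mons_def keys_single_mult[OF one_neq_zero] by (auto simp: weight_add)

lemma is_gin_imp_gin_degree_le:
  assumes "term_order gt" "is_gin gt I G" "max_gin_degree I = enat c" "\<nu> \<in> min_mon_gens G"
  shows "mon_deg \<nu> \<le> c"
proof -
  have G: "G \<in> gins I" using assms(1,2) unfolding gins_def by blast
  have "enat (mon_deg \<nu>) \<le> (SUP \<nu>\<in>min_mon_gens G. enat (mon_deg \<nu>))"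
    using assms(4) by (rule SUP_upper)
  also have "\<dots> \<le> max_gin_degree I"
    unfolding max_gin_degree_def using G by (rule SUP_upper)
  finally show ?thesis by (simp add: assms(3))
qed

text \<open>
  The least weight of an element with leading monomial \<open>\<nu>\<close> is at most \<open>c a\<close>, hence it is not attained
  at monomials that involve a variable in \<open>L\<close>.
\<close>

lemma in_weight_ideal_eq_add:
  fixes J :: "('n::finite, 'k::field) mpol set"
  assumes J: "graded J" and N: "lms (weight_order w) J = N"
    and gens: "\<And>\<nu>. \<nu> \<in> min_mon_gens {h :: ('n, 'k) mpol. keys h \<subseteq> N} \<Longrightarrow>
      mon_deg \<nu> \<le> c \<and> (\<forall>i\<in>L. lookup \<nu> i = 0)"
    and a: "0 \<le> a" and w: "\<And>i. 0 \<le> w $ i" "\<And>i. i \<notin> L \<Longrightarrow> w $ i \<le> a" "\<And>i. i \<in> L \<Longrightarrow> real c * a < w $ i"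
    and v: "\<And>i. 0 \<le> v $ i" "\<And>i. i \<notin> L \<Longrightarrow> v $ i = 0"
  shows "in_weight_ideal w J = in_weight_ideal (w + v) J"
proof (rule in_weight_ideal_eqI[OF J])
  fix \<beta> assume "\<beta> \<in> lms (weight_order w) J"
  then have "\<beta> \<in> N" using N by simp
  then obtain \<nu> b where \<nu>: "\<nu> \<in> min_mon_gens {h :: ('n, 'k) mpol. keys h \<subseteq> N}" "\<beta> = b + \<nu>"
    using min_mon_gens_generate by blast
  have "\<nu> \<in> N" using \<nu>(1) unfolding min_mon_gens_def by simp
  then have "\<nu> \<in> lms (weight_order w) J" using N by simp
  then obtain f where f: "f \<in> J" "homogeneous (mon_deg \<nu>) f" "is_lm (weight_order w) f \<nu>" "lookup f \<nu> = 1"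
    by (rule lms_homogeneous[OF J])
  have \<nu>_min: "\<nu> \<in> min_mons w f" by (rule is_lm_weight_order_min[OF f(2,3)])
  \<comment> \<open>A generator involves only variables outside \<open>L\<close>, each of weight at
    most \<open>a\<close>, and at most \<open>c\<close> of them with multiplicity.\<close>
  have "weight w \<nu> \<le> (\<Sum>i\<in>UNIV. a * real (lookup \<nu> i))"
    unfolding weight_def
  proof (rule sum_mono)
    fix i
    show "w $ i * real (lookup \<nu> i) \<le> a * real (lookup \<nu> i)"
      using gens[OF \<nu>(1)] w(2) by (cases "i \<in> L") (simp_all add: mult_right_mono)
  qed
  also have "\<dots> = a * real (mon_deg \<nu>)" by (simp add: mon_deg_def sum_distrib_left)
  also have "\<dots> \<le> a * real c" using gens[OF \<nu>(1)] a by (intro mult_left_mono) simp_all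
  finally have \<nu>_le: "weight w \<nu> \<le> real c * a" by (simp add: mult.commute)
  \<comment> \<open>A single variable in \<open>L\<close> already weighs more than
    \<open>c * a\<close>, and no weight is negative.\<close>
  have v_0: "weight v \<kappa> = 0" if "weight w \<kappa> \<le> weight w \<nu>" for \<kappa>
  proof -
    have "lookup \<kappa> i = 0" if i: "i \<in> L" for i
    proof (rule ccontr)
      assume "lookup \<kappa> i \<noteq> 0"
      then have "w $ i * 1 \<le> w $ i * real (lookup \<kappa> i)" using w(1) by (intro mult_left_mono) simp_all
      also have "\<dots> \<le> weight w \<kappa>"
        unfolding weight_def using w(1) by (intro member_le_sum) simp_all
      finally show False using \<open>weight w \<kappa> \<le> weight w \<nu>\<close> \<nu>_le w(3)[OF i] by simp
    qed
    then show ?thesis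
      unfolding weight_def using v(2) by (intro sum.neutral) (metis mult_eq_0_iff of_nat_0)
  qed
  have v_nonneg: "0 \<le> weight v \<kappa>" for \<kappa>
    unfolding weight_def using v(1) by (intro sum_nonneg mult_nonneg_nonneg) simp_all
  \<comment> \<open>\<open>v\<close> has weight 0 on all monomials not heavier than \<nu> and
    nonnegative weight elsewhere, so adding it neither removes nor creates a minimum.\<close>
  have "min_mons w f = min_mons (w + v) f"
  proof (intro Set.set_eqI iffI)
    fix \<kappa> assume \<kappa>: "\<kappa> \<in> min_mons w f"
    then have "weight w \<kappa> \<le> weight w \<nu>" using \<nu>_min unfolding min_mons_def by blast
    then have "weight v \<kappa> = 0" by (rule v_0)
    with \<kappa> show "\<kappa> \<in> min_mons (w + v) f"
      unfolding min_mons_def weight_plus using v_nonneg by (simp add: add_increasing2)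
  next
    fix \<kappa> assume \<kappa>: "\<kappa> \<in> min_mons (w + v) f"
    have "\<nu> \<in> keys f" using \<nu>_min by (simp add: min_mons_def)
    with \<kappa> have "weight w \<kappa> + weight v \<kappa> \<le> weight w \<nu> + weight v \<nu>"
      unfolding min_mons_def weight_plus by blast
    with v_0[of \<nu>] v_nonneg[of \<kappa>] have "weight w \<kappa> \<le> weight w \<nu>" by simp
    then show "\<kappa> \<in> min_mons w f"
      using \<kappa> \<nu>_min unfolding min_mons_def by force
  qed
  then have eq: "in_weight w (single b 1 * f) = in_weight (w + v) (single b 1 * f)"
    by (simp add: in_weight_eq_restr min_mons_single_mult)
  show "\<exists>f\<in>J. homogeneous (mon_deg \<beta>) f \<and> is_lm (weight_order w) f \<beta> \<and> in_weight w f = in_weight (w + v) f"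
  proof (intro bexI[of _ "single b 1 * f"] conjI eq)
    show "homogeneous (mon_deg \<beta>) (single b 1 * f)"
      unfolding \<nu>(2) mon_deg_add by (rule homogeneous_mult[OF homogeneous_single f(2)])
    show "is_lm (weight_order w) (single b 1 * f) \<beta>"
      unfolding \<nu>(2) using f(3) by (intro is_lm_single_mult term_order_weight_order) simp_all
    show "single b 1 * f \<in> J" using f(1) by (rule poly_ideal_mult[OF graded_poly_ideal[OF J]])
  qed
qed

lemma pos_cone_axis_nonneg:
  assumes "v \<in> pos_cone ((\<lambda>i. axis (x i) (1 :: real)) ` X)"
  shows "0 \<le> v $ i" "i \<notin> x ` X \<Longrightarrow> v $ i = 0"
proof -
  obtain T a where T: "finite T" "T \<subseteq> (\<lambda>i. axis (x i) 1) ` X" "\<forall>u\<in>T. 0 \<le> a u"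
    and v: "v = (\<Sum>u\<in>T. a u *\<^sub>R u)"
    using assms unfolding pos_cone_def by blast
  have vi: "v $ i = (\<Sum>u\<in>T. a u * u $ i)" by (simp add: v)
  have u: "0 \<le> u $ i" "i \<notin> x ` X \<Longrightarrow> u $ i = 0" if "u \<in> T" for u
  proof -
    obtain k where "u = axis (x k) 1" "k \<in> X" using \<open>u \<in> T\<close> T(2) by blast
    then show "0 \<le> u $ i" "i \<notin> x ` X \<Longrightarrow> u $ i = 0" by (auto simp: axis_def)
  qed
  show "0 \<le> v $ i" unfolding vi using T(3) u(1) by (intro sum_nonneg mult_nonneg_nonneg) simp_all
  show "v $ i = 0" if "i \<notin> x ` X" unfolding vi using u(2) that by (intro sum.neutral) simp
qed


theorem proposition5p8:
  fixes I :: "('n::finite, 'k::{alg_closed_field, field_char_0}) mpol set"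
    and F :: "(real^'n) set set"
    and C :: "(real^'n) set"
    and \<omega> :: "real^'n"
    and var :: "nat \<Rightarrow> 'n"
    and n m t c :: nat
  assumes n: "n = CARD('n)"
    and var: "bij_betw var {1..n} UNIV"
    and graded: "graded_ideal I"
    and nonzero: "I \<noteq> {0}"
    and max_gdepth: "maximal_gdepth I"
    and dim: "dim_ideal I = enat m"
    and depth: "depth_ideal I = enat t"
    and t: "0 < t" "t + 1 < m"
    and c: "max_gin_degree I = enat c"
    and gT: "is_gT I F"
    and \<omega>: "\<omega> \<in> \<Union>F"
    and \<omega>_zero: "\<forall>i\<in>{1..n - m + 1}. \<omega> $ var i = 0"
    and \<omega>_pos: "0 < \<omega> $ var (n - m + 2)"
    and \<omega>_mono: "\<forall>i\<in>{n - m + 2..n - t}. \<forall>j\<in>{n - m + 2..n - t}. i \<le> j \<longrightarrow> \<omega> $ var i \<le> \<omega> $ var j"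
    and \<omega>_gap: "\<forall>j\<in>{n - t + 1..n}. \<omega> $ var (n - t) < \<omega> $ var j"
    and \<omega>_c: "\<forall>j\<in>{n - t + 1..n}. real c * \<omega> $ var (n - t) < \<omega> $ var j"
    and C: "maximal_cone F C"
    and \<omega>_C: "\<omega> \<in> rel_interior C"
  shows "(\<lambda>v. \<omega> + v) ` pos_cone ((\<lambda>i. axis (var i) 1) ` {n - t + 1..n}) \<subseteq> rel_interior C"
proof -
  define L where "L = var ` {n - t + 1..n}"
  define a where "a = \<omega> $ var (n - t)"
  have I: "graded I" using graded by (rule graded_ideal_imp_graded)
  have surj: "\<exists>k\<in>{1..n}. i = var k" for i
    using bij_betw_imp_surj_on[OF var] by (metis UNIV_I imageE)
  have "t < n"
  proof (rule ccontr)
    assume "\<not> t < n"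
    then have 0: "n - t = 0" by simp
    \<comment> \<open>With \<open>n - t\<close> truncated to 0, the range of the gap hypothesis is
      all of \<open>1..n\<close>. The value \<open>var 0\<close> is outside the enumeration but
      equals some \<open>var k\<close>, whose weight would be less than itself.\<close>
    obtain k where "k \<in> {1..n}" "var (n - t) = var k" using surj by blast
    with \<omega>_gap 0 show False by force
  qed
  have card_L: "card L = t"
  proof -
    have "inj_on var {n - t + 1..n}"
      by (rule inj_on_subset[OF bij_betw_imp_inj_on[OF var]]) auto
    then show ?thesis using \<open>t < n\<close> by (simp add: L_def card_image)
  qed
  have low: "0 \<le> \<omega> $ var k \<and> \<omega> $ var k \<le> a" if k: "1 \<le> k" "k \<le> n - t" for k
  proof -
    have nonneg: "0 \<le> \<omega> $ var k" if k: "1 \<le> k" "k \<le> n - t" for k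
    proof (cases "k \<le> n - m + 1")
      case True
      with k \<omega>_zero show ?thesis by simp
    next
      case False
      with k \<omega>_mono have "\<omega> $ var (n - m + 2) \<le> \<omega> $ var k" by simp
      with \<omega>_pos show ?thesis by simp
    qed
    have "\<omega> $ var k \<le> a"
    proof (cases "k \<le> n - m + 1")
      case True
      with k \<omega>_zero have "\<omega> $ var k = 0" by simp
      moreover have "0 \<le> a" unfolding a_def using \<open>t < n\<close> by (intro nonneg) simp_all
      ultimately show ?thesis by simp
    next
      case False
      with k \<omega>_mono show ?thesis unfolding a_def by simp
    qed
    with nonneg[OF k] show ?thesis by blast
  qed
  have "1 \<le> n - t" using \<open>t < n\<close> by simp
  from low[OF this order.refl] have a_nonneg: "0 \<le> a" unfolding a_def by blast
  have \<omega>_L: "a < \<omega> $ i" "real c * a < \<omega> $ i" if "i \<in> L" for i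
    using that \<omega>_gap \<omega>_c unfolding L_def a_def by blast+
  have \<omega>_not_L: "0 \<le> \<omega> $ i \<and> \<omega> $ i \<le> a" if "i \<notin> L" for i
  proof -
    obtain k where k: "k \<in> {1..n}" "i = var k" using surj by blast
    with that have "k \<le> n - t" unfolding L_def by (cases "k \<le> n - t") auto
    with k low show ?thesis by simp
  qed
  have \<omega>_nonneg: "0 \<le> \<omega> $ i" for i
    using \<omega>_not_L[of i] \<omega>_L(1)[of i] a_nonneg by (cases "i \<in> L") auto
  let ?gt = "weight_order \<omega>"
  note gt = term_order_weight_order[of \<omega>]
  obtain N where N: "generically (\<lambda>g :: 'k^'n^'n. lms ?gt (act g ` I) = N)"
    "\<forall>d. \<exists>g :: 'k^'n^'n. invertible g \<and> max_rank ?gt I d g \<and>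
       lms ?gt (act g ` I) \<inter> {\<nu>. mon_deg \<nu> = d} = N \<inter> {\<nu>. mon_deg \<nu> = d}"
    by (rule generic_lms[OF gt I])
  define G where "G = {h :: ('n, 'k) mpol. keys h \<subseteq> N}"
  have gin: "is_gin ?gt I G"
    unfolding is_gin_def G_def
    by (rule generically_mono[OF N(1)])
      (simp add: in_order_ideal_eq[OF gt graded_poly_ideal[OF graded_act[OF _ I]]])
  then have "G \<in> gins I" using gt unfolding gins_def by blast
  then have "gdepth I \<le> depth_ideal G" unfolding gdepth_def by (rule INF_lower)
  then have depth_G: "enat t \<le> depth_ideal G"
    using max_gdepth depth by (simp add: maximal_gdepth_def)
  obtain g\<^sub>0 :: "'k^'n^'n" where "invertible g\<^sub>0" "lms ?gt (act g\<^sub>0 ` I) = N"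
    using generically_ex[OF N(1)] by blast
  then have N_add: "b + \<nu> \<in> N" if "\<nu> \<in> N" for \<nu> b
    using that lms_add[OF gt graded_poly_ideal[OF graded_act[OF _ I]]] by blast
  have stable: "\<rho> + single i 1 \<in> N"
    if \<rho>: "\<rho> + single j 1 \<in> N" "?gt (single i 1) (single j 1)" for \<rho> i j
  proof -
    let ?d = "Suc (mon_deg \<rho>)"
    obtain g :: "'k^'n^'n" where g: "invertible g" "max_rank ?gt I ?d g"
      "lms ?gt (act g ` I) \<inter> {\<nu>. mon_deg \<nu> = ?d} = N \<inter> {\<nu>. mon_deg \<nu> = ?d}"
      using N(2) by blast
    have deg: "mon_deg (\<rho> + single k 1) = ?d" for k by (simp add: mon_deg_add)
    have "\<rho> + single j 1 \<in> lms ?gt (act g ` I)" using g(3) \<rho>(1) deg by blast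
    then have "\<rho> + single i 1 \<in> lms ?gt (act g ` I)"
      using \<rho>(2) by (rule strongly_stable[OF gt I g(1,2)])
    then show ?thesis using g(3) deg by blast
  qed
  have gens: "mon_deg \<nu> \<le> c \<and> (\<forall>b\<in>L. lookup \<nu> b = 0)" if \<nu>: "\<nu> \<in> min_mon_gens G" for \<nu>
  proof (intro conjI ballI)
    show "mon_deg \<nu> \<le> c" by (rule is_gin_imp_gin_degree_le[OF gt gin c \<nu>])
    fix b assume b: "b \<in> L"
    show "lookup \<nu> b = 0"
    proof (rule ccontr)
      assume "lookup \<nu> b \<noteq> 0"
      then have "t \<le> card {i. i \<noteq> b \<and> \<not> ?gt (single i 1) (single b 1)}"
        by (intro min_mon_gens_depth[OF N_add stable depth_G[unfolded G_def] t(1) \<nu>[unfolded G_def]])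
      \<comment> \<open>Variables outside \<open>L\<close> have smaller weight, hence are larger in
        the order. At most the \<open>t - 1\<close> variables of \<open>L\<close> other than
        \<open>b\<close> remain, against the bound \<open>t\<close>.\<close>
      also have "{i. i \<noteq> b \<and> \<not> ?gt (single i 1) (single b 1)} \<subseteq> L - {b}"
      proof
        fix i assume i: "i \<in> {i. i \<noteq> b \<and> \<not> ?gt (single i 1) (single b 1)}"
        have "i \<in> L"
        proof (rule ccontr)
          assume "i \<notin> L"
          then have "\<omega> $ i < \<omega> $ b" using \<omega>_not_L[of i] \<omega>_L(1)[OF b] by simp
          then have "?gt (single i 1) (single b 1)" by (simp add: weight_order_def weight_single)
          with i show False by blast
        qed
        with i show "i \<in> L - {b}" by blast
      qed
      then have "card {i. i \<noteq> b \<and> \<not> ?gt (single i 1) (single b 1)} \<le> card (L - {b})"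
        by (intro card_mono) simp_all
      also have "\<dots> < card L" using b by (intro card_Diff1_less) simp_all
      finally show False using card_L by simp
    qed
  qed
  \<comment> \<open>A single matrix has to realise both the tropical fan and the leading monomials
    \<open>N\<close>.\<close>
  have "generically (\<lambda>g :: 'k^'n^'n. tropical_fan (act g ` I) = F \<and> lms ?gt (act g ` I) = N)"
    using gT N(1) unfolding is_gT_def by (rule generically_conj)
  then obtain g :: "'k^'n^'n" where g: "invertible g" "tropical_fan (act g ` I) = F" "lms ?gt (act g ` I) = N"
    using generically_ex by blast
  define J where "J = act g ` I"
  have J: "graded J" unfolding J_def by (rule graded_act[OF g(1) I])
  have "C \<in> groebner_fan J"
    using C g(2) unfolding maximal_cone_def tropical_fan_def J_def by blast
  then obtain \<omega>\<^sub>0 where C_eq: "C = closure {\<omega>'. in_weight_ideal \<omega>' J = in_weight_ideal \<omega>\<^sub>0 J}"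
    unfolding groebner_fan_def by blast
  define A where "A = {\<omega>'. in_weight_ideal \<omega>' J = in_weight_ideal \<omega>\<^sub>0 J}"
  have convex: "convex A" unfolding A_def by (rule convex_in_weight_ideal_class[OF J])
  \<comment> \<open>Closure does not change the relative interior of a convex set. Hence \<omega>
    belongs to the class itself and not merely to its closure.\<close>
  have rel: "rel_interior C = rel_interior A"
    unfolding C_eq A_def[symmetric] by (rule convex_rel_interior_closure[OF convex])
  have \<omega>_A: "\<omega> \<in> A" using \<omega>_C rel rel_interior_subset by blast
  show ?thesis
  proof (rule image_subsetI)
    fix v assume "v \<in> pos_cone ((\<lambda>i. axis (var i) (1 :: real)) ` {n - t + 1..n})"
    then have v: "\<And>i. 0 \<le> v $ i" "\<And>i. i \<notin> L \<Longrightarrow> v $ i = 0"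
      unfolding L_def using pos_cone_axis_nonneg by blast+
    have "in_weight_ideal \<omega> J = in_weight_ideal (\<omega> + 2 *\<^sub>R v) J"
    proof (rule in_weight_ideal_eq_add[OF J g(3)[folded J_def] gens[unfolded G_def] a_nonneg \<omega>_nonneg])
      show "\<omega> $ i \<le> a" if "i \<notin> L" for i using \<omega>_not_L[OF that] by blast
      show "real c * a < \<omega> $ i" if "i \<in> L" for i using that by (rule \<omega>_L(2))
      show "0 \<le> (2 *\<^sub>R v) $ i" for i using v(1) by simp
      show "(2 *\<^sub>R v) $ i = 0" if "i \<notin> L" for i using v(2)[OF that] by simp
    qed
    then have "\<omega> + 2 *\<^sub>R v \<in> A" using \<omega>_A unfolding A_def by simp
    with convex \<omega>_C[unfolded rel]
    have "\<omega> + 2 *\<^sub>R v - (1 / 2) *\<^sub>R (\<omega> + 2 *\<^sub>R v - \<omega>) \<in> rel_interior A"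
      by (rule rel_interior_convex_shrink) simp_all
    moreover have "\<omega> + 2 *\<^sub>R v - (1 / 2) *\<^sub>R (\<omega> + 2 *\<^sub>R v - \<omega>) = \<omega> + v"
      by (simp add: scaleR_2)
    ultimately show "\<omega> + v \<in> rel_interior C" by (simp only: rel)
  qed
qed

end
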